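(* In $\mathcal{H}eis_k$, with $c',d',t',x'$ and the dotted bubbles $\circlearrowleft_n,\circlearrowright_n$ ($n\in\mathbb Z$) as in the context, the following relations hold. (i) For all $r\in\mathbb Z$: $\circlearrowright_r=-\delta_{r,k-1}1_{\mathbf 1}$ if $r<k$; $\circlearrowleft_r=\delta_{r,-k-1}1_{\mathbf 1}$ if $r<-k$; and for all integers $m$, $\sum_{r,s\ge0,\ r+s=m}\circlearrowright_{r+k-1}\,\circlearrowleft_{s-k-1}=-\delta_{m,0}1_{\mathbf 1}$. (ii) $(1_\uparrow\otimes d')\circ(c'\otimes 1_\uparrow)=1_\uparrow$ and $(d'\otimes 1_\downarrow)\circ(1_\downarrow\otimes c')=1_\downarrow$. (iii) $(1_\downarrow\otimes d)\circ(1_\downarrow\otimes x\otimes 1_\downarrow)\circ(c\otimes 1_\downarrow)=(d'\otimes 1_\downarrow)\circ(1_\downarrow\otimes x\otimes 1_\downarrow)\circ(1_\downarrow\otimes c')$, and $\big(1_{\downarrow\otimes\downarrow}\otimes (d\circ(1_\uparrow\otimes d\otimes 1_\downarrow))\big)\circ\big(1_{\downarrow\otimes\downarrow}\otimes s\otimes 1_{\downarrow\otimes\downarrow}\big)\circ\big(((1_\downarrow\otimes c\otimes 1_\uparrow)\circ c)\otimes 1_{\downarrow\otimes\downarrow}\big) =\big((d'\circ(1_\downarrow\otimes d'\otimes 1_\uparrow))\otimes 1_{\downarrow\otimes\downarrow}\big)\circ\big(1_{\downarrow\otimes\downarrow}\otimes s\otimes 1_{\downarrow\otimes\downarrow}\big)\circ\big(1_{\downarrow\otimes\downarrow}\otimes((1_\uparrow\otimes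 c'\otimes 1_\downarrow)\circ c')\big)$ (i.e. the right and left mates of $x$ agree, and the right and left mates of $s$ agree). (iv) For all $r\ge 0$: $(d'\otimes 1_\uparrow)\circ(1_\downarrow\otimes x^r\otimes 1_\uparrow)\circ(1_\downarrow\otimes s)\circ(c\otimes 1_\uparrow)=\sum_{m\ge0}\circlearrowleft_{r-m-1}\otimes x^m$ and $(1_\uparrow\otimes d)\circ(1_\uparrow\otimes x^r\otimes 1_\downarrow)\circ(s\otimes 1_\downarrow)\circ(1_\uparrow\otimes c')=-\sum_{m\ge0}x^m\otimes\circlearrowright_{r-m-1}$. (v) For all $r\in\mathbb Z$: $1_\uparrow\otimes\circlearrowleft_r=\circlearrowleft_r\otimes 1_\uparrow-\sum_{m\ge0}(m+1)\,\circlearrowleft_{r-m-2}\otimes x^m$ and $\circlearrowright_r\otimes 1_\uparrow=1_\uparrow\otimes\circlearrowright_r-\sum_{m\ge0}(m+1)\,x^m\otimes\circlearrowright_{r-m-2}$. (vi) Let $D_1:=(t'\otimes 1_\uparrow)\circ(1_\downarrow\otimes s)\circ(t\otimes 1_\uparrow)$ and $D_2:=(1_\uparrow\otimes t)\circ(s\otimes 1_\downarrow)\circ(1_\uparrow\otimes t')$, both endomorphisms of $\uparrow\otimes\downarrow\otimes\uparrow$. Then $D_1-D_2=\sum_{a,b,m\ge0}\circlearrowleft_{-a-b-m-3}\otimes\big((x^a\otimes 1_\downarrow)\circ c'\circ d\circ(x^b\otimes 1_\downarrow)\big)\otimes x^m$ if $k\ge2$; $D_1-D_2=0$ if $-1\le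 k\le 1$; $D_1-D_2=\sum_{a,b,m\ge0}x^m\otimes\big((1_\downarrow\otimes x^a)\circ c\circ d'\circ(1_\downarrow\otimes x^b)\big)\otimes\circlearrowright_{-a-b-m-3}$ if $k\le-2$.
   Context: Fix a commutative ring $\Bbbk$ and an integer $k$. In a strict monoidal category write $\mathbf 1$ for the unit object, $1_X$ for the identity of $X$, $a\circ b$ for composition ($a$ after $b$), $a\otimes b$ for the tensor product, and $x^n$ for the $n$-fold composite of an endomorphism ($x^0$ the identity); $\delta$ is the Kronecker delta. The Heisenberg category $\mathcal{H}eis_k$ is the strict $\Bbbk$-linear monoidal category generated by objects $\uparrow,\downarrow$ and morphisms $x:\uparrow\to\uparrow$, $s:\uparrow\otimes\uparrow\to\uparrow\otimes\uparrow$, $c:\mathbf 1\to\downarrow\otimes\uparrow$, $d:\uparrow\otimes\downarrow\to\mathbf 1$, subject to the following relations, where $t:=(1_\downarrow\otimes 1_\uparrow\otimes d)\circ(1_\downarrow\otimes s\otimes 1_\downarrow)\circ(c\otimes 1_\uparrow\otimes 1_\downarrow):\uparrow\otimes\downarrow\to\downarrow\otimes\uparrow$: (H) $s\circ s=1_{\uparrow\otimes\uparrow}$; $(s\otimes 1_\uparrow)\circ(1_\uparrow\otimes s)\circ(s\otimes 1_\uparrow)=(1_\uparrow\otimes s)\circ(s\otimes 1_\uparrow)\circ(1_\uparrow\otimes s)$; $(x\otimes 1_\uparrow)\circ s-s\circ(1_\uparrow\otimes x)=1_{\uparrow\otimes\uparrow}$. (A) $(d\otimes 1_\uparrow)\circ(1_\uparrow\otimes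 c)=1_\uparrow$ and $(1_\downarrow\otimes d)\circ(c\otimes 1_\downarrow)=1_\downarrow$. (I) If $k\ge0$, the morphism $\uparrow\otimes\downarrow\to(\downarrow\otimes\uparrow)\oplus\mathbf 1^{\oplus k}$ with components $t$ and $d\circ(x^r\otimes 1_\downarrow)$, $r=0,\dots,k-1$, is an isomorphism in the additive envelope; if $k<0$, the morphism $(\uparrow\otimes\downarrow)\oplus\mathbf 1^{\oplus(-k)}\to\downarrow\otimes\uparrow$ with components $t$ and $(1_\downarrow\otimes x^r)\circ c$, $r=0,\dots,-k-1$, is an isomorphism in the additive envelope. (Formally, one adjoins as further generators the matrix entries of a two-sided inverse, with relations saying both matrix products are identity matrices.) Define $c':\mathbf 1\to\uparrow\otimes\downarrow$ and $d':\downarrow\otimes\uparrow\to\mathbf 1$ as follows. If $k\ge 0$, the inverse of the isomorphism in (I) has components $\tau:\downarrow\otimes\uparrow\to\uparrow\otimes\downarrow$ and $e_r:\mathbf 1\to\uparrow\otimes\downarrow$ ($0\le r<k$); if $k<0$ it has components $\tau:\downarrow\otimes\uparrow\to\uparrow\otimes\downarrow$ and $f_r:\downarrow\otimes\uparrow\to\mathbf 1$ ($0\le r<-k$). Set $c':=-e_{k-1}$ if $k>0$, $c':=\tau\circ(1_\downarrow\otimes x^{-k})\circ c$ if $k\le 0$; $d':=d\circ(x^k\otimes 1_\downarrow)\circ\tau$ if $k\ge0$, $d':=f_{-k-1}$ if $k<0$. Define $t':=(d'\otimes 1_\uparrow\otimes 1_\downarrow)\circ(1_\downarrow\otimes s\otimes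 1_\downarrow)\circ(1_\downarrow\otimes 1_\uparrow\otimes c'):\downarrow\otimes\uparrow\to\uparrow\otimes\downarrow$ and $x':=(1_\downarrow\otimes d)\circ(1_\downarrow\otimes x\otimes 1_\downarrow)\circ(c\otimes 1_\downarrow)$. For $n\ge 0$ let $\circlearrowleft_n:=d'\circ(1_\downarrow\otimes x^n)\circ c$ and $\circlearrowright_n:=d\circ(x^n\otimes 1_\downarrow)\circ c'$, endomorphisms of $\mathbf 1$ (these form a commutative ring, where product equals composition equals tensor product). For $n<0$ let $\circlearrowleft_n:=\det(\circlearrowright_{i-j+k})_{i,j=1,\dots,r}$ with $r:=n+k+1$, and $\circlearrowright_n:=-\det(-\circlearrowleft_{i-j-k})_{i,j=1,\dots,r}$ with $r:=n-k+1$; determinants are $1$ if $r=0$ and $0$ if $r<0$. All sums above have only finitely many nonzero terms. *)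

theory Defs
  imports Main
begin

datatype ob = Up | Dn

type_synonym obj = "ob list"  (* tensor product of objects = concatenation, unit object = [] *)

record ('k, 'm) lmcat =
  dom  :: "'m \<Rightarrow> obj"
  cod  :: "'m \<Rightarrow> obj"
  cmp  :: "'m \<Rightarrow> 'm \<Rightarrow> 'm"      (* cmp C f g = f \<circ> g, f after g *)
  tns  :: "'m \<Rightarrow> 'm \<Rightarrow> 'm"
  idm  :: "obj \<Rightarrow> 'm"
  add  :: "'m \<Rightarrow> 'm \<Rightarrow> 'm"
  zer  :: "obj \<Rightarrow> obj \<Rightarrow> 'm"
  smul :: "'k \<Rightarrow> 'm \<Rightarrow> 'm"

definition hom :: "('k, 'm, 'z) lmcat_scheme \<Rightarrow> obj \<Rightarrow> obj \<Rightarrow> 'm set" where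
  "hom C a b = {f. dom C f = a \<and> cod C f = b}"

definition lmcat_axioms :: "('k::comm_ring_1, 'm, 'z) lmcat_scheme \<Rightarrow> bool" where
  "lmcat_axioms C \<longleftrightarrow>
    \<comment> \<open>category\<close>
    (\<forall>a. idm C a \<in> hom C a a) \<and>
    (\<forall>f g. dom C f = cod C g \<longrightarrow> cmp C f g \<in> hom C (dom C g) (cod C f)) \<and>
    (\<forall>f. cmp C (idm C (cod C f)) f = f \<and> cmp C f (idm C (dom C f)) = f) \<and>
    (\<forall>f g h. dom C f = cod C g \<and> dom C g = cod C h \<longrightarrow>
        cmp C (cmp C f g) h = cmp C f (cmp C g h)) \<and>
    \<comment> \<open>strict monoidal structure\<close>
    (\<forall>f g. tns C f g \<in> hom C (dom C f @ dom C g) (cod C f @ cod C g)) \<and>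
    (\<forall>f g h. tns C (tns C f g) h = tns C f (tns C g h)) \<and>
    (\<forall>f. tns C (idm C []) f = f \<and> tns C f (idm C []) = f) \<and>
    (\<forall>a b. tns C (idm C a) (idm C b) = idm C (a @ b)) \<and>
    (\<forall>f g h l. dom C f = cod C g \<and> dom C h = cod C l \<longrightarrow>
        tns C (cmp C f g) (cmp C h l) = cmp C (tns C f h) (tns C g l)) \<and>
    \<comment> \<open>k-linear structure on each hom set\<close>
    (\<forall>a b. zer C a b \<in> hom C a b) \<and>
    (\<forall>a b f g. f \<in> hom C a b \<and> g \<in> hom C a b \<longrightarrow> add C f g \<in> hom C a b) \<and>
    (\<forall>a b r f. f \<in> hom C a b \<longrightarrow> smul C r f \<in> hom C a b) \<and>
    (\<forall>a b f g h. f \<in> hom C a b \<and> g \<in> hom C a b \<and> h \<in> hom C a b \<longrightarrow>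
        add C (add C f g) h = add C f (add C g h)) \<and>
    (\<forall>a b f g. f \<in> hom C a b \<and> g \<in> hom C a b \<longrightarrow> add C f g = add C g f) \<and>
    (\<forall>a b f. f \<in> hom C a b \<longrightarrow> add C f (zer C a b) = f) \<and>
    (\<forall>a b f. f \<in> hom C a b \<longrightarrow> add C f (smul C (-1) f) = zer C a b) \<and>
    (\<forall>f. smul C 1 f = f) \<and>
    (\<forall>r q f. smul C r (smul C q f) = smul C (r * q) f) \<and>
    (\<forall>r q f. smul C (r + q) f = add C (smul C r f) (smul C q f)) \<and>
    (\<forall>a b r f g. f \<in> hom C a b \<and> g \<in> hom C a b \<longrightarrow>
        smul C r (add C f g) = add C (smul C r f) (smul C r g)) \<and>
    \<comment> \<open>bilinearity of composition\<close>
    (\<forall>f f' g. dom C f = cod C g \<and> f' \<in> hom C (dom C f) (cod C f) \<longrightarrow>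
        cmp C (add C f f') g = add C (cmp C f g) (cmp C f' g)) \<and>
    (\<forall>f g g'. dom C f = cod C g \<and> g' \<in> hom C (dom C g) (cod C g) \<longrightarrow>
        cmp C f (add C g g') = add C (cmp C f g) (cmp C f g')) \<and>
    (\<forall>r f g. dom C f = cod C g \<longrightarrow>
        cmp C (smul C r f) g = smul C r (cmp C f g) \<and> cmp C f (smul C r g) = smul C r (cmp C f g)) \<and>
    \<comment> \<open>bilinearity of tensor product\<close>
    (\<forall>f f' g. f' \<in> hom C (dom C f) (cod C f) \<longrightarrow>
        tns C (add C f f') g = add C (tns C f g) (tns C f' g) \<and>
        tns C g (add C f f') = add C (tns C g f) (tns C g f')) \<and>
    (\<forall>r f g. tns C (smul C r f) g = smul C r (tns C f g) \<and> tns C f (smul C r g) = smul C r (tns C f g))"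

definition msub :: "('k::comm_ring_1, 'm, 'z) lmcat_scheme \<Rightarrow> 'm \<Rightarrow> 'm \<Rightarrow> 'm" where
  "msub C f g = add C f (smul C (-1) g)"

definition mneg :: "('k::comm_ring_1, 'm, 'z) lmcat_scheme \<Rightarrow> 'm \<Rightarrow> 'm" where
  "mneg C f = smul C (-1) f"

primrec mpow :: "('k, 'm, 'z) lmcat_scheme \<Rightarrow> obj \<Rightarrow> 'm \<Rightarrow> nat \<Rightarrow> 'm" where
  "mpow C a f 0 = idm C a"
| "mpow C a f (Suc n) = cmp C f (mpow C a f n)"

primrec msum :: "('k, 'm, 'z) lmcat_scheme \<Rightarrow> obj \<Rightarrow> obj \<Rightarrow> (nat \<Rightarrow> 'm) \<Rightarrow> nat \<Rightarrow> 'm" where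
  "msum C a b F 0 = zer C a b"
| "msum C a b F (Suc n) = add C (msum C a b F n) (F n)"

text \<open>Sum over all m \<ge> 0 of a family with only finitely many nonzero terms: the sum of
  the terms below the least bound beyond which all terms vanish.\<close>
definition msum_all :: "('k, 'm, 'z) lmcat_scheme \<Rightarrow> obj \<Rightarrow> obj \<Rightarrow> (nat \<Rightarrow> 'm) \<Rightarrow> 'm" where
  "msum_all C a b F = msum C a b F (LEAST N. \<forall>m\<ge>N. F m = zer C a b)"

text \<open>Determinant of an n x n matrix (entries M i j, 0 \<le> i, j < n) of endomorphisms of the
  unit object (a commutative ring, product = composition), by cofactor expansion along the
  first row; the determinant of the 0 x 0 matrix is the identity.\<close>
fun mdet :: "('k::comm_ring_1, 'm, 'z) lmcat_scheme \<Rightarrow> nat \<Rightarrow> (nat \<Rightarrow> nat \<Rightarrow> 'm) \<Rightarrow> 'm" where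
  "mdet C 0 M = idm C []"
| "mdet C (Suc n) M = msum C [] [] (\<lambda>j. smul C ((-1) ^ j)
      (cmp C (M 0 j) (mdet C n (\<lambda>i l. M (Suc i) (if l < j then l else Suc l))))) (Suc n)"

definition idet :: "('k::comm_ring_1, 'm, 'z) lmcat_scheme \<Rightarrow> int \<Rightarrow> (nat \<Rightarrow> nat \<Rightarrow> 'm) \<Rightarrow> 'm" where
  "idet C r M = (if r < 0 then zer C [] [] else mdet C (nat r) M)"

record ('k, 'm) heis = "('k, 'm) lmcat" +
  gx   :: 'm
  gs   :: 'm
  gc   :: 'm
  gd   :: 'm
  gtau :: 'm     (* component tau of the inverse in (I) *)
  ge   :: "nat \<Rightarrow> 'm"   (* components e_r of the inverse in (I), k \<ge> 0 *)
  gf   :: "nat \<Rightarrow> 'm"   (* components f_r of the inverse in (I), k < 0 *)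

abbreviation "iU H \<equiv> idm H [Up]"
abbreviation "iD H \<equiv> idm H [Dn]"

definition tt :: "('k, 'm, 'z) heis_scheme \<Rightarrow> 'm" where
  "tt H = cmp H (tns H (iD H) (tns H (iU H) (gd H)))
            (cmp H (tns H (iD H) (tns H (gs H) (iD H)))
                   (tns H (gc H) (tns H (iU H) (iD H))))"

definition heis_rel :: "('k::comm_ring_1, 'm, 'z) heis_scheme \<Rightarrow> int \<Rightarrow> bool" where
  "heis_rel H k \<longleftrightarrow>
    gx H \<in> hom H [Up] [Up] \<and> gs H \<in> hom H [Up, Up] [Up, Up] \<and>
    gc H \<in> hom H [] [Dn, Up] \<and> gd H \<in> hom H [Up, Dn] [] \<and>
    \<comment> \<open>(H)\<close>
    cmp H (gs H) (gs H) = idm H [Up, Up] \<and>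
    cmp H (tns H (gs H) (iU H)) (cmp H (tns H (iU H) (gs H)) (tns H (gs H) (iU H))) =
      cmp H (tns H (iU H) (gs H)) (cmp H (tns H (gs H) (iU H)) (tns H (iU H) (gs H))) \<and>
    msub H (cmp H (tns H (gx H) (iU H)) (gs H)) (cmp H (gs H) (tns H (iU H) (gx H))) = idm H [Up, Up] \<and>
    \<comment> \<open>(A)\<close>
    cmp H (tns H (gd H) (iU H)) (tns H (iU H) (gc H)) = iU H \<and>
    cmp H (tns H (iD H) (gd H)) (tns H (gc H) (iD H)) = iD H \<and>
    \<comment> \<open>(I), spelled out as the two matrix identities for a two-sided inverse\<close>
    gtau H \<in> hom H [Dn, Up] [Up, Dn] \<and>
    (0 \<le> k \<longrightarrow>
       (\<forall>r. int r < k \<longrightarrow> ge H r \<in> hom H [] [Up, Dn]) \<and>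
       add H (cmp H (gtau H) (tt H))
         (msum H [Up, Dn] [Up, Dn]
            (\<lambda>r. cmp H (ge H r) (cmp H (gd H) (tns H (mpow H [Up] (gx H) r) (iD H)))) (nat k))
         = idm H [Up, Dn] \<and>
       cmp H (tt H) (gtau H) = idm H [Dn, Up] \<and>
       (\<forall>r. int r < k \<longrightarrow> cmp H (tt H) (ge H r) = zer H [] [Dn, Up]) \<and>
       (\<forall>r. int r < k \<longrightarrow>
          cmp H (cmp H (gd H) (tns H (mpow H [Up] (gx H) r) (iD H))) (gtau H) = zer H [Dn, Up] []) \<and>
       (\<forall>r q. int r < k \<and> int q < k \<longrightarrow>
          cmp H (cmp H (gd H) (tns H (mpow H [Up] (gx H) r) (iD H))) (ge H q) =
            (if r = q then idm H [] else zer H [] []))) \<and>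
    (k < 0 \<longrightarrow>
       (\<forall>r. int r < - k \<longrightarrow> gf H r \<in> hom H [Dn, Up] []) \<and>
       add H (cmp H (tt H) (gtau H))
         (msum H [Dn, Up] [Dn, Up]
            (\<lambda>r. cmp H (cmp H (tns H (iD H) (mpow H [Up] (gx H) r)) (gc H)) (gf H r)) (nat (- k)))
         = idm H [Dn, Up] \<and>
       cmp H (gtau H) (tt H) = idm H [Up, Dn] \<and>
       (\<forall>r. int r < - k \<longrightarrow>
          cmp H (gtau H) (cmp H (tns H (iD H) (mpow H [Up] (gx H) r)) (gc H)) = zer H [] [Up, Dn]) \<and>
       (\<forall>r. int r < - k \<longrightarrow> cmp H (gf H r) (tt H) = zer H [Up, Dn] []) \<and>
       (\<forall>r q. int r < - k \<and> int q < - k \<longrightarrow>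
          cmp H (gf H r) (cmp H (tns H (iD H) (mpow H [Up] (gx H) q)) (gc H)) =
            (if r = q then idm H [] else zer H [] [])))"

definition cc' :: "('k::comm_ring_1, 'm, 'z) heis_scheme \<Rightarrow> int \<Rightarrow> 'm" where
  "cc' H k = (if 0 < k then mneg H (ge H (nat (k - 1)))
              else cmp H (gtau H) (cmp H (tns H (iD H) (mpow H [Up] (gx H) (nat (- k)))) (gc H)))"

definition dd' :: "('k::comm_ring_1, 'm, 'z) heis_scheme \<Rightarrow> int \<Rightarrow> 'm" where
  "dd' H k = (if 0 \<le> k then cmp H (gd H) (cmp H (tns H (mpow H [Up] (gx H) (nat k)) (iD H)) (gtau H))
              else gf H (nat (- k - 1)))"

definition tt' :: "('k::comm_ring_1, 'm, 'z) heis_scheme \<Rightarrow> int \<Rightarrow> 'm" where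
  "tt' H k = cmp H (tns H (dd' H k) (tns H (iU H) (iD H)))
              (cmp H (tns H (iD H) (tns H (gs H) (iD H)))
                     (tns H (iD H) (tns H (iU H) (cc' H k))))"

definition ccw0 :: "('k::comm_ring_1, 'm, 'z) heis_scheme \<Rightarrow> int \<Rightarrow> nat \<Rightarrow> 'm" where
  "ccw0 H k n = cmp H (dd' H k) (cmp H (tns H (iD H) (mpow H [Up] (gx H) n)) (gc H))"

definition cw0 :: "('k::comm_ring_1, 'm, 'z) heis_scheme \<Rightarrow> int \<Rightarrow> nat \<Rightarrow> 'm" where
  "cw0 H k n = cmp H (gd H) (cmp H (tns H (mpow H [Up] (gx H) n) (iD H)) (cc' H k))"

text \<open>Bubbles for all integers n; negative ones via the determinantal formulas (the matrix
  entries there have nonnegative indices).  Matrix indices are shifted to start at 0,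
  which does not change i - j.\<close>
definition ccw :: "('k::comm_ring_1, 'm, 'z) heis_scheme \<Rightarrow> int \<Rightarrow> int \<Rightarrow> 'm" where
  "ccw H k n = (if 0 \<le> n then ccw0 H k (nat n)
               else idet H (n + k + 1) (\<lambda>i j. cw0 H k (nat (int i - int j + k))))"

definition cw :: "('k::comm_ring_1, 'm, 'z) heis_scheme \<Rightarrow> int \<Rightarrow> int \<Rightarrow> 'm" where
  "cw H k n = (if 0 \<le> n then cw0 H k (nat n)
              else mneg H (idet H (n - k + 1) (\<lambda>i j. mneg H (ccw0 H k (nat (int i - int j - k))))))"

end

theory Submission
  imports Defs
begin

text \<open>
  For k \<ge> 0 the pair (t, caps with fewer than k dots) is jointly monic, so identities between
  morphisms into \<up>\<down> can be tested after composing with these. This yields the pitchfork relation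
  that pulls a strand through c', hence one zigzag identity for c' and d'. The second zigzag
  follows by comparing the two evaluations of t' c. The components of the inverse are combinations
  of dotted c' with bubble coefficients satisfying a Hessenberg recursion, which identifies the
  determinantal bubbles with the honest ones and gives the infinite Grassmannian relation. Bubble
  slides for one orientation come from pulling a strand through a bubble; for the other orientation
  they follow because the two generating series are inverse up to sign. Rotating all diagrams by
  180 degrees exchanges k and -k, which reduces k < 0 to k > 0.
\<close>

section \<open>Strict monoidal linear categories\<close>

text \<open>Axiom (I) gives \<open>t\<close> alone only a one-sided inverse. For nonnegative charge
  \<open>\<tau>\<close> is a right inverse of \<open>t\<close>, and
  \<open>\<tau> \<bullet> t\<close> differs from the identity by a sum of cups times dotted caps.
  This single defect produces the undotted counterclockwise curl and every term of the alternating
  braid relation; it is why the components of the inverse have to be computed explicitly, with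
  bubbles as coefficients. The normalisation of \<open>c'\<close> and \<open>d'\<close> is what
  makes the slide of a dot through \<open>\<tau>\<close> cost exactly
  \<open>c' \<bullet> d'\<close>. Bubbles of negative index cannot be drawn: they are determinants.
  Their recursion therefore has two unrelated origins, cofactor expansion on one side and dots
  pulled through \<open>\<tau>\<close> on the other, and the two ranges have to be joined. At charge
  zero there are no dotted caps to test with, \<open>t\<close> is invertible, and \<open>c'\<close>
  is \<open>\<tau> \<bullet> c\<close> instead of a component of the inverse. All case distinctions
  on \<open>K = 0\<close> come from this.\<close>

locale lmcat =
  fixes C :: "('k::comm_ring_1, 'm, 'z) lmcat_scheme"
  assumes ax: "lmcat_axioms C"
begin

abbreviation cmp_C (infixr "\<bullet>" 65) where "f \<bullet> g \<equiv> cmp C f g"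
abbreviation tns_C (infixr "\<otimes>" 70) where "f \<otimes> g \<equiv> tns C f g"
abbreviation add_C (infixr "\<oplus>" 60) where "f \<oplus> g \<equiv> add C f g"
abbreviation I where "I a \<equiv> idm C a"
abbreviation Z where "Z a b \<equiv> zer C a b"
abbreviation D where "D f \<equiv> dom C f"
abbreviation R where "R f \<equiv> cod C f"

text \<open>The projections follow the order of the conjuncts of lmcat_axioms; a primed fact is the
  conjunction of all later conjuncts.\<close>

lemmas ax_unfolded = ax [unfolded lmcat_axioms_def hom_def mem_Collect_eq]
lemmas ax_idm = ax_unfolded [THEN conjunct1, rule_format] and ax_idm' = ax_unfolded [THEN conjunct2]
lemmas ax_cmp = ax_idm' [THEN conjunct1, rule_format] and ax_cmp' = ax_idm' [THEN conjunct2]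
lemmas ax_unit = ax_cmp' [THEN conjunct1, rule_format] and ax_unit' = ax_cmp' [THEN conjunct2]
lemmas ax_assoc = ax_unit' [THEN conjunct1, rule_format] and ax_assoc' = ax_unit' [THEN conjunct2]
lemmas ax_tns = ax_assoc' [THEN conjunct1, rule_format] and ax_tns' = ax_assoc' [THEN conjunct2]
lemmas ax_tassoc = ax_tns' [THEN conjunct1, rule_format] and ax_tassoc' = ax_tns' [THEN conjunct2]
lemmas ax_tunit = ax_tassoc' [THEN conjunct1, rule_format] and ax_tunit' = ax_tassoc' [THEN conjunct2]
lemmas ax_tidm = ax_tunit' [THEN conjunct1, rule_format] and ax_tidm' = ax_tunit' [THEN conjunct2]
lemmas ax_inter = ax_tidm' [THEN conjunct1, rule_format] and ax_inter' = ax_tidm' [THEN conjunct2]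
lemmas ax_zer = ax_inter' [THEN conjunct1, rule_format] and ax_zer' = ax_inter' [THEN conjunct2]
lemmas ax_add = ax_zer' [THEN conjunct1, rule_format] and ax_add' = ax_zer' [THEN conjunct2]
lemmas ax_smul = ax_add' [THEN conjunct1, rule_format] and ax_smul' = ax_add' [THEN conjunct2]
lemmas ax_aassoc = ax_smul' [THEN conjunct1, rule_format] and ax_aassoc' = ax_smul' [THEN conjunct2]
lemmas ax_acomm = ax_aassoc' [THEN conjunct1, rule_format] and ax_acomm' = ax_aassoc' [THEN conjunct2]
lemmas ax_azer = ax_acomm' [THEN conjunct1, rule_format] and ax_azer' = ax_acomm' [THEN conjunct2]
lemmas ax_aneg = ax_azer' [THEN conjunct1, rule_format] and ax_aneg' = ax_azer' [THEN conjunct2]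
lemmas ax_s1 = ax_aneg' [THEN conjunct1, rule_format] and ax_s1' = ax_aneg' [THEN conjunct2]
lemmas ax_ss = ax_s1' [THEN conjunct1, rule_format] and ax_ss' = ax_s1' [THEN conjunct2]
lemmas ax_sl = ax_ss' [THEN conjunct1, rule_format] and ax_sl' = ax_ss' [THEN conjunct2]
lemmas ax_sr = ax_sl' [THEN conjunct1, rule_format] and ax_sr' = ax_sl' [THEN conjunct2]
lemmas ax_cmpl = ax_sr' [THEN conjunct1, rule_format] and ax_cmpl' = ax_sr' [THEN conjunct2]
lemmas ax_cmpr = ax_cmpl' [THEN conjunct1, rule_format] and ax_cmpr' = ax_cmpl' [THEN conjunct2]
lemmas ax_cmps = ax_cmpr' [THEN conjunct1, rule_format] and ax_cmps' = ax_cmpr' [THEN conjunct2]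
lemmas ax_tadd = ax_cmps' [THEN conjunct1, rule_format] and ax_tadd' = ax_cmps' [THEN conjunct2]
lemmas ax_tsmul = ax_tadd' [rule_format]

lemma typing [simp]:
  "D (I a) = a" "R (I a) = a"
  "D (f \<otimes> g) = D f @ D g" "R (f \<otimes> g) = R f @ R g"
  "D (Z a b) = a" "R (Z a b) = b"
  "D (smul C r f) = D f" "R (smul C r f) = R f"
  "D (mneg C f) = D f" "R (mneg C f) = R f"
  by (simp_all add: mneg_def ax_idm ax_tns ax_zer ax_smul)

lemma typing_cmp [simp]:
  "D f = R g \<Longrightarrow> D (f \<bullet> g) = D g" "D f = R g \<Longrightarrow> R (f \<bullet> g) = R f"
  by (simp_all add: ax_cmp)

lemma typing_add [simp]:
  assumes "D f = D g" "R f = R g"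
  shows "D (f \<oplus> g) = D g" "R (f \<oplus> g) = R g"
  using ax_add assms by simp_all

lemma cmp_idm [simp]:
  "R f = a \<Longrightarrow> I a \<bullet> f = f" "D f = a \<Longrightarrow> f \<bullet> I a = f"
  using ax_unit by auto

lemma cmp_assoc:
  "D f = R g \<Longrightarrow> D g = R h \<Longrightarrow> (f \<bullet> g) \<bullet> h = f \<bullet> g \<bullet> h"
  by (rule ax_assoc) simp

lemma tns_assoc [simp]: "(f \<otimes> g) \<otimes> h = f \<otimes> g \<otimes> h"
  by (rule ax_tassoc)

lemma tns_idm [simp]:
  "I [] \<otimes> f = f" "f \<otimes> I [] = f" "I a \<otimes> I b = I (a @ b)"
  by (simp_all add: ax_tunit ax_tidm)

lemma tns_idm_left [simp]: "I a \<otimes> I b \<otimes> f = I (a @ b) \<otimes> f"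
  by (simp flip: tns_idm(3))

lemma interchange:
  "D f = R g \<Longrightarrow> D h = R l \<Longrightarrow> (f \<bullet> g) \<otimes> (h \<bullet> l) = (f \<otimes> h) \<bullet> (g \<otimes> l)"
  by (rule ax_inter) simp

lemma whisker:
  "D f = R g \<Longrightarrow> I a \<otimes> (f \<bullet> g) = (I a \<otimes> f) \<bullet> (I a \<otimes> g)"
  "D f = R g \<Longrightarrow> (f \<bullet> g) \<otimes> I a = (f \<otimes> I a) \<bullet> (g \<otimes> I a)"
  using interchange [of f g "I a" "I a"] interchange [of "I a" "I a" f g] by simp_all


lemma tns_eq_cmp:
  "D f = a \<Longrightarrow> R g = b \<Longrightarrow> f \<otimes> g = (f \<otimes> I b) \<bullet> (I a \<otimes> g)"
  "R f = a \<Longrightarrow> D g = b \<Longrightarrow> f \<otimes> g = (I a \<otimes> g) \<bullet> (f \<otimes> I b)"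
  using interchange [of f "I a" "I b" g] interchange [of "I a" f g "I b"] by simp_all

text \<open>The height exchange law: two pieces of a diagram that stand side by side may be
  performed in either order. The geometric moves below are mostly instances of it.\<close>

lemma swap:
  assumes "D f = a" "R f = a'" "D g = b" "R g = b'"
  shows "(f \<otimes> I b') \<bullet> (I a \<otimes> g) = (I a' \<otimes> g) \<bullet> (f \<otimes> I b)"
  using tns_eq_cmp [of f a g b'] tns_eq_cmp(2) [of f a' g b] assms by simp

lemma smul_simps [simp]:
  "smul C 1 f = f" "smul C r (smul C q f) = smul C (r * q) f"
  "smul C r (mneg C f) = mneg C (smul C r f)"
  by (simp_all add: mneg_def ax_s1 ax_ss)

lemma smul_add_left: "smul C (r + q) f = smul C r f \<oplus> smul C q f"
  by (rule ax_sl)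

lemma smul_add_right:
  "D f = D g \<Longrightarrow> R f = R g \<Longrightarrow> smul C r (f \<oplus> g) = smul C r f \<oplus> smul C r g"
  by (rule ax_sr) auto

lemma add_assoc:
  "D f = D g \<Longrightarrow> R f = R g \<Longrightarrow> D g = D h \<Longrightarrow> R g = R h \<Longrightarrow> (f \<oplus> g) \<oplus> h = f \<oplus> g \<oplus> h"
  by (rule ax_aassoc) auto

lemma add_commute: "D f = D g \<Longrightarrow> R f = R g \<Longrightarrow> f \<oplus> g = g \<oplus> f"
  by (rule ax_acomm) auto

lemma add_left_commute:
  "D f = D g \<Longrightarrow> R f = R g \<Longrightarrow> D g = D h \<Longrightarrow> R g = R h \<Longrightarrow> f \<oplus> g \<oplus> h = g \<oplus> f \<oplus> h"
  by (metis add_assoc add_commute)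

lemmas add_ac = add_assoc add_commute add_left_commute

lemma add_zer [simp]:
  "D f = a \<Longrightarrow> R f = b \<Longrightarrow> f \<oplus> Z a b = f" "D f = a \<Longrightarrow> R f = b \<Longrightarrow> Z a b \<oplus> f = f"
  using ax_azer [of f a b] add_commute [of "Z a b" f] by simp_all

lemma add_mneg [simp]:
  "D f = a \<Longrightarrow> R f = b \<Longrightarrow> f \<oplus> mneg C f = Z a b"
  "D f = a \<Longrightarrow> R f = b \<Longrightarrow> mneg C f \<oplus> f = Z a b"
  using ax_aneg [of f a b] add_commute [of "mneg C f" f] by (simp_all add: mneg_def)

lemma mneg_mneg [simp]: "mneg C (mneg C f) = f"
  by (simp add: mneg_def)

lemma smul_0 [simp]: "smul C 0 f = Z (D f) (R f)"
  using smul_add_left [of 1 "-1" f] add_mneg [of f] by (simp add: mneg_def)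

lemma smul_zer [simp]: "smul C r (Z a b) = Z a b"
  using smul_simps(2) [of r 0 "Z a b"] by simp

lemma mneg_zer [simp]: "mneg C (Z a b) = Z a b"
  by (simp add: mneg_def)

lemma mneg_add:
  "D f = D g \<Longrightarrow> R f = R g \<Longrightarrow> mneg C (f \<oplus> g) = mneg C f \<oplus> mneg C g"
  by (simp add: mneg_def smul_add_right)

lemma msub_eq: "msub C f g = f \<oplus> mneg C g"
  by (simp add: msub_def mneg_def)

text \<open>Addition is a group operation only inside one hom set, so moving a summand to the other
  side has to carry the typing of all three morphisms.\<close>

lemma eq_add_iff:
  assumes "D f = a" "R f = b" "D g = a" "R g = b" "D h = a" "R h = b"
  shows "f = g \<oplus> h \<longleftrightarrow> f \<oplus> mneg C h = g"
proof
  assume f: "f = g \<oplus> h"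
  show "f \<oplus> mneg C h = g" unfolding f using assms by (simp add: add_assoc)
next
  assume g: "f \<oplus> mneg C h = g"
  have "(f \<oplus> mneg C h) \<oplus> h = f" using assms by (simp add: add_assoc)
  then show "f = g \<oplus> h" by (simp only: g)
qed

lemma mneg_eq_iff: "mneg C f = mneg C g \<longleftrightarrow> f = g"
  by (metis mneg_mneg)

lemma cmp_add:
  "D f = R g \<Longrightarrow> D f' = D f \<Longrightarrow> R f' = R f \<Longrightarrow> (f \<oplus> f') \<bullet> g = f \<bullet> g \<oplus> f' \<bullet> g"
  "D f = R g \<Longrightarrow> D g' = D g \<Longrightarrow> R g' = R g \<Longrightarrow> f \<bullet> (g \<oplus> g') = f \<bullet> g \<oplus> f \<bullet> g'"
  by (simp_all add: ax_cmpl ax_cmpr)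

lemma cmp_smul [simp]:
  "D f = R g \<Longrightarrow> smul C r f \<bullet> g = smul C r (f \<bullet> g)" "D f = R g \<Longrightarrow> f \<bullet> smul C r g = smul C r (f \<bullet> g)"
  by (simp_all add: ax_cmps)

lemma tns_add:
  "D f' = D f \<Longrightarrow> R f' = R f \<Longrightarrow> (f \<oplus> f') \<otimes> g = f \<otimes> g \<oplus> f' \<otimes> g"
  "D f' = D f \<Longrightarrow> R f' = R f \<Longrightarrow> g \<otimes> (f \<oplus> f') = g \<otimes> f \<oplus> g \<otimes> f'"
  by (simp_all add: ax_tadd)

lemma tns_smul [simp]:
  "smul C r f \<otimes> g = smul C r (f \<otimes> g)" "f \<otimes> smul C r g = smul C r (f \<otimes> g)"
  by (simp_all add: ax_tsmul)

lemma mneg_out [simp]: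
  "D f = R g \<Longrightarrow> mneg C f \<bullet> g = mneg C (f \<bullet> g)" "D f = R g \<Longrightarrow> f \<bullet> mneg C g = mneg C (f \<bullet> g)"
  "mneg C f \<otimes> g = mneg C (f \<otimes> g)" "f \<otimes> mneg C g = mneg C (f \<otimes> g)"
  by (simp_all add: mneg_def)

lemma cmp_zer [simp]:
  "R g = a \<Longrightarrow> Z a b \<bullet> g = Z (D g) b" "D f = b \<Longrightarrow> f \<bullet> Z a b = Z a (R f)"
  using cmp_smul(1) [of "Z a b" g 0] cmp_smul(2) [of f "Z a b" 0] by simp_all

lemma tns_zer [simp]:
  "Z a b \<otimes> g = Z (a @ D g) (b @ R g)" "g \<otimes> Z a b = Z (D g @ a) (R g @ b)"
  using tns_smul(1) [of 0 "Z a b" g] tns_smul(2) [of g 0 "Z a b"] by simp_all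

lemmas lin = cmp_add tns_add mneg_add smul_add_right

text \<open>Rewriting with lay turns a diagram into a right-nested composite of whiskered generators.\<close>

lemmas lay = cmp_assoc whisker

lemma scalar_tns_cmp:
  "D \<beta> = [] \<Longrightarrow> R \<beta> = [] \<Longrightarrow> D f = R g \<Longrightarrow> (\<beta> \<otimes> f) \<bullet> g = \<beta> \<otimes> (f \<bullet> g)"
  "D \<beta> = [] \<Longrightarrow> R \<beta> = [] \<Longrightarrow> D f = R g \<Longrightarrow> f \<bullet> (\<beta> \<otimes> g) = \<beta> \<otimes> (f \<bullet> g)"
  using interchange [of \<beta> "I []" f g] interchange [of "I []" \<beta> f g] by simp_all

lemma scalar_tns_state: "D \<beta> = [] \<Longrightarrow> R \<beta> = [] \<Longrightarrow> D f = [] \<Longrightarrow> \<beta> \<otimes> f = f \<bullet> \<beta>"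
  using tns_eq_cmp(2) [of \<beta> "[]" f "[]"] by simp

text \<open>Eckmann-Hilton: the tensor product of two endomorphisms of the unit equals both
  composites.\<close>

lemma scalar_commute:
  assumes "D \<alpha> = []" "R \<alpha> = []" "D \<beta> = []" "R \<beta> = []"
  shows "\<alpha> \<bullet> \<beta> = \<beta> \<bullet> \<alpha>"
  using tns_eq_cmp [of \<alpha> "[]" \<beta> "[]"] tns_eq_cmp(2) [of \<alpha> "[]" \<beta> "[]"] assms by simp

section \<open>Finite sums in a hom set\<close>

lemma typing_msum [simp]:
  assumes "\<And>i. i < n \<Longrightarrow> D (F i) = a" "\<And>i. i < n \<Longrightarrow> R (F i) = b"
  shows "D (msum C a b F n) = a" "R (msum C a b F n) = b"
proof -
  have "D (msum C a b F n) = a \<and> R (msum C a b F n) = b"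
    using assms by (induction n) simp_all
  then show "D (msum C a b F n) = a" "R (msum C a b F n) = b" by simp_all
qed

lemma msum_cong: "(\<And>i. i < n \<Longrightarrow> F i = G i) \<Longrightarrow> msum C a b F n = msum C a b G n"
  by (induction n) simp_all

lemma msum_zero: "(\<And>i. i < n \<Longrightarrow> F i = Z a b) \<Longrightarrow> msum C a b F n = Z a b"
  by (induction n) simp_all

text \<open>One induction serves all linear operations on sums. Additivity of \<open>\<phi>\<close>
  is asked for only on the hom set of the summands, because \<open>add\<close> is not controlled
  between morphisms of different type.\<close>

lemma msum_additive:
  assumes "\<phi> (Z a b) = Z a' b'"
    and "\<And>f g. D f = a \<Longrightarrow> R f = b \<Longrightarrow> D g = a \<Longrightarrow> R g = b \<Longrightarrow> \<phi> (f \<oplus> g) = \<phi> f \<oplus> \<phi> g"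
    and "\<And>i. i < n \<Longrightarrow> D (F i) = a" "\<And>i. i < n \<Longrightarrow> R (F i) = b"
  shows "\<phi> (msum C a b F n) = msum C a' b' (\<lambda>i. \<phi> (F i)) n"
  using assms(3,4) by (induction n) (simp_all add: assms(1,2))

lemma msum_cmp_left:
  assumes "D f = b" "\<And>i. i < n \<Longrightarrow> D (F i) = a" "\<And>i. i < n \<Longrightarrow> R (F i) = b" "R f = b'"
  shows "f \<bullet> msum C a b F n = msum C a b' (\<lambda>i. f \<bullet> F i) n"
  by (rule msum_additive) (simp_all add: assms lin)

lemma msum_cmp_right:
  assumes "R f = a" "\<And>i. i < n \<Longrightarrow> D (F i) = a" "\<And>i. i < n \<Longrightarrow> R (F i) = b" "D f = a'"
  shows "msum C a b F n \<bullet> f = msum C a' b (\<lambda>i. F i \<bullet> f) n"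
  by (rule msum_additive [where \<phi> = "\<lambda>g. g \<bullet> f"]) (simp_all add: assms lin)

lemma msum_tns_left:
  assumes "\<And>i. i < n \<Longrightarrow> D (F i) = a" "\<And>i. i < n \<Longrightarrow> R (F i) = b" "a' = D f @ a" "b' = R f @ b"
  shows "f \<otimes> msum C a b F n = msum C a' b' (\<lambda>i. f \<otimes> F i) n"
  by (rule msum_additive) (simp_all add: assms lin)

lemma msum_tns_right:
  assumes "\<And>i. i < n \<Longrightarrow> D (F i) = a" "\<And>i. i < n \<Longrightarrow> R (F i) = b" "a' = a @ D f" "b' = b @ R f"
  shows "msum C a b F n \<otimes> f = msum C a' b' (\<lambda>i. F i \<otimes> f) n"
  by (rule msum_additive [where \<phi> = "\<lambda>g. g \<otimes> f"]) (simp_all add: assms lin)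

lemma msum_mneg:
  assumes "\<And>i. i < n \<Longrightarrow> D (F i) = a" "\<And>i. i < n \<Longrightarrow> R (F i) = b"
  shows "mneg C (msum C a b F n) = msum C a b (\<lambda>i. mneg C (F i)) n"
  by (rule msum_additive) (simp_all add: assms lin)

lemma msum_add:
  assumes "\<And>i. i < n \<Longrightarrow> D (F i) = a" "\<And>i. i < n \<Longrightarrow> R (F i) = b"
    and "\<And>i. i < n \<Longrightarrow> D (G i) = a" "\<And>i. i < n \<Longrightarrow> R (G i) = b"
  shows "msum C a b (\<lambda>i. F i \<oplus> G i) n = msum C a b F n \<oplus> msum C a b G n"
  using assms by (induction n) (simp_all add: add_ac)

lemma msum_Suc_shift:
  assumes "\<And>i. i \<le> n \<Longrightarrow> D (F i) = a" "\<And>i. i \<le> n \<Longrightarrow> R (F i) = b"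
  shows "msum C a b F (Suc n) = F 0 \<oplus> msum C a b (\<lambda>i. F (Suc i)) n"
proof -
  have "msum C a b F (Suc m) = F 0 \<oplus> msum C a b (\<lambda>i. F (Suc i)) m" if "m \<le> n" for m
    using that
  proof (induction m)
    case (Suc m)
    have "msum C a b F (Suc (Suc m)) = msum C a b F (Suc m) \<oplus> F (Suc m)" by simp
    also have "\<dots> = (F 0 \<oplus> msum C a b (\<lambda>i. F (Suc i)) m) \<oplus> F (Suc m)" using Suc by simp
    also have "\<dots> = F 0 \<oplus> msum C a b (\<lambda>i. F (Suc i)) (Suc m)"
      using Suc.prems assms by (simp add: add_assoc)
    finally show ?case .
  qed (use assms in simp)
  then show ?thesis by blast
qed

lemma msum_append:
  assumes "\<And>i. i < n + m \<Longrightarrow> D (F i) = a" "\<And>i. i < n + m \<Longrightarrow> R (F i) = b"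
  shows "msum C a b F (n + m) = msum C a b F n \<oplus> msum C a b (\<lambda>i. F (n + i)) m"
  using assms by (induction m) (simp_all add: add_assoc)

lemma msum_extend:
  assumes "n \<le> N" "\<And>i. n \<le> i \<Longrightarrow> i < N \<Longrightarrow> F i = Z a b"
    and "\<And>i. i < n \<Longrightarrow> D (F i) = a" "\<And>i. i < n \<Longrightarrow> R (F i) = b"
  shows "msum C a b F N = msum C a b F n"
proof -
  have *: "D (F i) = a" "R (F i) = b" if "i < N" for i
    using assms that by (cases "i < n"; simp)+
  show ?thesis
    using msum_append [of n "N - n" F a b] msum_zero [of "N - n" "\<lambda>i. F (n + i)" a b] assms * by simp
qed

lemma msum_rev:
  assumes "\<And>i. i < n \<Longrightarrow> D (F i) = a" "\<And>i. i < n \<Longrightarrow> R (F i) = b"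
  shows "msum C a b F n = msum C a b (\<lambda>i. F (n - Suc i)) n"
  using assms
proof (induction n)
  case (Suc n)
  have "msum C a b (\<lambda>i. F (Suc n - Suc i)) (Suc n) = F n \<oplus> msum C a b (\<lambda>i. F (n - Suc i)) n"
    using msum_Suc_shift [of n "\<lambda>i. F (n - i)"] Suc.prems by simp
  then show ?case using Suc by (simp add: add_commute)
qed simp

lemma msum_swap:
  assumes "\<And>i j. i < n \<Longrightarrow> j < m \<Longrightarrow> D (F i j) = a" "\<And>i j. i < n \<Longrightarrow> j < m \<Longrightarrow> R (F i j) = b"
  shows "msum C a b (\<lambda>i. msum C a b (F i) m) n = msum C a b (\<lambda>j. msum C a b (\<lambda>i. F i j) n) m"
  using assms
proof (induction n)
  case 0
  then show ?case by (simp add: msum_zero)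
next
  case (Suc n)
  have "msum C a b (\<lambda>j. msum C a b (\<lambda>i. F i j) (Suc n)) m
    = msum C a b (\<lambda>j. msum C a b (\<lambda>i. F i j) n) m \<oplus> msum C a b (F n) m"
    by (simp add: msum_add Suc.prems)
  also have "msum C a b (\<lambda>j. msum C a b (\<lambda>i. F i j) n) m = msum C a b (\<lambda>i. msum C a b (F i) m) n"
    by (rule Suc.IH [symmetric]) (use Suc.prems in auto)
  finally show ?case by simp
qed

text \<open>One triangle of indices, summed by antidiagonals and by rows: in the induction the new
  antidiagonal appends the entry \<open>F i (n - i)\<close> to each row.\<close>

lemma msum_triangle:
  assumes "\<And>i j. i + j < n \<Longrightarrow> D (F i j) = a" "\<And>i j. i + j < n \<Longrightarrow> R (F i j) = b"
  shows "msum C a b (\<lambda>r. msum C a b (\<lambda>i. F i (r - i)) (Suc r)) n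
    = msum C a b (\<lambda>i. msum C a b (F i) (n - i)) n"
  using assms
proof (induction n)
  case (Suc n)
  have "msum C a b (\<lambda>i. msum C a b (F i) (Suc n - i)) (Suc n)
      = msum C a b (\<lambda>i. msum C a b (F i) (n - i) \<oplus> F i (n - i)) (Suc n)"
    by (rule msum_cong) (simp add: Suc_diff_le)
  also have "\<dots> = msum C a b (\<lambda>i. msum C a b (F i) (n - i)) (Suc n) \<oplus> msum C a b (\<lambda>i. F i (n - i)) (Suc n)"
    by (rule msum_add) (use Suc.prems in \<open>auto intro!: typing_msum\<close>)
  also have "msum C a b (\<lambda>i. msum C a b (F i) (n - i)) (Suc n) = msum C a b (\<lambda>i. msum C a b (F i) (n - i)) n"
    by (rule msum_extend) (use Suc.prems in \<open>auto intro!: typing_msum\<close>)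
  also have "msum C a b (\<lambda>i. msum C a b (F i) (n - i)) n = msum C a b (\<lambda>r. msum C a b (\<lambda>i. F i (r - i)) (Suc r)) n"
    by (rule Suc.IH [symmetric]) (use Suc.prems in auto)
  finally show ?case by (simp only: msum.simps(2) [of _ _ _ _ n])
qed simp

text \<open>Frees later arguments from the least bound in the definition: every bound past which the
  family vanishes gives the same value.\<close>

lemma msum_all_eq:
  assumes "\<And>m. N \<le> m \<Longrightarrow> F m = Z a b" "\<And>m. D (F m) = a" "\<And>m. R (F m) = b"
  shows "msum_all C a b F = msum C a b F N"
proof -
  let ?P = "\<lambda>N. \<forall>m\<ge>N. F m = Z a b"
  have "?P N" using assms by blast
  have *: "?P (LEAST N. ?P N)" by (rule LeastI [of ?P N]) fact
  have "(LEAST N. ?P N) \<le> N" by (rule Least_le) fact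
  then show ?thesis
    unfolding msum_all_def using assms(2,3) * by (intro msum_extend [symmetric]) blast+
qed

text \<open>Negation neither creates nor destroys zero terms, so both sums are cut off at the same
  least bound.\<close>

lemma msum_all_mneg:
  assumes "\<And>m. D (F m) = a" "\<And>m. R (F m) = b"
  shows "msum_all C a b (\<lambda>m. mneg C (F m)) = mneg C (msum_all C a b F)"
proof -
  have "mneg C (F m) = Z a b \<longleftrightarrow> F m = Z a b" for m
    using mneg_eq_iff [of "F m" "Z a b"] by simp
  then show ?thesis using assms by (simp add: msum_all_def msum_mneg)
qed

lemma msum_all_box:
  assumes [simp]: "\<And>i j m. D (G i j m) = a" "\<And>i j m. R (G i j m) = b"
    and vanish: "\<And>i j m. N \<le> i + j + m \<Longrightarrow> G i j m = Z a b"
  shows "msum_all C a b (\<lambda>i. msum_all C a b (\<lambda>j. msum_all C a b (G i j)))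
    = msum C a b (\<lambda>i. msum C a b (\<lambda>j. msum C a b (G i j) N) N) N"
proof -
  have "msum_all C a b (G i j) = msum C a b (G i j) N" for i j
    by (rule msum_all_eq) (simp_all add: vanish)
  moreover have "msum_all C a b (\<lambda>j. msum C a b (G i j) N) = msum C a b (\<lambda>j. msum C a b (G i j) N) N" for i
    by (rule msum_all_eq) (simp_all add: vanish msum_zero)
  moreover have "msum_all C a b (\<lambda>i. msum C a b (\<lambda>j. msum C a b (G i j) N) N)
    = msum C a b (\<lambda>i. msum C a b (\<lambda>j. msum C a b (G i j) N) N) N"
    by (rule msum_all_eq) (simp_all add: vanish msum_zero)
  ultimately show ?thesis by simp
qed

text \<open>The rotation exchanges the dots before and after the cup-cap pair in the alternating
  braid relation, hence the two outer sums; both orders reduce to the same finite box.\<close>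

lemma msum_all_swap:
  assumes "\<And>i j m. D (G i j m) = a" "\<And>i j m. R (G i j m) = b"
    and "\<And>i j m. N \<le> i + j + m \<Longrightarrow> G i j m = Z a b"
  shows "msum_all C a b (\<lambda>i. msum_all C a b (\<lambda>j. msum_all C a b (G i j)))
    = msum_all C a b (\<lambda>i. msum_all C a b (\<lambda>j. msum_all C a b (G j i)))"
proof -
  have "msum_all C a b (\<lambda>i. msum_all C a b (\<lambda>j. msum_all C a b (G i j)))
    = msum C a b (\<lambda>i. msum C a b (\<lambda>j. msum C a b (G i j) N) N) N"
    by (rule msum_all_box) (simp_all add: assms)
  also have "\<dots> = msum C a b (\<lambda>i. msum C a b (\<lambda>j. msum C a b (G j i) N) N) N"
    by (rule msum_swap) (simp_all add: assms)
  also have "\<dots> = msum_all C a b (\<lambda>i. msum_all C a b (\<lambda>j. msum_all C a b (G j i)))"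
    by (rule msum_all_box [symmetric]) (simp_all add: assms add.commute)
  finally show ?thesis .
qed

lemma typing_mdet [simp]:
  assumes "\<And>i j. D (M i j) = []" "\<And>i j. R (M i j) = []"
  shows "D (mdet C n M) = []" "R (mdet C n M) = []"
proof -
  have "D (mdet C n M) = [] \<and> R (mdet C n M) = []"
    using assms
  proof (induction n arbitrary: M)
    case (Suc n)
    have "D (mdet C n (\<lambda>i l. M (Suc i) (if l < j then l else Suc l))) = [] \<and>
      R (mdet C n (\<lambda>i l. M (Suc i) (if l < j then l else Suc l))) = []" for j
      by (rule Suc.IH) (simp_all add: Suc.prems)
    then show ?case using Suc.prems by (simp del: msum.simps)
  qed simp
  then show "D (mdet C n M) = []" "R (mdet C n M) = []" by simp_all
qed

end

section \<open>Right mates\<close>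

locale heis = lmcat H for H :: "('k::comm_ring_1, 'm) heis" +
  fixes k :: int
  assumes rel: "heis_rel H k"
begin

abbreviation cmp_H (infixr "\<bullet>" 65) where "f \<bullet> g \<equiv> cmp H f g"
abbreviation tns_H (infixr "\<otimes>" 70) where "f \<otimes> g \<equiv> tns H f g"
abbreviation add_H (infixr "\<oplus>" 60) where "f \<oplus> g \<equiv> add H f g"
abbreviation x where "x \<equiv> gx H"
abbreviation s where "s \<equiv> gs H"
abbreviation c where "c \<equiv> gc H"
abbreviation d where "d \<equiv> gd H"
abbreviation t where "t \<equiv> tt H"
abbreviation \<tau> where "\<tau> \<equiv> gtau H"
abbreviation xp where "xp n \<equiv> mpow H [Up] (gx H) n"
abbreviation U where "U \<equiv> idm H [Up]"
abbreviation V where "V \<equiv> idm H [Dn]"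

lemma typing_gens [simp]:
  "D x = [Up]" "R x = [Up]" "D s = [Up, Up]" "R s = [Up, Up]" "D c = []" "R c = [Dn, Up]"
  "D d = [Up, Dn]" "R d = []" "D \<tau> = [Dn, Up]" "R \<tau> = [Up, Dn]"
  using rel unfolding heis_rel_def hom_def mem_Collect_eq by linarith+

lemma typing_pow [simp]: "D (xp n) = [Up]" "R (xp n) = [Up]"
proof -
  have "D (xp n) = [Up] \<and> R (xp n) = [Up]" by (induction n) simp_all
  then show "D (xp n) = [Up]" "R (xp n) = [Up]" by simp_all
qed

lemma typing_t [simp]: "D t = [Up, Dn]" "R t = [Dn, Up]"
  by (simp_all add: tt_def)

lemma ss: "s \<bullet> s = I [Up, Up]"
  and braid: "(s \<otimes> U) \<bullet> (U \<otimes> s) \<bullet> (s \<otimes> U) = (U \<otimes> s) \<bullet> (s \<otimes> U) \<bullet> (U \<otimes> s)"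
  and hecke_msub: "msub H ((x \<otimes> U) \<bullet> s) (s \<bullet> (U \<otimes> x)) = I [Up, Up]"
  and zigzag_Up: "(d \<otimes> U) \<bullet> (U \<otimes> c) = U"
  and zigzag_Dn: "(V \<otimes> d) \<bullet> (c \<otimes> V) = V"
  using rel unfolding heis_rel_def by linarith+

lemma hecke: "(x \<otimes> U) \<bullet> s = s \<bullet> (U \<otimes> x) \<oplus> I [Up, Up]"
  using hecke_msub eq_add_iff [of "(x \<otimes> U) \<bullet> s" "[Up, Up]" "[Up, Up]" "I [Up, Up]" "s \<bullet> (U \<otimes> x)"]
  by (simp add: msub_eq add_commute)

text \<open>Since \<open>s\<close> is an involution, composing \<open>hecke\<close> with
  \<open>s\<close> on both sides moves the dot to the other strand.\<close>

lemma hecke': "s \<bullet> (x \<otimes> U) = (U \<otimes> x) \<bullet> s \<oplus> I [Up, Up]"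
proof -
  have "s \<bullet> (x \<otimes> U) = s \<bullet> ((x \<otimes> U) \<bullet> s) \<bullet> s"
    by (simp add: cmp_assoc ss)
  also have "\<dots> = (s \<bullet> s) \<bullet> (U \<otimes> x) \<bullet> s \<oplus> s \<bullet> s"
    unfolding hecke by (simp add: lin cmp_assoc)
  finally show ?thesis by (simp add: ss)
qed

text \<open>The operation rho bends the leftmost input and the rightmost output strand downwards:
  it sends s to t, the dot x to the mate xD, and t to the mate sD of s.\<close>

definition rho where
  "rho a b f = (I (Dn # b) \<otimes> d) \<bullet> (V \<otimes> f \<otimes> V) \<bullet> (c \<otimes> I (a @ [Dn]))"

lemma typing_rho [simp]:
  assumes "D f = Up # a" "R f = b @ [Up]"
  shows "D (rho a b f) = a @ [Dn]" "R (rho a b f) = Dn # b"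
  using assms by (simp_all add: rho_def)

lemma cap_rho:
  assumes "D f = Up # a" "R f = b @ [Up]"
  shows "(d \<otimes> I b) \<bullet> (U \<otimes> rho a b f) = (I b \<otimes> d) \<bullet> (f \<otimes> V)"
proof -
  let ?g = "(I b \<otimes> d) \<bullet> (f \<otimes> V)"
  have "(d \<otimes> I b) \<bullet> (U \<otimes> rho a b f) = ((d \<otimes> I b) \<bullet> (I [Up, Dn] \<otimes> ?g)) \<bullet> (U \<otimes> c \<otimes> I (a @ [Dn]))"
    using assms by (simp add: rho_def lay)
  also have "(d \<otimes> I b) \<bullet> (I [Up, Dn] \<otimes> ?g) = ?g \<bullet> (d \<otimes> I (Up # a @ [Dn]))"
    using swap [of d _ _ ?g _ b] assms by simp
  also have "\<dots> \<bullet> (U \<otimes> c \<otimes> I (a @ [Dn])) = ?g \<bullet> (((d \<otimes> U) \<bullet> (U \<otimes> c)) \<otimes> I (a @ [Dn]))"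
    using assms by (simp add: lay)
  finally show ?thesis using assms by (simp add: zigzag_Up)
qed

lemma rho_cup:
  assumes "D f = Up # a" "R f = b @ [Up]"
  shows "(rho a b f \<otimes> U) \<bullet> (I a \<otimes> c) = (V \<otimes> f) \<bullet> (c \<otimes> I a)"
proof -
  let ?g = "(V \<otimes> f) \<bullet> (c \<otimes> I a)"
  have "(rho a b f \<otimes> U) \<bullet> (I a \<otimes> c) = (I (Dn # b) \<otimes> d \<otimes> U) \<bullet> ((?g \<otimes> I [Dn, Up]) \<bullet> (I a \<otimes> c))"
    using assms by (simp add: rho_def lay)
  also have "(?g \<otimes> I [Dn, Up]) \<bullet> (I a \<otimes> c) = (I (Dn # b @ [Up]) \<otimes> c) \<bullet> ?g"
    using swap [of ?g _ _ c] assms by simp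
  also have "(I (Dn # b) \<otimes> d \<otimes> U) \<bullet> \<dots> = (I (Dn # b) \<otimes> ((d \<otimes> U) \<bullet> (U \<otimes> c))) \<bullet> ?g"
    using assms by (simp add: lay)
  finally show ?thesis using assms by (simp add: zigzag_Up)
qed

text \<open>Straightening with \<open>zigzag_Dn\<close> recovers \<open>g\<close> from its composite
  with the cup, so the equation of \<open>rho_cup\<close> characterises \<open>rho a b f\<close>.
  The compatibility of \<open>rho\<close> with composition is proved by checking this
  equation.\<close>

lemma rho_unique:
  assumes "D f = Up # a" "R f = b @ [Up]" "D g = a @ [Dn]" "R g = Dn # b"
    and "(g \<otimes> U) \<bullet> (I a \<otimes> c) = (V \<otimes> f) \<bullet> (c \<otimes> I a)"
  shows "rho a b f = g"
proof -
  have "rho a b f = (I (Dn # b) \<otimes> d) \<bullet> (((V \<otimes> f) \<bullet> (c \<otimes> I a)) \<otimes> V)"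
    using assms(1,2) by (simp add: rho_def lay)
  also have "\<dots> = ((I (Dn # b) \<otimes> d) \<bullet> (g \<otimes> I [Up, Dn])) \<bullet> (I a \<otimes> c \<otimes> V)"
    unfolding assms(5) [symmetric] using assms(3,4) by (simp add: lay)
  also have "(I (Dn # b) \<otimes> d) \<bullet> (g \<otimes> I [Up, Dn]) = g \<bullet> (I (a @ [Dn]) \<otimes> d)"
    using swap [of g _ _ d] assms(3,4) by simp
  also have "\<dots> \<bullet> (I a \<otimes> c \<otimes> V) = g \<bullet> (I a \<otimes> ((V \<otimes> d) \<bullet> (c \<otimes> V)))"
    using assms(3,4) by (simp add: lay)
  finally show ?thesis using assms(3,4) by (simp add: zigzag_Dn)
qed

lemma rho_pre:
  assumes "D f = Up # a" "R f = b @ [Up]" "R h = a"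
  shows "rho (D h) b (f \<bullet> (U \<otimes> h)) = rho a b f \<bullet> (h \<otimes> V)"
proof (rule rho_unique)
  have "((rho a b f \<bullet> (h \<otimes> V)) \<otimes> U) \<bullet> (I (D h) \<otimes> c) = (rho a b f \<otimes> U) \<bullet> ((h \<otimes> I [Dn, Up]) \<bullet> (I (D h) \<otimes> c))"
    using assms by (simp add: lay)
  also have "\<dots> = ((rho a b f \<otimes> U) \<bullet> (I a \<otimes> c)) \<bullet> h"
    using swap [of h _ _ c] assms by (simp add: lay)
  also have "\<dots> = (V \<otimes> f) \<bullet> (c \<otimes> I a) \<bullet> h"
    using assms by (simp add: rho_cup lay)
  also have "\<dots> = (V \<otimes> (f \<bullet> (U \<otimes> h))) \<bullet> (c \<otimes> I (D h))"
    using swap [of c _ _ h] assms by (simp add: lay)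
  finally show "((rho a b f \<bullet> (h \<otimes> V)) \<otimes> U) \<bullet> (I (D h) \<otimes> c) = \<dots>" .
qed (use assms in simp_all)

lemma rho_post:
  assumes "D f = Up # a" "R f = b @ [Up]" "D h = b"
  shows "rho a (R h) ((h \<otimes> U) \<bullet> f) = (V \<otimes> h) \<bullet> rho a b f"
proof (rule rho_unique)
  have "(((V \<otimes> h) \<bullet> rho a b f) \<otimes> U) \<bullet> (I a \<otimes> c) = (V \<otimes> h \<otimes> U) \<bullet> ((rho a b f \<otimes> U) \<bullet> (I a \<otimes> c))"
    using assms by (simp add: lay)
  then show "(((V \<otimes> h) \<bullet> rho a b f) \<otimes> U) \<bullet> (I a \<otimes> c) = (V \<otimes> ((h \<otimes> U) \<bullet> f)) \<bullet> (c \<otimes> I a)"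
    using assms by (simp add: rho_cup lay)
qed (use assms in simp_all)

text \<open>The bent strand runs through \<open>f\<close> first and then through \<open>g\<close>.
  Once bent it runs downwards, so the two images are stacked in the opposite order.\<close>

lemma rho_star:
  assumes "D f = Up # a" "R f = b @ [Up]" "D g = Up # a'" "R g = b' @ [Up]"
  shows "rho (a @ a') (b @ b') ((I b \<otimes> g) \<bullet> (f \<otimes> I a')) = (rho a b f \<otimes> I b') \<bullet> (I a \<otimes> rho a' b' g)"
proof (rule rho_unique)
  have "(((rho a b f \<otimes> I b') \<bullet> (I a \<otimes> rho a' b' g)) \<otimes> U) \<bullet> (I (a @ a') \<otimes> c)
    = (rho a b f \<otimes> I (b' @ [Up])) \<bullet> (I a \<otimes> ((rho a' b' g \<otimes> U) \<bullet> (I a' \<otimes> c)))"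
    using assms by (simp add: lay)
  also have "\<dots> = ((rho a b f \<otimes> I (b' @ [Up])) \<bullet> (I (a @ [Dn]) \<otimes> g)) \<bullet> (I a \<otimes> c \<otimes> I a')"
    using assms by (simp add: rho_cup lay)
  also have "\<dots> = ((I (Dn # b) \<otimes> g) \<bullet> (rho a b f \<otimes> I (Up # a'))) \<bullet> (I a \<otimes> c \<otimes> I a')"
    using swap [of "rho a b f" _ _ g] assms by simp
  also have "\<dots> = (I (Dn # b) \<otimes> g) \<bullet> (((rho a b f \<otimes> U) \<bullet> (I a \<otimes> c)) \<otimes> I a')"
    using assms by (simp add: lay)
  also have "\<dots> = (V \<otimes> ((I b \<otimes> g) \<bullet> (f \<otimes> I a'))) \<bullet> (c \<otimes> I (a @ a'))"
    using assms by (simp add: rho_cup lay)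
  finally show "(((rho a b f \<otimes> I b') \<bullet> (I a \<otimes> rho a' b' g)) \<otimes> U) \<bullet> (I (a @ a') \<otimes> c) = \<dots>" .
qed (use assms in simp_all)

lemma rho_add:
  assumes "D f = Up # a" "R f = b @ [Up]" "D g = Up # a" "R g = b @ [Up]"
  shows "rho a b (f \<oplus> g) = rho a b f \<oplus> rho a b g"
  using assms by (simp add: rho_def lin)

lemma rho_cross: "rho [Up] [Up] s = t"
  by (simp add: rho_def tt_def)

lemma rho_Up: "rho [] [] U = V"
  by (rule rho_unique) simp_all

text \<open>In the identity the bent input lies on the left strand and the bent output on the right
  one, so bending leaves a cap below a cup. This is how the identity term of the Hecke relation
  becomes the error \<open>c \<bullet> d\<close> in \<open>t_dot\<close>.\<close>

lemma rho_UpUp: "rho [Up] [Up] (I [Up, Up]) = c \<bullet> d"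
  using swap [of c _ _ d] by (simp add: rho_def)

definition xD where "xD = rho [] [] x"
definition sD where "sD = rho [Dn] [Dn] t"

lemma typing_D [simp]: "D xD = [Dn]" "R xD = [Dn]" "D sD = [Dn, Dn]" "R sD = [Dn, Dn]"
  by (simp_all add: xD_def sD_def)

lemma cup_dot: "(xD \<otimes> U) \<bullet> c = (V \<otimes> x) \<bullet> c"
  using rho_cup [of x "[]" "[]"] by (simp add: xD_def)

lemma cap_dot: "d \<bullet> (U \<otimes> xD) = d \<bullet> (x \<otimes> V)"
  using cap_rho [of x "[]" "[]"] by (simp add: xD_def)

lemma cap_t: "(d \<otimes> U) \<bullet> (U \<otimes> t) = (U \<otimes> d) \<bullet> (s \<otimes> V)"
  using cap_rho [of s "[Up]" "[Up]"] by (simp add: rho_cross)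

lemma t_cup: "(t \<otimes> U) \<bullet> (U \<otimes> c) = (V \<otimes> s) \<bullet> (c \<otimes> U)"
  using rho_cup [of s "[Up]" "[Up]"] by (simp add: rho_cross)

lemma cap_sD: "(d \<otimes> V) \<bullet> (U \<otimes> sD) = (V \<otimes> d) \<bullet> (t \<otimes> V)"
  using cap_rho [of t "[Dn]" "[Dn]"] by (simp add: sD_def)

lemma t_dot: "(V \<otimes> x) \<bullet> t = t \<bullet> (x \<otimes> V) \<oplus> c \<bullet> d"
proof -
  have "rho [Up] [Up] ((x \<otimes> U) \<bullet> s) = (V \<otimes> x) \<bullet> t"
    using rho_post [of s "[Up]" "[Up]" x] by (simp add: rho_cross)
  moreover have "rho [Up] [Up] (s \<bullet> (U \<otimes> x)) = t \<bullet> (x \<otimes> V)"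
    using rho_pre [of s "[Up]" "[Up]" x] by (simp add: rho_cross)
  ultimately show ?thesis by (simp add: hecke rho_add rho_UpUp)
qed

lemma t_dot': "(xD \<otimes> U) \<bullet> t = t \<bullet> (U \<otimes> xD) \<oplus> c \<bullet> d"
proof -
  have "rho [Up] [Up] (s \<bullet> (x \<otimes> U)) = (xD \<otimes> U) \<bullet> t"
    using rho_star [of x "[]" "[]" s "[Up]" "[Up]"] by (simp add: rho_cross xD_def)
  moreover have "rho [Up] [Up] ((U \<otimes> x) \<bullet> s) = t \<bullet> (U \<otimes> xD)"
    using rho_star [of s "[Up]" "[Up]" x "[]" "[]"] by (simp add: rho_cross xD_def)
  ultimately show ?thesis by (simp add: hecke' rho_add rho_UpUp)
qed

text \<open>The braid relation says that \<open>(U \<otimes> s) \<bullet> (s \<otimes> U)\<close>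
  carries a crossing from its right input strands to its left output strands. Neither crossing
  touches a bent end, so naturality of \<open>rho\<close> transports the statement.\<close>

lemma braid_t: "(t \<otimes> U) \<bullet> (U \<otimes> t) \<bullet> (s \<otimes> V) = (V \<otimes> s) \<bullet> (t \<otimes> U) \<bullet> (U \<otimes> t)"
proof -
  let ?f = "(U \<otimes> s) \<bullet> (s \<otimes> U)"
  have f: "rho [Up, Up] [Up, Up] ?f = (t \<otimes> U) \<bullet> (U \<otimes> t)"
    using rho_star [of s "[Up]" "[Up]" s "[Up]" "[Up]"] by (simp add: rho_cross)
  have "?f \<bullet> (U \<otimes> s) = (s \<otimes> U) \<bullet> ?f" using braid by (simp add: cmp_assoc)
  then show ?thesis
    using rho_pre [of ?f "[Up, Up]" "[Up, Up]" s] rho_post [of ?f "[Up, Up]" "[Up, Up]" s]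
    by (simp add: f cmp_assoc)
qed

section \<open>Dotted caps\<close>

abbreviation "dx r \<equiv> d \<bullet> (xp r \<otimes> V)"

lemma pow_Suc': "xp (Suc n) = xp n \<bullet> x"
proof (induction n)
  case (Suc n)
  have "x \<bullet> xp (Suc n) = (x \<bullet> xp n) \<bullet> x" unfolding Suc by (simp add: cmp_assoc)
  then show ?case by simp
qed simp

lemma pow_comm: "x \<bullet> xp n = xp n \<bullet> x"
  using pow_Suc' by simp

lemma dx_dot: "dx r \<bullet> (x \<otimes> V) = dx (Suc r)"
  unfolding pow_Suc' by (simp add: lay)

lemma t_dot_neg: "t \<bullet> (x \<otimes> V) = (V \<otimes> x) \<bullet> t \<oplus> mneg H (c \<bullet> d)"
  using t_dot eq_add_iff [of "(V \<otimes> x) \<bullet> t" "[Up, Dn]" "[Dn, Up]" "t \<bullet> (x \<otimes> V)" "c \<bullet> d"] by simp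

lemma cw_nat: "cw H k (int n) = cw0 H k n" and ccw_nat: "ccw H k (int n) = ccw0 H k n"
  by (simp_all add: cw_def ccw_def)

text \<open>Iterated degenerate affine Hecke relation. Each dot either follows its strand through
  the crossing or is absorbed when the crossing is resolved, and then the remaining dots are split
  between the two strands.\<close>

lemma s_pow:
  "s \<bullet> (xp r \<otimes> U) \<bullet> s
    = (U \<otimes> xp r) \<oplus> msum H [Up, Up] [Up, Up] (\<lambda>i. s \<bullet> (xp (r - Suc i) \<otimes> xp i)) r"
proof (induction r)
  case (Suc r)
  have "s \<bullet> (xp (Suc r) \<otimes> U) \<bullet> s = s \<bullet> (xp r \<otimes> U) \<bullet> ((x \<otimes> U) \<bullet> s)"
    unfolding pow_Suc' by (simp add: lay)
  also have "\<dots> = (s \<bullet> (xp r \<otimes> U) \<bullet> s) \<bullet> (U \<otimes> x) \<oplus> s \<bullet> (xp r \<otimes> U)"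
    unfolding hecke by (simp add: lin cmp_assoc)
  also have "(s \<bullet> (xp r \<otimes> U) \<bullet> s) \<bullet> (U \<otimes> x) = (U \<otimes> xp (Suc r))
      \<oplus> msum H [Up, Up] [Up, Up] (\<lambda>i. s \<bullet> (xp (r - Suc i) \<otimes> xp i)) r \<bullet> (U \<otimes> x)"
    unfolding Suc.IH pow_Suc' by (simp add: lin lay)
  also have "msum H [Up, Up] [Up, Up] (\<lambda>i. s \<bullet> (xp (r - Suc i) \<otimes> xp i)) r \<bullet> (U \<otimes> x)
    = msum H [Up, Up] [Up, Up] (\<lambda>i. (s \<bullet> (xp (r - Suc i) \<otimes> xp i)) \<bullet> (U \<otimes> x)) r"
    by (rule msum_cmp_right) simp_all
  also have "\<dots> = msum H [Up, Up] [Up, Up] (\<lambda>i. s \<bullet> (xp (r - Suc i) \<otimes> xp (Suc i))) r"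
    unfolding pow_Suc' by (rule msum_cong) (simp add: cmp_assoc flip: interchange)
  finally show ?case
    by (subst msum_Suc_shift) (simp_all add: add_ac del: msum.simps mpow.simps(2))
qed (simp add: ss)

text \<open>Pulls an upward strand through a cap with \<open>r\<close> dots: \<open>cap_t\<close>
  turns \<open>t\<close> into a second crossing, and \<open>s_pow\<close> removes both at the price
  of the listed corrections. The pitchfork relation, the clockwise bubble slide and the alternating
  braid relation all start from this formula, with different cups attached below.\<close>

lemma dx_cross:
  "(dx r \<otimes> U) \<bullet> (U \<otimes> t) \<bullet> (s \<otimes> V) = (U \<otimes> dx r)
    \<oplus> msum H [Up, Up, Dn] [Up] (\<lambda>i. (d \<otimes> U) \<bullet> (xp (r - Suc i) \<otimes> (t \<bullet> (xp i \<otimes> V)))) r"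
proof -
  have "(dx r \<otimes> U) \<bullet> (U \<otimes> t) \<bullet> (s \<otimes> V) = (d \<otimes> U) \<bullet> ((xp r \<otimes> I [Dn, Up]) \<bullet> (U \<otimes> t)) \<bullet> (s \<otimes> V)"
    by (simp add: lay)
  also have "(xp r \<otimes> I [Dn, Up]) \<bullet> (U \<otimes> t) = (U \<otimes> t) \<bullet> (xp r \<otimes> I [Up, Dn])"
    by (rule swap) simp_all
  also have "(d \<otimes> U) \<bullet> ((U \<otimes> t) \<bullet> (xp r \<otimes> I [Up, Dn])) \<bullet> (s \<otimes> V)
    = ((d \<otimes> U) \<bullet> (U \<otimes> t)) \<bullet> (xp r \<otimes> I [Up, Dn]) \<bullet> (s \<otimes> V)"
    by (simp add: cmp_assoc)
  also have "\<dots> = (U \<otimes> d) \<bullet> ((s \<bullet> (xp r \<otimes> U) \<bullet> s) \<otimes> V)"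
    unfolding cap_t by (simp add: lay)
  also have "\<dots> = (U \<otimes> dx r)
    \<oplus> (U \<otimes> d) \<bullet> (msum H [Up, Up] [Up, Up] (\<lambda>i. s \<bullet> (xp (r - Suc i) \<otimes> xp i)) r \<otimes> V)"
    unfolding s_pow by (simp add: lin lay)
  also have "(U \<otimes> d) \<bullet> (msum H [Up, Up] [Up, Up] (\<lambda>i. s \<bullet> (xp (r - Suc i) \<otimes> xp i)) r \<otimes> V)
    = msum H [Up, Up, Dn] [Up] (\<lambda>i. (U \<otimes> d) \<bullet> ((s \<bullet> (xp (r - Suc i) \<otimes> xp i)) \<otimes> V)) r"
    by (rule msum_additive) (simp_all add: lin)
  also have "\<dots> = msum H [Up, Up, Dn] [Up] (\<lambda>i. (d \<otimes> U) \<bullet> (xp (r - Suc i) \<otimes> (t \<bullet> (xp i \<otimes> V)))) r"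
  proof (rule msum_cong)
    fix i
    have "(U \<otimes> d) \<bullet> ((s \<bullet> (xp (r - Suc i) \<otimes> xp i)) \<otimes> V) = ((U \<otimes> d) \<bullet> (s \<otimes> V)) \<bullet> (xp (r - Suc i) \<otimes> xp i \<otimes> V)"
      by (simp add: lay)
    also have "\<dots> = (d \<otimes> U) \<bullet> ((U \<otimes> t) \<bullet> (xp (r - Suc i) \<otimes> xp i \<otimes> V))"
      unfolding cap_t [symmetric] by (simp add: cmp_assoc)
    also have "(U \<otimes> t) \<bullet> (xp (r - Suc i) \<otimes> xp i \<otimes> V) = xp (r - Suc i) \<otimes> (t \<bullet> (xp i \<otimes> V))"
      by (simp flip: interchange)
    finally show "(U \<otimes> d) \<bullet> ((s \<bullet> (xp (r - Suc i) \<otimes> xp i)) \<otimes> V) = (d \<otimes> U) \<bullet> (xp (r - Suc i) \<otimes> (t \<bullet> (xp i \<otimes> V)))" .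
  qed
  finally show ?thesis .
qed

lemma dx_cup: "(dx r \<otimes> U) \<bullet> (U \<otimes> c) = xp r"
proof -
  have "(dx r \<otimes> U) \<bullet> (U \<otimes> c) = (d \<otimes> U) \<bullet> ((xp r \<otimes> I [Dn, Up]) \<bullet> (U \<otimes> c))"
    by (simp add: lay)
  also have "(xp r \<otimes> I [Dn, Up]) \<bullet> (U \<otimes> c) = (U \<otimes> c) \<bullet> xp r"
    using swap [of "xp r" _ _ c] by simp
  also have "(d \<otimes> U) \<bullet> (U \<otimes> c) \<bullet> xp r = ((d \<otimes> U) \<bullet> (U \<otimes> c)) \<bullet> xp r"
    by (simp add: cmp_assoc)
  finally show ?thesis by (simp add: zigzag_Up)
qed

end

section \<open>Nonnegative central charge\<close>

locale heis_nonneg = heis +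
  assumes k_nonneg: "0 \<le> k"
begin

abbreviation "K \<equiv> nat k"
abbreviation "e \<equiv> ge H"
abbreviation "c' \<equiv> cc' H k"
abbreviation "d' \<equiv> dd' H k"
abbreviation "W \<equiv> cw0 H k"
abbreviation "W' \<equiv> ccw0 H k"

lemma rel_nonneg:
  "r < K \<Longrightarrow> e r \<in> hom H [] [Up, Dn]"
  "\<tau> \<bullet> t \<oplus> msum H [Up, Dn] [Up, Dn] (\<lambda>r. e r \<bullet> dx r) K = I [Up, Dn]"
  "t \<bullet> \<tau> = I [Dn, Up]"
  "r < K \<Longrightarrow> t \<bullet> e r = Z [] [Dn, Up]"
  "r < K \<Longrightarrow> dx r \<bullet> \<tau> = Z [Dn, Up] []"
  "r < K \<Longrightarrow> q < K \<Longrightarrow> dx r \<bullet> e q = (if r = q then I [] else Z [] [])"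
proof -
  have *: "(\<forall>r. int r < k \<longrightarrow> e r \<in> hom H [] [Up, Dn]) \<and>
    \<tau> \<bullet> t \<oplus> msum H [Up, Dn] [Up, Dn] (\<lambda>r. e r \<bullet> dx r) K = I [Up, Dn] \<and>
    t \<bullet> \<tau> = I [Dn, Up] \<and>
    (\<forall>r. int r < k \<longrightarrow> t \<bullet> e r = Z [] [Dn, Up]) \<and>
    (\<forall>r. int r < k \<longrightarrow> dx r \<bullet> \<tau> = Z [Dn, Up] []) \<and>
    (\<forall>r q. int r < k \<and> int q < k \<longrightarrow> dx r \<bullet> e q = (if r = q then I [] else Z [] []))"
    by (rule mp [OF _ k_nonneg], insert rel, unfold heis_rel_def, elim conjE) assumption
  then show "\<tau> \<bullet> t \<oplus> msum H [Up, Dn] [Up, Dn] (\<lambda>r. e r \<bullet> dx r) K = I [Up, Dn]"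
    "t \<bullet> \<tau> = I [Dn, Up]"
    by blast+
  have lt: "int r < k \<longleftrightarrow> r < K" for r by auto
  from * [unfolded lt] show "r < K \<Longrightarrow> e r \<in> hom H [] [Up, Dn]"
    "r < K \<Longrightarrow> t \<bullet> e r = Z [] [Dn, Up]"
    "r < K \<Longrightarrow> dx r \<bullet> \<tau> = Z [Dn, Up] []"
    "r < K \<Longrightarrow> q < K \<Longrightarrow> dx r \<bullet> e q = (if r = q then I [] else Z [] [])"
    by blast+
qed

lemma typing_e [simp]: "r < K \<Longrightarrow> D (e r) = []" "r < K \<Longrightarrow> R (e r) = [Up, Dn]"
  using rel_nonneg(1) [of r] by (simp_all add: hom_def)

lemmas inverse_sum = rel_nonneg(2) and t_tau = rel_nonneg(3) and t_e = rel_nonneg(4)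
  and dx_tau = rel_nonneg(5) and dx_e = rel_nonneg(6)

text \<open>\<open>inverse_sum\<close> writes the identity as a sum of maps through \<open>t\<close>
  and the dotted caps, so a morphism can be rebuilt from its tests. The objects \<open>a\<close> and
  \<open>b\<close> allow testing any adjacent up-down pair of the codomain.\<close>

lemma joint_monic:
  assumes "D f = o'" "R f = a @ [Up, Dn] @ b" "D g = o'" "R g = a @ [Up, Dn] @ b"
    and t: "(I a \<otimes> t \<otimes> I b) \<bullet> f = (I a \<otimes> t \<otimes> I b) \<bullet> g"
    and dx: "\<And>r. r < K \<Longrightarrow> (I a \<otimes> dx r \<otimes> I b) \<bullet> f = (I a \<otimes> dx r \<otimes> I b) \<bullet> g"
  shows "f = g"
proof -
  have *: "h = (I a \<otimes> \<tau> \<otimes> I b) \<bullet> (I a \<otimes> t \<otimes> I b) \<bullet> h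
      \<oplus> msum H o' (a @ [Up, Dn] @ b) (\<lambda>r. (I a \<otimes> e r \<otimes> I b) \<bullet> (I a \<otimes> dx r \<otimes> I b) \<bullet> h) K"
    if "D h = o'" "R h = a @ [Up, Dn] @ b" for h
  proof -
    have "h = (I a \<otimes> (\<tau> \<bullet> t \<oplus> msum H [Up, Dn] [Up, Dn] (\<lambda>r. e r \<bullet> dx r) K) \<otimes> I b) \<bullet> h"
      unfolding inverse_sum using that by simp
    also have "\<dots> = (I a \<otimes> (\<tau> \<bullet> t) \<otimes> I b) \<bullet> h \<oplus>
        (I a \<otimes> msum H [Up, Dn] [Up, Dn] (\<lambda>r. e r \<bullet> dx r) K \<otimes> I b) \<bullet> h"
      using that by (simp add: lin)
    also have "(I a \<otimes> msum H [Up, Dn] [Up, Dn] (\<lambda>r. e r \<bullet> dx r) K \<otimes> I b) \<bullet> h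
       = msum H o' (a @ [Up, Dn] @ b) (\<lambda>r. (I a \<otimes> (e r \<bullet> dx r) \<otimes> I b) \<bullet> h) K"
      by (rule msum_additive) (use that in \<open>simp_all add: lin\<close>)
    also have "\<dots> = msum H o' (a @ [Up, Dn] @ b) (\<lambda>r. (I a \<otimes> e r \<otimes> I b) \<bullet> (I a \<otimes> dx r \<otimes> I b) \<bullet> h) K"
      by (rule msum_cong) (use that in \<open>simp add: lay\<close>)
    finally show ?thesis using that by (simp add: lay)
  qed
  have "msum H o' (a @ [Up, Dn] @ b) (\<lambda>r. (I a \<otimes> e r \<otimes> I b) \<bullet> (I a \<otimes> dx r \<otimes> I b) \<bullet> f) K
    = msum H o' (a @ [Up, Dn] @ b) (\<lambda>r. (I a \<otimes> e r \<otimes> I b) \<bullet> (I a \<otimes> dx r \<otimes> I b) \<bullet> g) K"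
    by (rule msum_cong) (simp only: dx)
  then show ?thesis using * [of f] * [of g] assms(1-4) t by simp
qed

lemma typing_c'd' [simp]: "D c' = []" "R c' = [Up, Dn]" "D d' = [Dn, Up]" "R d' = []"
  using k_nonneg by (simp_all add: cc'_def dd'_def)

lemma typing_W [simp]: "D (W n) = []" "R (W n) = []" "D (W' n) = []" "R (W' n) = []"
  by (simp_all add: cw0_def ccw0_def)

lemma d'_eq: "d' = dx K \<bullet> \<tau>"
  using k_nonneg by (simp add: dd'_def cmp_assoc)

lemma c'_eq: "0 < K \<Longrightarrow> c' = mneg H (e (K - 1))" "K = 0 \<Longrightarrow> c' = \<tau> \<bullet> c"
  using k_nonneg by (simp_all add: cc'_def nat_diff_distrib)

lemma W_eq: "dx n \<bullet> c' = W n"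
  by (simp add: cw0_def cmp_assoc)

lemma W_zero: "Suc n < K \<Longrightarrow> W n = Z [] []"
  using dx_e [of n "K - 1"] by (auto simp: c'_eq simp flip: W_eq)

lemma W_last: "Suc n = K \<Longrightarrow> W n = mneg H (I [])"
  using dx_e [of n "K - 1"] by (auto simp: c'_eq simp flip: W_eq)

lemma t_c': "t \<bullet> c' = (if K = 0 then c else Z [] [Dn, Up])"
proof (cases "K = 0")
  case True
  have "t \<bullet> \<tau> \<bullet> c = c" using t_tau by (simp flip: cmp_assoc)
  with True show ?thesis by (simp add: c'_eq)
qed (simp add: c'_eq t_e)

text \<open>Moving the dots through \<open>t\<close> one at a time leaves terms
  \<open>c \<bullet> W j\<close> with \<open>j < i\<close>; as \<open>i < K\<close>, all these
  bubbles lie below the first nonzero one.\<close>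

lemma t_pow_c': "i < K \<Longrightarrow> t \<bullet> (xp i \<otimes> V) \<bullet> c' = Z [] [Dn, Up]"
proof (induction i)
  case (Suc i)
  have "t \<bullet> (xp (Suc i) \<otimes> V) \<bullet> c' = (t \<bullet> (x \<otimes> V)) \<bullet> (xp i \<otimes> V) \<bullet> c'"
    by (simp add: lay)
  also have "\<dots> = (V \<otimes> x) \<bullet> (t \<bullet> (xp i \<otimes> V) \<bullet> c') \<oplus> mneg H (c \<bullet> W i)"
    unfolding t_dot_neg by (simp add: lin cmp_assoc flip: W_eq)
  also have "\<dots> = Z [] [Dn, Up]" using Suc by (simp add: W_zero)
  finally show ?case .
qed (simp add: t_c')

lemma t_pow_tau: "i \<le> K \<Longrightarrow> t \<bullet> (xp i \<otimes> V) \<bullet> \<tau> = V \<otimes> xp i"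
proof (induction i)
  case (Suc i)
  have "t \<bullet> (xp (Suc i) \<otimes> V) \<bullet> \<tau> = (t \<bullet> (x \<otimes> V)) \<bullet> (xp i \<otimes> V) \<bullet> \<tau>"
    by (simp add: lay)
  also have "\<dots> = (V \<otimes> x) \<bullet> (t \<bullet> (xp i \<otimes> V) \<bullet> \<tau>) \<oplus> mneg H (c \<bullet> (dx i \<bullet> \<tau>))"
    unfolding t_dot_neg by (simp add: lin cmp_assoc)
  also have "\<dots> = V \<otimes> xp (Suc i)"
  proof -
    have "dx i \<bullet> \<tau> = Z [Dn, Up] []" "t \<bullet> (xp i \<otimes> V) \<bullet> \<tau> = V \<otimes> xp i"
      using Suc by (simp_all only: dx_tau Suc_le_eq less_imp_le)
    then show ?thesis by (simp only:) (simp add: lay)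
  qed
  finally show ?case .
qed (simp add: t_tau)

text \<open>Only one test sees the error term. For \<open>K = 0\<close> it is \<open>t\<close>,
  because then \<open>t \<bullet> c' = c\<close> and \<open>d' = d \<bullet> \<tau>\<close>. For
  \<open>K > 0\<close> it is the cap with \<open>K - 1\<close> dots: one more dot turns that cap on
  \<open>\<tau>\<close> into \<open>d'\<close>, and \<open>W (K - 1)\<close> is minus the
  identity.\<close>

lemma tau_dot: "\<tau> \<bullet> (V \<otimes> x) = (x \<otimes> V) \<bullet> \<tau> \<oplus> c' \<bullet> d'"
proof (rule joint_monic [where a = "[]" and b = "[]"])
  have "t \<bullet> \<tau> \<bullet> (V \<otimes> x) = V \<otimes> x"
    by (simp add: t_tau flip: cmp_assoc)
  moreover have "t \<bullet> (x \<otimes> V) \<bullet> \<tau> = (V \<otimes> x) \<oplus> mneg H (c \<bullet> d \<bullet> \<tau>)"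
    using arg_cong [OF t_dot_neg, of "\<lambda>z. z \<bullet> \<tau>"] by (simp add: lin cmp_assoc t_tau)
  moreover have "t \<bullet> c' \<bullet> d' = c \<bullet> d \<bullet> \<tau>"
  proof (cases "K = 0")
    case True
    have "(t \<bullet> c') \<bullet> d' = c \<bullet> d'" using True by (simp add: t_c')
    then show ?thesis using True by (simp add: d'_eq cmp_assoc)
  next
    case False
    have "(t \<bullet> c') \<bullet> d' = Z [Dn, Up] [Dn, Up]" using False by (simp add: t_c')
    then show ?thesis using False dx_tau [of 0] by (simp add: cmp_assoc)
  qed
  ultimately show "(I [] \<otimes> t \<otimes> I []) \<bullet> \<tau> \<bullet> (V \<otimes> x) = (I [] \<otimes> t \<otimes> I []) \<bullet> ((x \<otimes> V) \<bullet> \<tau> \<oplus> c' \<bullet> d')"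
    by (simp add: lin add_assoc)
next
  fix r assume r: "r < K"
  have "dx r \<bullet> \<tau> \<bullet> (V \<otimes> x) = (dx r \<bullet> \<tau>) \<bullet> (V \<otimes> x)" by (simp add: cmp_assoc)
  also have "\<dots> = Z [Dn, Up] []" using r by (simp add: dx_tau)
  moreover have "dx r \<bullet> (x \<otimes> V) \<bullet> \<tau> = dx (Suc r) \<bullet> \<tau>"
    unfolding dx_dot [symmetric] by (simp add: cmp_assoc)
  moreover have "dx r \<bullet> c' \<bullet> d' = W r \<bullet> d'"
    unfolding W_eq [symmetric] by (simp add: cmp_assoc)
  moreover have "dx (Suc r) \<bullet> \<tau> \<oplus> W r \<bullet> d' = Z [Dn, Up] []"
  proof (cases "Suc r = K")
    case True
    then have "W r = mneg H (I [])" by (rule W_last)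
    then show ?thesis unfolding True d'_eq by simp
  next
    case False
    then have "Suc r < K" using r by simp
    then show ?thesis using dx_tau [of "Suc r"] by (simp add: W_zero del: mpow.simps)
  qed
  ultimately show "(I [] \<otimes> dx r \<otimes> I []) \<bullet> \<tau> \<bullet> (V \<otimes> x) = (I [] \<otimes> dx r \<otimes> I []) \<bullet> ((x \<otimes> V) \<bullet> \<tau> \<oplus> c' \<bullet> d')"
    by (simp add: lin)
qed simp_all

section \<open>Bubble recursion\<close>

text \<open>Bubbles indexed so that the first nonzero one has index 0.\<close>

definition "B n = ccw H k (int n - k - 1)"

text \<open>The matrix is Hessenberg with superdiagonal entries -1; shifting its first column by a makes
  the family closed under deleting the first row and the second column.\<close>

definition "hess n a = mdet H n (\<lambda>i j. if j = 0 then W (K + a + i) else W (nat (int i - int j + k)))"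

lemma typing_hess [simp]: "D (hess n a) = []" "R (hess n a) = []"
  by (simp_all add: hess_def)

text \<open>The first row is \<open>W (K + a)\<close>, then -1, then zeros, so two cofactors
  survive, and the sign of the second cancels the entry -1. The bound \<open>Suc n \<le> K\<close>
  keeps the indices \<open>K - j\<close> of that row positive, so that \<open>nat\<close> does not
  truncate them.\<close>

lemma hess_rec:
  assumes "Suc n \<le> K"
  shows "hess (Suc n) a = W (K + a) \<bullet> hess n 0 \<oplus> (if n = 0 then Z [] [] else hess n (Suc a))"
proof -
  define M where "M = (\<lambda>i j. if j = 0 then W (K + a + i) else W (nat (int i - int j + k)))"
  define G where "G = (\<lambda>j. smul H ((-1) ^ j) (M 0 j \<bullet> mdet H n (\<lambda>i l. M (Suc i) (if l < j then l else Suc l))))"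
  have M [simp]: "D (M i j) = []" "R (M i j) = []" for i j by (simp_all add: M_def)
  have G [simp]: "D (G j) = []" "R (G j) = []" for j by (simp_all add: G_def)
  have hess: "hess (Suc n) a = msum H [] [] G (Suc n)"
    unfolding hess_def G_def M_def mdet.simps ..
  have "(\<lambda>i l. M (Suc i) (Suc l)) = (\<lambda>i j. if j = 0 then W (K + 0 + i) else W (nat (int i - int j + k)))"
    using k_nonneg by (auto simp: M_def fun_eq_iff nat_add_distrib intro!: arg_cong [where f = W])
  then have G0: "G 0 = W (K + a) \<bullet> hess n 0"
    by (simp add: G_def hess_def) (simp add: M_def)
  show ?thesis
  proof (cases "n = 0")
    case True
    then show ?thesis using hess G0 by simp
  next
    case False
    have "(\<lambda>i l. M (Suc i) (if l < 1 then l else Suc l))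
        = (\<lambda>i j. if j = 0 then W (K + Suc a + i) else W (nat (int i - int j + k)))"
      by (auto simp: M_def fun_eq_iff)
    moreover have "M 0 1 = mneg H (I [])"
      using W_last [of "K - 1"] assms k_nonneg by (simp add: M_def nat_diff_distrib)
    ultimately have G1: "G 1 = hess n (Suc a)"
      by (simp add: G_def hess_def flip: mneg_def)
    have "G j = Z [] []" if "2 \<le> j" "j < Suc n" for j
    proof -
      have "M 0 j = W (K - j)" using that k_nonneg by (simp add: M_def nat_diff_distrib')
      also have "\<dots> = Z [] []" using that assms by (intro W_zero) simp
      finally show ?thesis by (simp add: G_def)
    qed
    then have "hess (Suc n) a = msum H [] [] G 2"
      unfolding hess using False by (intro msum_extend) simp_all
    then show ?thesis using False G0 G1 by (simp add: numeral_2_eq_2)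
  qed
qed

lemma hess_expand: "Suc n \<le> K \<Longrightarrow> hess (Suc n) a = msum H [] [] (\<lambda>i. W (K + a + i) \<bullet> hess (n - i) 0) (Suc n)"
proof (induction n arbitrary: a)
  case 0
  then show ?case by (simp add: hess_rec)
next
  case (Suc n)
  have "hess (Suc (Suc n)) a = W (K + a) \<bullet> hess (Suc n) 0 \<oplus> msum H [] [] (\<lambda>i. W (K + Suc a + i) \<bullet> hess (n - i) 0) (Suc n)"
    using hess_rec [of "Suc n" a] Suc.IH [of "Suc a"] Suc.prems by (simp del: msum.simps)
  also have "\<dots> = msum H [] [] (\<lambda>i. W (K + a + i) \<bullet> hess (Suc n - i) 0) (Suc (Suc n))"
    by (subst msum_Suc_shift) (simp_all del: msum.simps)
  finally show ?case .
qed

text \<open>For \<open>n \<le> K\<close> the bubble index \<open>n - k - 1\<close> is negative, so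
  \<open>B n\<close> is a determinant by definition, and its size is \<open>n\<close>.\<close>

lemma B_eq_hess: "n \<le> K \<Longrightarrow> B n = hess n 0"
  using k_nonneg by (auto simp: B_def ccw_def idet_def hess_def fun_eq_iff nat_add_distrib
    intro!: arg_cong [where f = W] arg_cong [where f = "mdet H n"])

lemma B_eq_W': "B (K + Suc n) = W' n"
  using k_nonneg by (simp add: B_def ccw_def)

lemma B_0: "B 0 = I []"
  by (simp add: B_eq_hess hess_def)

lemma typing_B [simp]: "D (B n) = []" "R (B n) = []"
proof -
  have "D (B n) = [] \<and> R (B n) = []"
  proof (cases "n \<le> K")
    case False
    then obtain m where "n = K + Suc m" by (metis add_Suc_right less_imp_Suc_add not_le_imp_less)
    then show ?thesis using B_eq_W' by simp
  qed (simp add: B_eq_hess)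
  then show "D (B n) = []" "R (B n) = []" by simp_all
qed

lemma B_Suc_le: "Suc n \<le> K \<Longrightarrow> B (Suc n) = msum H [] [] (\<lambda>i. W (K + i) \<bullet> B (n - i)) (Suc n)"
  using hess_expand [of n 0] by (auto simp: B_eq_hess simp del: of_nat_Suc msum.simps intro!: msum_cong)

text \<open>For j < K this is minus the component of the inverse with index K - 1 - j, and for j = K it
  is the composite of \<open>\<tau>\<close> and c.\<close>

definition "cup_sum j = msum H [] [Up, Dn] (\<lambda>i. (xp i \<otimes> V) \<bullet> c' \<bullet> B (j - i)) (Suc j)"

lemma typing_cup_sum [simp]: "D (cup_sum j) = []" "R (cup_sum j) = [Up, Dn]"
  by (simp_all add: cup_sum_def del: msum.simps)

lemma dx_shift: "dx q \<bullet> (xp i \<otimes> V) = dx (q + i)"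
proof -
  have "xp q \<bullet> xp i = xp (q + i)"
    by (induction q) (simp_all add: cmp_assoc)
  then show ?thesis by (simp add: lay flip: whisker(2))
qed

lemma dx_cup_sum: "dx q \<bullet> cup_sum j = msum H [] [] (\<lambda>i. W (q + i) \<bullet> B (j - i)) (Suc j)"
proof -
  have "dx q \<bullet> cup_sum j = msum H [] [] (\<lambda>i. dx q \<bullet> (xp i \<otimes> V) \<bullet> c' \<bullet> B (j - i)) (Suc j)"
    unfolding cup_sum_def by (rule msum_cmp_left) simp_all
  also have "\<dots> = msum H [] [] (\<lambda>i. W (q + i) \<bullet> B (j - i)) (Suc j)"
  proof (rule msum_cong)
    fix i
    have "dx q \<bullet> (xp i \<otimes> V) \<bullet> c' \<bullet> B (j - i) = ((dx q \<bullet> (xp i \<otimes> V)) \<bullet> c') \<bullet> B (j - i)"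
      by (simp add: cmp_assoc)
    also have "\<dots> = W (q + i) \<bullet> B (j - i)"
      unfolding dx_shift W_eq ..
    finally show "dx q \<bullet> (xp i \<otimes> V) \<bullet> c' \<bullet> B (j - i) = W (q + i) \<bullet> B (j - i)" .
  qed
  finally show ?thesis .
qed

text \<open>A Horner step. By the determinant recursion the new coefficient \<open>B (Suc j)\<close>
  is \<open>dx K \<bullet> cup_sum j\<close>, which gives the recursion the same shape as the one
  satisfied by the components \<open>e r\<close>.\<close>

lemma cup_sum_Suc:
  assumes "Suc j \<le> K"
  shows "cup_sum (Suc j) = (x \<otimes> V) \<bullet> cup_sum j \<oplus> c' \<bullet> dx K \<bullet> cup_sum j"
proof -
  have "cup_sum (Suc j) = c' \<bullet> B (Suc j) \<oplus> msum H [] [Up, Dn] (\<lambda>i. (xp (Suc i) \<otimes> V) \<bullet> c' \<bullet> B (j - i)) (Suc j)"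
    unfolding cup_sum_def by (subst msum_Suc_shift) (simp_all del: msum.simps of_nat_Suc)
  also have "msum H [] [Up, Dn] (\<lambda>i. (xp (Suc i) \<otimes> V) \<bullet> c' \<bullet> B (j - i)) (Suc j) = (x \<otimes> V) \<bullet> cup_sum j"
    unfolding cup_sum_def by (subst msum_cmp_left) (simp_all add: lay del: msum.simps)
  also have "B (Suc j) = dx K \<bullet> cup_sum j"
    using B_Suc_le [OF assms] by (simp only: dx_cup_sum)
  finally show ?thesis by (simp add: add_commute)
qed

text \<open>A dot on \<open>e (Suc r)\<close> lowers by one the number of dots on the cap dual to
  it. The only defect is seen by the cap with \<open>K - 1\<close> dots, which becomes
  \<open>dx K\<close>; adding \<open>c' \<bullet> dx K \<bullet> e (Suc r)\<close> cancels it
  because \<open>W (K - 1)\<close> is minus the identity. This determines \<open>e r\<close> from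
  \<open>e (Suc r)\<close>.\<close>

lemma e_eq_cup_sum:
  assumes "j < K"
  shows "e (K - Suc j) = mneg H (cup_sum j)"
  using assms
proof (induction j)
  case 0
  have "cup_sum 0 = c'" using B_0 by (simp add: cup_sum_def)
  then show ?case using 0 by (simp add: c'_eq)
next
  case (Suc j)
  define r where "r = K - Suc (Suc j)"
  have r: "K - Suc j = Suc r" "Suc r < K" "0 < K" using Suc.prems by (simp_all add: r_def)
  have "e r = (x \<otimes> V) \<bullet> e (Suc r) \<oplus> c' \<bullet> dx K \<bullet> e (Suc r)"
  proof (rule joint_monic [where a = "[]" and b = "[]"])
    have "t \<bullet> (x \<otimes> V) \<bullet> e (Suc r) = (V \<otimes> x) \<bullet> (t \<bullet> e (Suc r)) \<oplus> mneg H (c \<bullet> (dx 0 \<bullet> e (Suc r)))"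
      using arg_cong [OF t_dot_neg, of "\<lambda>z. z \<bullet> e (Suc r)"] r by (simp add: lin cmp_assoc)
    also have "\<dots> = Z [] [Dn, Up]" using r t_e [of "Suc r"] dx_e [of 0 "Suc r"] by simp
    finally have "t \<bullet> (x \<otimes> V) \<bullet> e (Suc r) = Z [] [Dn, Up]" .
    moreover have "t \<bullet> c' \<bullet> dx K \<bullet> e (Suc r) = (t \<bullet> c') \<bullet> dx K \<bullet> e (Suc r)"
      using r by (simp add: cmp_assoc)
    ultimately show "(I [] \<otimes> t \<otimes> I []) \<bullet> e r = (I [] \<otimes> t \<otimes> I []) \<bullet> ((x \<otimes> V) \<bullet> e (Suc r) \<oplus> c' \<bullet> dx K \<bullet> e (Suc r))"
      using r by (simp add: lin t_e t_c')
  next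
    fix q assume q: "q < K"
    have "dx q \<bullet> (x \<otimes> V) \<bullet> e (Suc r) = dx (Suc q) \<bullet> e (Suc r)"
      using r unfolding dx_dot [symmetric] by (simp add: cmp_assoc)
    moreover have "dx q \<bullet> c' \<bullet> dx K \<bullet> e (Suc r) = W q \<bullet> dx K \<bullet> e (Suc r)"
      using r unfolding W_eq [symmetric] by (simp add: cmp_assoc)
    moreover have "dx q \<bullet> e r = dx (Suc q) \<bullet> e (Suc r) \<oplus> W q \<bullet> dx K \<bullet> e (Suc r)"
    proof (cases "Suc q = K")
      case True
      then have "W q = mneg H (I [])" by (rule W_last)
      moreover have "q \<noteq> r" using True r by simp
      ultimately show ?thesis using r q dx_e [of q r] by (simp add: True del: mpow.simps)
    next
      case False
      then have "Suc q < K" using q by simp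
      moreover have "W q = Z [] []" using \<open>Suc q < K\<close> by (rule W_zero)
      ultimately show ?thesis using r q dx_e [of q r] dx_e [of "Suc q" "Suc r"] by (simp del: mpow.simps)
    qed
    ultimately show "(I [] \<otimes> dx q \<otimes> I []) \<bullet> e r = (I [] \<otimes> dx q \<otimes> I []) \<bullet> ((x \<otimes> V) \<bullet> e (Suc r) \<oplus> c' \<bullet> dx K \<bullet> e (Suc r))"
      using r by (simp add: lin)
  qed (use r in simp_all)
  also have "\<dots> = mneg H (cup_sum (Suc j))"
    using Suc r by (simp add: cup_sum_Suc lin)
  finally show ?case by (simp add: r_def)
qed

text \<open>The recursion for the components, continued one step below \<open>e 0\<close>. What is
  new is that \<open>d \<bullet> e 0\<close> is the identity, so \<open>t\<close> sends the dotted
  \<open>e 0\<close> to \<open>- c\<close> instead of zero.\<close>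

lemma tau_c: "\<tau> \<bullet> c = cup_sum K"
proof (cases "K = 0")
  case True
  then show ?thesis using B_0 by (simp add: cup_sum_def c'_eq)
next
  case False
  then obtain j where j: "K = Suc j" using not0_implies_Suc by blast
  have "\<tau> \<bullet> c = mneg H ((x \<otimes> V) \<bullet> e 0 \<oplus> c' \<bullet> dx K \<bullet> e 0)"
  proof (rule joint_monic [where a = "[]" and b = "[]"])
    have "t \<bullet> (x \<otimes> V) \<bullet> e 0 = (V \<otimes> x) \<bullet> (t \<bullet> e 0) \<oplus> mneg H (c \<bullet> (dx 0 \<bullet> e 0))"
      using arg_cong [OF t_dot_neg, of "\<lambda>z. z \<bullet> e 0"] j by (simp add: lin cmp_assoc)
    also have "\<dots> = mneg H c" using j t_e [of 0] dx_e [of 0 0] by simp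
    finally have "t \<bullet> (x \<otimes> V) \<bullet> e 0 = mneg H c" .
    moreover have "t \<bullet> c' \<bullet> dx K \<bullet> e 0 = (t \<bullet> c') \<bullet> dx K \<bullet> e 0"
      using j by (simp add: cmp_assoc)
    moreover have "t \<bullet> \<tau> \<bullet> c = c"
      by (simp add: t_tau flip: cmp_assoc)
    ultimately show "(I [] \<otimes> t \<otimes> I []) \<bullet> \<tau> \<bullet> c = (I [] \<otimes> t \<otimes> I []) \<bullet> mneg H ((x \<otimes> V) \<bullet> e 0 \<oplus> c' \<bullet> dx K \<bullet> e 0)"
      using j by (simp add: lin t_c')
  next
    fix q assume q: "q < K"
    have "dx q \<bullet> (x \<otimes> V) \<bullet> e 0 = dx (Suc q) \<bullet> e 0"
      using j unfolding dx_dot [symmetric] by (simp add: cmp_assoc)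
    moreover have "dx q \<bullet> c' \<bullet> dx K \<bullet> e 0 = W q \<bullet> dx K \<bullet> e 0"
      using j unfolding W_eq [symmetric] by (simp add: cmp_assoc)
    moreover have "dx (Suc q) \<bullet> e 0 \<oplus> W q \<bullet> dx K \<bullet> e 0 = Z [] []"
    proof (cases "Suc q = K")
      case True
      then have "W q = mneg H (I [])" by (rule W_last)
      then show ?thesis using j q by (simp add: True del: mpow.simps)
    next
      case False
      then have "Suc q < K" using q by simp
      moreover have "W q = Z [] []" using \<open>Suc q < K\<close> by (rule W_zero)
      ultimately show ?thesis using j q dx_e [of "Suc q" 0] by (simp del: mpow.simps)
    qed
    moreover have "dx q \<bullet> \<tau> \<bullet> c = (dx q \<bullet> \<tau>) \<bullet> c" by (simp add: cmp_assoc)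
    ultimately show "(I [] \<otimes> dx q \<otimes> I []) \<bullet> \<tau> \<bullet> c = (I [] \<otimes> dx q \<otimes> I []) \<bullet> mneg H ((x \<otimes> V) \<bullet> e 0 \<oplus> c' \<bullet> dx K \<bullet> e 0)"
      using j q by (simp add: cmp_add dx_tau flip: mneg_add)
  qed (use j in simp_all)
  also have "e 0 = mneg H (cup_sum j)" using e_eq_cup_sum [of j] j by simp
  also have "mneg H ((x \<otimes> V) \<bullet> mneg H (cup_sum j) \<oplus> c' \<bullet> dx K \<bullet> mneg H (cup_sum j)) = cup_sum K"
    unfolding j using cup_sum_Suc [of j] by (simp add: j lin)
  finally show ?thesis .
qed

text \<open>Every dot pulled through \<open>\<tau>\<close> by \<open>tau_dot\<close> either joins
  the dots on the cap or cuts the diagram into a product of two bubbles.\<close>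

lemma dx_tau_pow:
  "dx p \<bullet> \<tau> \<bullet> (V \<otimes> xp n) \<bullet> c = dx (p + n) \<bullet> \<tau> \<bullet> c \<oplus> msum H [] [] (\<lambda>b. W (p + n - Suc b) \<bullet> W' b) n"
proof (induction n arbitrary: p)
  case (Suc n)
  have "dx p \<bullet> \<tau> \<bullet> (V \<otimes> xp (Suc n)) \<bullet> c = dx p \<bullet> (\<tau> \<bullet> (V \<otimes> x)) \<bullet> (V \<otimes> xp n) \<bullet> c"
    by (simp add: lay)
  also have "\<dots> = (dx p \<bullet> (x \<otimes> V)) \<bullet> \<tau> \<bullet> (V \<otimes> xp n) \<bullet> c \<oplus> (dx p \<bullet> c') \<bullet> d' \<bullet> (V \<otimes> xp n) \<bullet> c"
    unfolding tau_dot by (simp add: lin cmp_assoc)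
  also have "\<dots> = dx (Suc p) \<bullet> \<tau> \<bullet> (V \<otimes> xp n) \<bullet> c \<oplus> W p \<bullet> W' n"
    unfolding dx_dot W_eq ccw0_def ..
  also have "\<dots> = dx (p + Suc n) \<bullet> \<tau> \<bullet> c \<oplus> (msum H [] [] (\<lambda>b. W (Suc p + n - Suc b) \<bullet> W' b) n \<oplus> W p \<bullet> W' n)"
    unfolding Suc.IH by (simp add: add_assoc del: mpow.simps)
  finally show ?case by simp
qed simp

text \<open>Past the determinants the sum splits at \<open>m = n - K\<close>. The terms with
  \<open>i < m\<close> are the products of bubbles cut off in \<open>dx_tau_pow\<close>; the
  remaining \<open>K + 1\<close> terms come from \<open>tau_c\<close> and contain \<open>B j\<close>
  with \<open>j \<le> K\<close>.\<close>

lemma B_Suc: "B (Suc n) = msum H [] [] (\<lambda>i. W (K + i) \<bullet> B (n - i)) (Suc n)"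
proof (cases "Suc n \<le> K")
  case True
  then show ?thesis by (rule B_Suc_le)
next
  case False
  define m where "m = n - K"
  have n: "n = m + K" using False by (simp add: m_def)
  have "B (Suc n) = W' m" using B_eq_W' [of m] by (simp add: n add.commute)
  also have "\<dots> = dx K \<bullet> \<tau> \<bullet> (V \<otimes> xp m) \<bullet> c" by (simp add: ccw0_def d'_eq cmp_assoc)
  also have "\<dots> = dx (K + m) \<bullet> \<tau> \<bullet> c \<oplus> msum H [] [] (\<lambda>b. W (K + m - Suc b) \<bullet> W' b) m"
    by (rule dx_tau_pow)
  also have "dx (K + m) \<bullet> \<tau> \<bullet> c = msum H [] [] (\<lambda>i. W (K + (m + i)) \<bullet> B (n - (m + i))) (Suc K)"
    unfolding tau_c dx_cup_sum n by (simp add: add.assoc del: msum.simps)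
  also have "msum H [] [] (\<lambda>b. W (K + m - Suc b) \<bullet> W' b) m = msum H [] [] (\<lambda>i. W (K + m - Suc (m - Suc i)) \<bullet> W' (m - Suc i)) m"
    by (rule msum_rev) simp_all
  also have "\<dots> = msum H [] [] (\<lambda>i. W (K + i) \<bullet> B (n - i)) m"
  proof (rule msum_cong)
    fix i assume i: "i < m"
    then have "n - i = K + Suc (m - Suc i)" "K + m - Suc (m - Suc i) = K + i" by (simp_all add: n)
    then show "W (K + m - Suc (m - Suc i)) \<bullet> W' (m - Suc i) = W (K + i) \<bullet> B (n - i)"
      using B_eq_W' [of "m - Suc i"] by simp
  qed
  finally have "B (Suc n) = msum H [] [] (\<lambda>i. W (K + i) \<bullet> B (n - i)) (m + Suc K)"
    by (subst msum_append) (simp_all add: add_commute del: msum.simps)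
  then show ?thesis by (simp add: n del: msum.simps)
qed

section \<open>Left adjunction\<close>

text \<open>For nonnegative charge and negative index the clockwise determinant has size at most 0,
  with equality only for charge 0 and index -1. Hence \<open>cw_first\<close> also covers charge
  0.\<close>

lemma cw_vanish: "r < k - 1 \<Longrightarrow> cw H k r = Z [] []" and cw_first: "cw H k (k - 1) = mneg H (I [])"
proof -
  show "cw H k r = Z [] []" if "r < k - 1"
    using that W_zero [of "nat r"] k_nonneg by (auto simp: cw_def idet_def)
  show "cw H k (k - 1) = mneg H (I [])"
    using W_last [of "nat (k - 1)"] k_nonneg by (auto simp: cw_def idet_def)
qed

lemma ccw_vanish: "r < - k - 1 \<Longrightarrow> ccw H k r = Z [] []" and ccw_first: "ccw H k (- k - 1) = I []"
  using k_nonneg B_0 by (auto simp: ccw_def idet_def B_def)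

lemma typing_bubbles [simp]: "D (cw H k r) = []" "R (cw H k r) = []" "D (ccw H k r) = []" "R (ccw H k r) = []"
proof -
  have "D (cw H k r) = [] \<and> R (cw H k r) = []"
    by (cases "0 \<le> r"; cases "r = k - 1") (use cw_vanish [of r] cw_first k_nonneg in \<open>auto simp: cw_def\<close>)
  moreover have "D (ccw H k r) = [] \<and> R (ccw H k r) = []"
  proof (cases "r < - k - 1")
    case False
    then have "ccw H k r = B (nat (r + k + 1))" by (simp add: B_def)
    then show ?thesis by simp
  qed (simp add: ccw_vanish)
  ultimately show "D (cw H k r) = []" "R (cw H k r) = []" "D (ccw H k r) = []" "R (ccw H k r) = []"
    by simp_all
qed

text \<open>The primed curl has its dots on the other side of the crossing; the rotation exchanges the
  two versions.\<close>

definition "rcurl r = (U \<otimes> dx r) \<bullet> (s \<otimes> V) \<bullet> (U \<otimes> c')"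
definition "rcurl' r = (d \<otimes> U) \<bullet> (U \<otimes> (t \<bullet> (xp r \<otimes> V) \<bullet> c'))"

lemma typing_rcurl [simp]: "D (rcurl r) = [Up]" "R (rcurl r) = [Up]" "D (rcurl' r) = [Up]" "R (rcurl' r) = [Up]"
  by (simp_all add: rcurl_def rcurl'_def)

lemma rcurl'_0: "rcurl' 0 = (if K = 0 then U else Z [Up] [Up])"
  by (simp add: rcurl'_def t_c' zigzag_Up)

lemma rcurl_0: "rcurl 0 = (if K = 0 then U else Z [Up] [Up])"
proof -
  have "rcurl 0 = ((U \<otimes> d) \<bullet> (s \<otimes> V)) \<bullet> (U \<otimes> c')" by (simp add: rcurl_def cmp_assoc)
  also have "\<dots> = rcurl' 0" unfolding cap_t [symmetric] by (simp add: rcurl'_def lay)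
  finally show ?thesis by (simp add: rcurl'_0)
qed

lemma hecke'_neg: "(U \<otimes> x) \<bullet> s = s \<bullet> (x \<otimes> U) \<oplus> mneg H (I [Up, Up])"
  using hecke' eq_add_iff [of "s \<bullet> (x \<otimes> U)" "[Up, Up]" "[Up, Up]" "(U \<otimes> x) \<bullet> s" "I [Up, Up]"] by simp

text \<open>The Hecke relation moves one dot from the loop to the strand entering the curl; its
  identity term detaches the loop as a bubble.\<close>

lemma rcurl_Suc: "rcurl (Suc r) = rcurl r \<bullet> x \<oplus> mneg H (U \<otimes> W r)"
proof -
  have "rcurl (Suc r) = (U \<otimes> dx r) \<bullet> (((U \<otimes> x) \<bullet> s) \<otimes> V) \<bullet> (U \<otimes> c')"
    unfolding rcurl_def pow_Suc' by (simp add: lay)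
  also have "\<dots> = (U \<otimes> dx r) \<bullet> (s \<otimes> V) \<bullet> ((x \<otimes> I [Up, Dn]) \<bullet> (U \<otimes> c')) \<oplus> mneg H ((U \<otimes> dx r) \<bullet> (U \<otimes> c'))"
    unfolding hecke'_neg by (simp add: lin lay)
  also have "(x \<otimes> I [Up, Dn]) \<bullet> (U \<otimes> c') = (U \<otimes> c') \<bullet> x"
    using swap [of x _ _ c'] by simp
  also have "(U \<otimes> dx r) \<bullet> (U \<otimes> c') = U \<otimes> W r"
    by (simp flip: whisker(1) W_eq)
  finally show ?thesis by (simp add: rcurl_def cmp_assoc)
qed

lemma rcurl'_Suc: "rcurl' (Suc r) = x \<bullet> rcurl' r \<oplus> mneg H (U \<otimes> W r)"
proof -
  let ?h = "(xp r \<otimes> V) \<bullet> c'"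
  have "rcurl' (Suc r) = (d \<otimes> U) \<bullet> (U \<otimes> ((t \<bullet> (x \<otimes> V)) \<bullet> ?h))"
    by (simp add: rcurl'_def lay)
  also have "\<dots> = ((d \<otimes> U) \<bullet> (I [Up, Dn] \<otimes> x)) \<bullet> (U \<otimes> (t \<bullet> ?h)) \<oplus> mneg H (((d \<otimes> U) \<bullet> (U \<otimes> c)) \<bullet> (U \<otimes> (dx r \<bullet> c')))"
    unfolding t_dot_neg by (simp add: lin lay)
  also have "(d \<otimes> U) \<bullet> (I [Up, Dn] \<otimes> x) = x \<bullet> (d \<otimes> U)"
    using swap [of d _ _ x] by simp
  finally show ?thesis unfolding W_eq by (simp add: rcurl'_def zigzag_Up cmp_assoc)
qed

text \<open>The term \<open>m = r\<close> carries the bubble of index -1. It counts only at charge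
  0, where that bubble is minus the identity.\<close>

definition "rcurl_sum r = msum H [Up] [Up] (\<lambda>m. xp m \<otimes> cw H k (int r - int m - 1)) (Suc r)"

lemma typing_rcurl_sum [simp]: "D (rcurl_sum r) = [Up]" "R (rcurl_sum r) = [Up]"
  by (simp_all add: rcurl_sum_def del: msum.simps)

text \<open>The summand is a parameter so that multiplication by \<open>x\<close> on the left and on
  the right both fit. The two recursions for curls therefore have the same solution.\<close>

lemma rcurl_sum_Suc:
  assumes "\<And>m. D (g m) = [Up]" "\<And>m. R (g m) = [Up]"
    and "\<And>m. g m = xp (Suc m) \<otimes> cw H k (int r - int m - 1)"
  shows "rcurl_sum (Suc r) = msum H [Up] [Up] g (Suc r) \<oplus> (U \<otimes> W r)"
proof -
  have "rcurl_sum (Suc r) = (U \<otimes> W r) \<oplus> msum H [Up] [Up] (\<lambda>m. xp (Suc m) \<otimes> cw H k (int r - int m - 1)) (Suc r)"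
    unfolding rcurl_sum_def
    by (subst msum_Suc_shift) (simp_all add: cw_nat algebra_simps del: msum.simps mpow.simps(2))
  moreover have "g = (\<lambda>m. xp (Suc m) \<otimes> cw H k (int r - int m - 1))"
    using assms(3) by blast
  ultimately show ?thesis by (simp add: add_commute del: msum.simps mpow.simps(2))
qed

lemma rcurl_sum_0: "rcurl_sum 0 = (if K = 0 then mneg H U else Z [Up] [Up])"
  using cw_vanish [of "-1"] cw_first k_nonneg by (auto simp: rcurl_sum_def)

lemma rcurl_eq: "rcurl r = mneg H (rcurl_sum r)"
proof (induction r)
  case (Suc r)
  have "rcurl_sum r \<bullet> x = msum H [Up] [Up] (\<lambda>m. (xp m \<otimes> cw H k (int r - int m - 1)) \<bullet> x) (Suc r)"
    unfolding rcurl_sum_def by (rule msum_cmp_right) simp_all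
  moreover have "(xp m \<otimes> cw H k (int r - int m - 1)) \<bullet> x = xp (Suc m) \<otimes> cw H k (int r - int m - 1)" for m
    using interchange [of "xp m" x "cw H k (int r - int m - 1)" "I []"] unfolding pow_Suc' by simp
  ultimately have "rcurl_sum (Suc r) = rcurl_sum r \<bullet> x \<oplus> (U \<otimes> W r)"
    using rcurl_sum_Suc [of "\<lambda>m. (xp m \<otimes> cw H k (int r - int m - 1)) \<bullet> x" r] by simp
  then show ?case using Suc by (simp add: rcurl_Suc lin)
qed (simp add: rcurl_0 rcurl_sum_0)

lemma rcurl'_eq: "rcurl' r = mneg H (rcurl_sum r)"
proof (induction r)
  case (Suc r)
  have "x \<bullet> rcurl_sum r = msum H [Up] [Up] (\<lambda>m. x \<bullet> (xp m \<otimes> cw H k (int r - int m - 1))) (Suc r)"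
    unfolding rcurl_sum_def by (rule msum_cmp_left) simp_all
  moreover have "x \<bullet> (xp m \<otimes> cw H k (int r - int m - 1)) = xp (Suc m) \<otimes> cw H k (int r - int m - 1)" for m
    using interchange [of x "xp m" "I []" "cw H k (int r - int m - 1)"] by simp
  ultimately have "rcurl_sum (Suc r) = x \<bullet> rcurl_sum r \<oplus> (U \<otimes> W r)"
    using rcurl_sum_Suc [of "\<lambda>m. x \<bullet> (xp m \<otimes> cw H k (int r - int m - 1))" r] by simp
  then show ?case using Suc by (simp add: rcurl'_Suc lin)
qed (simp add: rcurl'_0 rcurl_sum_0)

lemma rcurl_sum_small: "r < K \<Longrightarrow> rcurl_sum r = Z [Up] [Up]"
  unfolding rcurl_sum_def by (rule msum_zero) (simp add: cw_vanish)

lemma rcurl_sum_K: "rcurl_sum K = mneg H U"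
proof -
  have "rcurl_sum K = msum H [Up] [Up] (\<lambda>m. xp m \<otimes> cw H k (int K - int m - 1)) (Suc 0)"
    unfolding rcurl_sum_def by (rule msum_extend) (use k_nonneg in \<open>simp_all add: cw_vanish\<close>)
  then show ?thesis using k_nonneg cw_first by simp
qed

text \<open>Two nested tests. On the right-hand pair the dotted caps give curls with fewer than
  \<open>K\<close> dots, which vanish, and \<open>t\<close> leaves an expression for
  \<open>c' \<otimes> U\<close>. That expression is tested again on the left-hand pair, where
  \<open>braid_t\<close> handles \<open>t\<close> and \<open>dx_cross\<close> the caps.\<close>

lemma pitchfork: "(U \<otimes> \<tau>) \<bullet> (c' \<otimes> U) = (s \<otimes> V) \<bullet> (U \<otimes> c')"
proof (rule joint_monic [where a = "[Up]" and b = "[]"])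
  fix r assume r: "r < K"
  have "(U \<otimes> dx r) \<bullet> (U \<otimes> \<tau>) \<bullet> (c' \<otimes> U) = (U \<otimes> (dx r \<bullet> \<tau>)) \<bullet> (c' \<otimes> U)"
    by (simp add: lay)
  moreover have "(U \<otimes> dx r) \<bullet> (s \<otimes> V) \<bullet> (U \<otimes> c') = Z [Up] [Up]"
    using rcurl_eq [of r] r by (simp add: rcurl_def rcurl_sum_small)
  ultimately show "(I [Up] \<otimes> dx r \<otimes> I []) \<bullet> (U \<otimes> \<tau>) \<bullet> (c' \<otimes> U) = (I [Up] \<otimes> dx r \<otimes> I []) \<bullet> (s \<otimes> V) \<bullet> (U \<otimes> c')"
    using r by (simp add: dx_tau)
next
  have "(U \<otimes> t) \<bullet> (U \<otimes> \<tau>) \<bullet> (c' \<otimes> U) = (U \<otimes> (t \<bullet> \<tau>)) \<bullet> (c' \<otimes> U)"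
    by (simp add: lay)
  also have "\<dots> = c' \<otimes> U" by (simp add: t_tau)
  also have "\<dots> = (U \<otimes> t) \<bullet> (s \<otimes> V) \<bullet> (U \<otimes> c')"
  proof (rule joint_monic [where a = "[]" and b = "[Up]"])
    have "(t \<otimes> U) \<bullet> (U \<otimes> t) \<bullet> (s \<otimes> V) \<bullet> (U \<otimes> c') = ((t \<otimes> U) \<bullet> (U \<otimes> t) \<bullet> (s \<otimes> V)) \<bullet> (U \<otimes> c')"
      by (simp add: cmp_assoc)
    also have "\<dots> = (V \<otimes> s) \<bullet> (t \<otimes> U) \<bullet> (U \<otimes> (t \<bullet> c'))"
      unfolding braid_t by (simp add: lay)
    also have "\<dots> = (t \<bullet> c') \<otimes> U"
    proof (cases "K = 0")
      case True
      then have tc: "t \<bullet> c' = c" by (simp add: t_c')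
      have "(V \<otimes> s) \<bullet> (t \<otimes> U) \<bullet> (U \<otimes> c) = (V \<otimes> (s \<bullet> s)) \<bullet> (c \<otimes> U)"
        by (simp add: t_cup lay)
      then show ?thesis unfolding tc by (simp add: ss)
    qed (simp add: t_c')
    finally show "(I [] \<otimes> t \<otimes> I [Up]) \<bullet> (c' \<otimes> U) = (I [] \<otimes> t \<otimes> I [Up]) \<bullet> (U \<otimes> t) \<bullet> (s \<otimes> V) \<bullet> (U \<otimes> c')"
      by (simp add: lay)
  next
    fix r assume r: "r < K"
    \<comment> \<open>These are the corrections of \<open>dx_cross\<close>; each contains
      \<open>t\<close> on a cup with \<open>i < K\<close> dots.\<close>
    have *: "(d \<otimes> U) \<bullet> (xp (r - Suc i) \<otimes> (t \<bullet> (xp i \<otimes> V))) \<bullet> (U \<otimes> c') = Z [Up] [Up]" if "i < r" for i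
    proof -
      have "(xp (r - Suc i) \<otimes> (t \<bullet> (xp i \<otimes> V))) \<bullet> (U \<otimes> c') = xp (r - Suc i) \<otimes> (t \<bullet> (xp i \<otimes> V) \<bullet> c')"
        by (simp add: cmp_assoc flip: interchange)
      then show ?thesis using that r by (simp add: t_pow_c')
    qed
    have "(dx r \<otimes> U) \<bullet> (U \<otimes> t) \<bullet> (s \<otimes> V) \<bullet> (U \<otimes> c') = ((dx r \<otimes> U) \<bullet> (U \<otimes> t) \<bullet> (s \<otimes> V)) \<bullet> (U \<otimes> c')"
      by (simp add: cmp_assoc)
    also have "\<dots> = (U \<otimes> dx r) \<bullet> (U \<otimes> c') \<oplus>
      msum H [Up, Up, Dn] [Up] (\<lambda>i. (d \<otimes> U) \<bullet> (xp (r - Suc i) \<otimes> (t \<bullet> (xp i \<otimes> V)))) r \<bullet> (U \<otimes> c')"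
      unfolding dx_cross by (rule cmp_add) simp_all
    also have "msum H [Up, Up, Dn] [Up] (\<lambda>i. (d \<otimes> U) \<bullet> (xp (r - Suc i) \<otimes> (t \<bullet> (xp i \<otimes> V)))) r \<bullet> (U \<otimes> c')
      = msum H [Up] [Up] (\<lambda>i. ((d \<otimes> U) \<bullet> (xp (r - Suc i) \<otimes> (t \<bullet> (xp i \<otimes> V)))) \<bullet> (U \<otimes> c')) r"
      by (rule msum_cmp_right) simp_all
    also have "\<dots> = Z [Up] [Up]"
      by (rule msum_zero) (simp add: cmp_assoc *)
    also have "(U \<otimes> dx r) \<bullet> (U \<otimes> c') = U \<otimes> W r"
      by (simp flip: whisker(1) W_eq)
    \<comment> \<open>For \<open>r < K\<close> the bubble is zero or minus the identity, so it
      passes the strand without a slide relation.\<close>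
    also have "\<dots> = W r \<otimes> U"
      using r by (cases "Suc r = K") (simp_all add: W_zero W_last)
    also have "\<dots> = (dx r \<otimes> U) \<bullet> (c' \<otimes> U)"
      by (simp flip: whisker(2) W_eq)
    finally show "(I [] \<otimes> dx r \<otimes> I [Up]) \<bullet> (c' \<otimes> U) = (I [] \<otimes> dx r \<otimes> I [Up]) \<bullet> (U \<otimes> t) \<bullet> (s \<otimes> V) \<bullet> (U \<otimes> c')"
      by simp
  qed simp_all
  finally show "(I [Up] \<otimes> t \<otimes> I []) \<bullet> (U \<otimes> \<tau>) \<bullet> (c' \<otimes> U) = (I [Up] \<otimes> t \<otimes> I []) \<bullet> (s \<otimes> V) \<bullet> (U \<otimes> c')"
    by simp
qed simp_all

text \<open>Since \<open>d'\<close> is the cap with \<open>K\<close> dots on \<open>\<tau>\<close>,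
  the pitchfork turns this zigzag into the curl with \<open>K\<close> dots, the first curl that does
  not vanish.\<close>

lemma left_zigzag_Up: "(U \<otimes> d') \<bullet> (c' \<otimes> U) = U"
proof -
  have "(U \<otimes> d') \<bullet> (c' \<otimes> U) = (U \<otimes> dx K) \<bullet> ((U \<otimes> \<tau>) \<bullet> (c' \<otimes> U))"
    by (simp add: d'_eq lay)
  also have "\<dots> = rcurl K" unfolding pitchfork rcurl_def ..
  finally show ?thesis by (simp add: rcurl_eq rcurl_sum_K)
qed

section \<open>Counterclockwise curls and the second zigzag\<close>

definition "lcurl r = (d' \<otimes> U) \<bullet> (V \<otimes> xp r \<otimes> U) \<bullet> (V \<otimes> s) \<bullet> (c \<otimes> U)"

lemma typing_lcurl [simp]: "D (lcurl r) = [Up]" "R (lcurl r) = [Up]"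
  by (simp_all add: lcurl_def)

text \<open>Measures how far \<open>\<tau>\<close> is from a left inverse of \<open>t\<close>. The
  bubbles hidden in \<open>cup_sum\<close> become the coefficients of the undotted counterclockwise
  curl and of the alternating braid relation.\<close>

lemma tau_t:
  "\<tau> \<bullet> t = I [Up, Dn] \<oplus> msum H [Up, Dn] [Up, Dn] (\<lambda>r. cup_sum (K - Suc r) \<bullet> dx r) K"
proof -
  have "\<tau> \<bullet> t = I [Up, Dn] \<oplus> mneg H (msum H [Up, Dn] [Up, Dn] (\<lambda>r. e r \<bullet> dx r) K)"
    using inverse_sum eq_add_iff [of "I [Up, Dn]" "[Up, Dn]" "[Up, Dn]" "\<tau> \<bullet> t" "msum H [Up, Dn] [Up, Dn] (\<lambda>r. e r \<bullet> dx r) K"]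
    by simp
  also have "mneg H (msum H [Up, Dn] [Up, Dn] (\<lambda>r. e r \<bullet> dx r) K) = msum H [Up, Dn] [Up, Dn] (\<lambda>r. mneg H (e r \<bullet> dx r)) K"
    by (rule msum_mneg) simp_all
  also have "\<dots> = msum H [Up, Dn] [Up, Dn] (\<lambda>r. cup_sum (K - Suc r) \<bullet> dx r) K"
  proof (rule msum_cong)
    fix r assume "r < K"
    then show "mneg H (e r \<bullet> dx r) = cup_sum (K - Suc r) \<bullet> dx r"
      using e_eq_cup_sum [of "K - Suc r"] by simp
  qed
  finally show ?thesis .
qed

text \<open>By \<open>t_cup\<close> the crossing on a cup is \<open>t\<close> on a cup, and
  \<open>d'\<close> contributes \<open>\<tau>\<close>, so \<open>tau_t\<close> applies. Its identity
  term gives the summand \<open>r = K\<close>, where \<open>B 0\<close> is the identity.\<close>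

lemma lcurl_0: "lcurl 0 = msum H [Up] [Up] (\<lambda>r. B (K - r) \<otimes> xp r) (Suc K)"
proof -
  have "lcurl 0 = (d' \<otimes> U) \<bullet> ((V \<otimes> s) \<bullet> (c \<otimes> U))" by (simp add: lcurl_def)
  also have "\<dots> = ((dx K \<bullet> (\<tau> \<bullet> t)) \<otimes> U) \<bullet> (U \<otimes> c)"
    unfolding t_cup [symmetric] by (simp add: d'_eq lay)
  also have "\<dots> = (dx K \<otimes> U) \<bullet> (U \<otimes> c) \<oplus>
      ((dx K \<bullet> msum H [Up, Dn] [Up, Dn] (\<lambda>r. cup_sum (K - Suc r) \<bullet> dx r) K) \<otimes> U) \<bullet> (U \<otimes> c)"
    unfolding tau_t by (simp add: lin)
  also have "((dx K \<bullet> msum H [Up, Dn] [Up, Dn] (\<lambda>r. cup_sum (K - Suc r) \<bullet> dx r) K) \<otimes> U) \<bullet> (U \<otimes> c)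
    = msum H [Up] [Up] (\<lambda>r. ((dx K \<bullet> cup_sum (K - Suc r) \<bullet> dx r) \<otimes> U) \<bullet> (U \<otimes> c)) K"
    by (rule msum_additive) (simp_all add: lin)
  also have "\<dots> = msum H [Up] [Up] (\<lambda>r. B (K - r) \<otimes> xp r) K"
  proof (rule msum_cong)
    fix r assume r: "r < K"
    have "((dx K \<bullet> cup_sum (K - Suc r) \<bullet> dx r) \<otimes> U) \<bullet> (U \<otimes> c)
      = ((dx K \<bullet> cup_sum (K - Suc r)) \<otimes> U) \<bullet> ((dx r \<otimes> U) \<bullet> (U \<otimes> c))"
      by (simp add: lay)
    also have "dx K \<bullet> cup_sum (K - Suc r) = B (K - r)"
      using B_Suc [of "K - Suc r"] r by (simp add: dx_cup_sum Suc_diff_Suc del: msum.simps)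
    finally show "((dx K \<bullet> cup_sum (K - Suc r) \<bullet> dx r) \<otimes> U) \<bullet> (U \<otimes> c) = B (K - r) \<otimes> xp r"
      unfolding dx_cup by (simp add: scalar_tns_cmp)
  qed
  finally show ?thesis unfolding dx_cup by (simp add: B_0 add_commute)
qed

lemma left_zigzag_Dn: "(d' \<otimes> V) \<bullet> (V \<otimes> c') = V"
  and tt'_eq: "tt' H k = \<tau>"
proof -
  \<comment> \<open>The pitchfork gives t' = \<open>\<tau>\<close> (p \<otimes> 1), and t' c = \<open>\<tau>\<close> c by the curl formula, so
    (p \<otimes> 1) c = c, which forces p = 1.\<close>
  define p where "p = (d' \<otimes> V) \<bullet> (V \<otimes> c')"
  have [simp]: "D p = [Dn]" "R p = [Dn]" by (simp_all add: p_def)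
  have t': "tt' H k = \<tau> \<bullet> (p \<otimes> U)"
  proof -
    have "tt' H k = (d' \<otimes> I [Up, Dn]) \<bullet> (V \<otimes> ((s \<otimes> V) \<bullet> (U \<otimes> c')))"
      by (simp add: tt'_def lay)
    also have "\<dots> = ((d' \<otimes> I [Up, Dn]) \<bullet> (I [Dn, Up] \<otimes> \<tau>)) \<bullet> (V \<otimes> c' \<otimes> U)"
      unfolding pitchfork [symmetric] by (simp add: lay)
    also have "(d' \<otimes> I [Up, Dn]) \<bullet> (I [Dn, Up] \<otimes> \<tau>) = \<tau> \<bullet> (d' \<otimes> I [Dn, Up])"
      using swap [of d' _ _ \<tau>] by simp
    finally show ?thesis by (simp add: p_def lay)
  qed
  have "tt' H k \<bullet> c = (d' \<otimes> I [Up, Dn]) \<bullet> (V \<otimes> s \<otimes> V) \<bullet> ((I [Dn, Up] \<otimes> c') \<bullet> c)"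
    by (simp add: tt'_def cmp_assoc)
  also have "(I [Dn, Up] \<otimes> c') \<bullet> c = (c \<otimes> I [Up, Dn]) \<bullet> c'"
    using swap [of c _ _ c'] by simp
  also have "(d' \<otimes> I [Up, Dn]) \<bullet> (V \<otimes> s \<otimes> V) \<bullet> (c \<otimes> I [Up, Dn]) \<bullet> c' = (lcurl 0 \<otimes> V) \<bullet> c'"
    by (simp add: lcurl_def lay)
  also have "\<dots> = msum H [] [Up, Dn] (\<lambda>r. ((B (K - r) \<otimes> xp r) \<otimes> V) \<bullet> c') (Suc K)"
    unfolding lcurl_0 by (rule msum_additive [where \<phi> = "\<lambda>z. (z \<otimes> V) \<bullet> c'"]) (simp_all add: lin)
  also have "\<dots> = cup_sum K"
    unfolding cup_sum_def
  proof (rule msum_cong)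
    fix r
    show "((B (K - r) \<otimes> xp r) \<otimes> V) \<bullet> c' = (xp r \<otimes> V) \<bullet> c' \<bullet> B (K - r)"
      using scalar_tns_cmp(1) [of "B (K - r)" "xp r \<otimes> V" c'] scalar_tns_state [of "B (K - r)" "(xp r \<otimes> V) \<bullet> c'"]
      by (simp add: cmp_assoc)
  qed
  finally have "\<tau> \<bullet> (p \<otimes> U) \<bullet> c = \<tau> \<bullet> c" by (simp add: t' tau_c cmp_assoc)
  from arg_cong [OF this, of "\<lambda>z. t \<bullet> z"] have pc: "(p \<otimes> U) \<bullet> c = c"
    by (simp add: t_tau flip: cmp_assoc)
  have "p = p \<bullet> ((V \<otimes> d) \<bullet> (c \<otimes> V))"
    by (simp add: zigzag_Dn)
  also have "\<dots> = (p \<bullet> (V \<otimes> d)) \<bullet> (c \<otimes> V)"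
    by (simp add: cmp_assoc)
  also have "p \<bullet> (V \<otimes> d) = (V \<otimes> d) \<bullet> (p \<otimes> I [Up, Dn])"
    using swap [of p _ _ d] by simp
  also have "\<dots> \<bullet> (c \<otimes> V) = (V \<otimes> d) \<bullet> (((p \<otimes> U) \<bullet> c) \<otimes> V)"
    by (simp add: lay)
  finally have "p = V" unfolding pc by (simp add: zigzag_Dn)
  then show "(d' \<otimes> V) \<bullet> (V \<otimes> c') = V" "tt' H k = \<tau>" by (simp_all add: t' flip: p_def)
qed

section \<open>Equality of right and left mates\<close>

lemma c'_dot: "(x \<otimes> V) \<bullet> c' = (U \<otimes> xD) \<bullet> c'"
proof (rule joint_monic [where a = "[]" and b = "[]"])
  have neg: "t \<bullet> (U \<otimes> xD) = (xD \<otimes> U) \<bullet> t \<oplus> mneg H (c \<bullet> d)"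
    using t_dot' eq_add_iff [of "(xD \<otimes> U) \<bullet> t" "[Up, Dn]" "[Dn, Up]" "t \<bullet> (U \<otimes> xD)" "c \<bullet> d"] by simp
  have "t \<bullet> (x \<otimes> V) \<bullet> c' = (V \<otimes> x) \<bullet> (t \<bullet> c') \<oplus> mneg H (c \<bullet> d \<bullet> c')"
    using arg_cong [OF t_dot_neg, of "\<lambda>z. z \<bullet> c'"] by (simp add: lin cmp_assoc)
  \<comment> \<open>Depending on \<open>K\<close> the morphism \<open>t \<bullet> c'\<close> is
    \<open>c\<close> or zero; in either case the dot may change strands by
    \<open>cup_dot\<close>.\<close>
  also have "(V \<otimes> x) \<bullet> (t \<bullet> c') = (xD \<otimes> U) \<bullet> (t \<bullet> c')"
    by (simp add: t_c' cup_dot)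
  also have "\<dots> \<oplus> mneg H (c \<bullet> d \<bullet> c') = t \<bullet> (U \<otimes> xD) \<bullet> c'"
    using arg_cong [OF neg, of "\<lambda>z. z \<bullet> c'"] by (simp add: lin cmp_assoc)
  finally show "(I [] \<otimes> t \<otimes> I []) \<bullet> (x \<otimes> V) \<bullet> c' = (I [] \<otimes> t \<otimes> I []) \<bullet> (U \<otimes> xD) \<bullet> c'"
    by simp
next
  fix r
  have "dx r \<bullet> (U \<otimes> xD) = d \<bullet> ((xp r \<otimes> V) \<bullet> (U \<otimes> xD))" by (simp add: cmp_assoc)
  also have "(xp r \<otimes> V) \<bullet> (U \<otimes> xD) = (U \<otimes> xD) \<bullet> (xp r \<otimes> V)"
    by (rule swap) simp_all
  also have "d \<bullet> \<dots> = (d \<bullet> (U \<otimes> xD)) \<bullet> (xp r \<otimes> V)" by (simp add: cmp_assoc)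
  also have "\<dots> = dx (Suc r)" unfolding cap_dot by (simp add: lay)
  finally have "dx r \<bullet> (U \<otimes> xD) \<bullet> c' = dx (Suc r) \<bullet> c'" by (simp flip: cmp_assoc)
  moreover have "dx r \<bullet> (x \<otimes> V) \<bullet> c' = dx (Suc r) \<bullet> c'"
    unfolding dx_dot [symmetric] by (simp add: cmp_assoc)
  ultimately show "(I [] \<otimes> dx r \<otimes> I []) \<bullet> (x \<otimes> V) \<bullet> c' = (I [] \<otimes> dx r \<otimes> I []) \<bullet> (U \<otimes> xD) \<bullet> c'"
    by simp
qed simp_all

lemma mates_x:
  "(V \<otimes> d) \<bullet> (V \<otimes> x \<otimes> V) \<bullet> (c \<otimes> V) = (d' \<otimes> V) \<bullet> (V \<otimes> x \<otimes> V) \<bullet> (V \<otimes> c')"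
proof -
  have "(d' \<otimes> V) \<bullet> (V \<otimes> x \<otimes> V) \<bullet> (V \<otimes> c') = (d' \<otimes> V) \<bullet> (V \<otimes> ((x \<otimes> V) \<bullet> c'))"
    by (simp add: lay)
  also have "\<dots> = ((d' \<otimes> V) \<bullet> (I [Dn, Up] \<otimes> xD)) \<bullet> (V \<otimes> c')"
    unfolding c'_dot by (simp add: lay)
  also have "(d' \<otimes> V) \<bullet> (I [Dn, Up] \<otimes> xD) = xD \<bullet> (d' \<otimes> V)"
    using swap [of d' _ _ xD] by simp
  also have "\<dots> \<bullet> (V \<otimes> c') = xD" by (simp add: cmp_assoc left_zigzag_Dn)
  finally show ?thesis by (simp add: xD_def rho_def)
qed

text \<open>The component under \<open>t\<close> is the image under \<open>rho\<close> of the first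
  pitchfork with \<open>t\<close> applied to it. The dotted caps see nothing: \<open>cap_sD\<close>
  exposes \<open>t\<close> on a cup with fewer than \<open>K\<close> dots.\<close>

lemma pitchfork_Dn: "(\<tau> \<otimes> V) \<bullet> (V \<otimes> c') = (U \<otimes> sD) \<bullet> (c' \<otimes> V)"
proof (rule joint_monic [where a = "[]" and b = "[Dn]"])
  let ?f = "(U \<otimes> t) \<bullet> (s \<otimes> V)"
  have f: "rho [Up, Dn] [Up, Dn] ?f = (t \<otimes> V) \<bullet> (U \<otimes> sD)"
    using rho_star [of s "[Up]" "[Up]" t "[Dn]" "[Dn]"] by (simp add: rho_cross flip: sD_def)
  have "?f \<bullet> (U \<otimes> c') = (U \<otimes> t) \<bullet> ((s \<otimes> V) \<bullet> (U \<otimes> c'))" by (simp add: cmp_assoc)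
  also have "\<dots> = (U \<otimes> (t \<bullet> \<tau>)) \<bullet> (c' \<otimes> U)" unfolding pitchfork [symmetric] by (simp add: lay)
  finally have "?f \<bullet> (U \<otimes> c') = (c' \<otimes> U) \<bullet> U" by (simp add: t_tau)
  then have "((t \<otimes> V) \<bullet> (U \<otimes> sD)) \<bullet> (c' \<otimes> V) = V \<otimes> c'"
    using rho_pre [of ?f "[Up, Dn]" "[Up, Dn]" c'] rho_post [of U "[]" "[]" c'] by (simp add: f rho_Up)
  moreover have "(t \<otimes> V) \<bullet> (\<tau> \<otimes> V) \<bullet> (V \<otimes> c') = ((t \<bullet> \<tau>) \<otimes> V) \<bullet> (V \<otimes> c')"
    by (simp add: lay)
  ultimately show "(I [] \<otimes> t \<otimes> I [Dn]) \<bullet> (\<tau> \<otimes> V) \<bullet> (V \<otimes> c') = (I [] \<otimes> t \<otimes> I [Dn]) \<bullet> (U \<otimes> sD) \<bullet> (c' \<otimes> V)"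
    by (simp add: t_tau cmp_assoc)
next
  fix r assume r: "r < K"
  have "(dx r \<otimes> V) \<bullet> (U \<otimes> sD) \<bullet> (c' \<otimes> V) = (d \<otimes> V) \<bullet> ((xp r \<otimes> I [Dn, Dn]) \<bullet> (U \<otimes> sD)) \<bullet> (c' \<otimes> V)"
    by (simp add: lay)
  also have "(xp r \<otimes> I [Dn, Dn]) \<bullet> (U \<otimes> sD) = (U \<otimes> sD) \<bullet> (xp r \<otimes> I [Dn, Dn])"
    by (rule swap) simp_all
  also have "(d \<otimes> V) \<bullet> ((U \<otimes> sD) \<bullet> (xp r \<otimes> I [Dn, Dn])) \<bullet> (c' \<otimes> V)
    = ((d \<otimes> V) \<bullet> (U \<otimes> sD)) \<bullet> (xp r \<otimes> I [Dn, Dn]) \<bullet> (c' \<otimes> V)"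
    by (simp add: cmp_assoc)
  also have "\<dots> = (V \<otimes> d) \<bullet> ((t \<bullet> (xp r \<otimes> V) \<bullet> c') \<otimes> V)"
    unfolding cap_sD by (simp add: lay)
  finally have "(dx r \<otimes> V) \<bullet> (U \<otimes> sD) \<bullet> (c' \<otimes> V) = Z [Dn] [Dn]"
    using r by (simp add: t_pow_c')
  moreover have "(dx r \<otimes> V) \<bullet> (\<tau> \<otimes> V) \<bullet> (V \<otimes> c') = ((dx r \<bullet> \<tau>) \<otimes> V) \<bullet> (V \<otimes> c')"
    by (simp add: lay)
  ultimately show "(I [] \<otimes> dx r \<otimes> I [Dn]) \<bullet> (\<tau> \<otimes> V) \<bullet> (V \<otimes> c') = (I [] \<otimes> dx r \<otimes> I [Dn]) \<bullet> (U \<otimes> sD) \<bullet> (c' \<otimes> V)"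
    using r by (simp add: dx_tau)
qed simp_all

text \<open>The left side unfolds to \<open>sD\<close>. On the right side the two pitchforks carry
  the crossing over the nested cups \<open>c'\<close>, where it becomes \<open>sD\<close>; it then
  slides above the nested caps and two zigzags straighten the strands.\<close>

lemma mates_s:
  "(I [Dn, Dn] \<otimes> (d \<bullet> (U \<otimes> d \<otimes> V))) \<bullet> (I [Dn, Dn] \<otimes> s \<otimes> I [Dn, Dn]) \<bullet> (((V \<otimes> c \<otimes> U) \<bullet> c) \<otimes> I [Dn, Dn])
  = ((d' \<bullet> (V \<otimes> d' \<otimes> U)) \<otimes> I [Dn, Dn]) \<bullet> (I [Dn, Dn] \<otimes> s \<otimes> I [Dn, Dn]) \<bullet> (I [Dn, Dn] \<otimes> ((U \<otimes> c' \<otimes> V) \<bullet> c'))"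
  (is "?L = ?R")
proof -
  let ?C = "(U \<otimes> c' \<otimes> V) \<bullet> c'"
  let ?D = "d' \<bullet> (V \<otimes> d' \<otimes> U)"
  have "?L = sD"
    unfolding sD_def rho_def [of "[Dn]"] tt_def by (simp add: lay)
  have "(s \<otimes> I [Dn, Dn]) \<bullet> ?C = (((s \<otimes> V) \<bullet> (U \<otimes> c')) \<otimes> V) \<bullet> c'"
    by (simp add: lay)
  also have "\<dots> = (U \<otimes> \<tau> \<otimes> V) \<bullet> ((c' \<otimes> I [Up, Dn]) \<bullet> c')"
    unfolding pitchfork [symmetric] by (simp add: lay)
  also have "(c' \<otimes> I [Up, Dn]) \<bullet> c' = (I [Up, Dn] \<otimes> c') \<bullet> c'"
    using swap [of c' _ _ c'] by simp
  also have "(U \<otimes> \<tau> \<otimes> V) \<bullet> (I [Up, Dn] \<otimes> c') \<bullet> c' = (U \<otimes> ((\<tau> \<otimes> V) \<bullet> (V \<otimes> c'))) \<bullet> c'"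
    by (simp add: lay)
  also have "\<dots> = (I [Up, Up] \<otimes> sD) \<bullet> ?C"
    unfolding pitchfork_Dn by (simp add: lay)
  finally have sC: "(s \<otimes> I [Dn, Dn]) \<bullet> ?C = (I [Up, Up] \<otimes> sD) \<bullet> ?C" .
  have "?R = (?D \<otimes> I [Dn, Dn]) \<bullet> (I [Dn, Dn] \<otimes> ((s \<otimes> I [Dn, Dn]) \<bullet> ?C))"
    by (simp add: lay)
  also have "\<dots> = ((?D \<otimes> I [Dn, Dn]) \<bullet> (I [Dn, Dn, Up, Up] \<otimes> sD)) \<bullet> (I [Dn, Dn] \<otimes> ?C)"
    unfolding sC by (simp add: lay)
  also have "(?D \<otimes> I [Dn, Dn]) \<bullet> (I [Dn, Dn, Up, Up] \<otimes> sD) = sD \<bullet> (?D \<otimes> I [Dn, Dn])"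
    using swap [of ?D _ _ sD] by simp
  also have "\<dots> \<bullet> (I [Dn, Dn] \<otimes> ?C) = sD \<bullet> (d' \<otimes> I [Dn, Dn]) \<bullet>
      (V \<otimes> ((d' \<otimes> I [Up, Dn]) \<bullet> (I [Dn, Up] \<otimes> c')) \<otimes> V) \<bullet> (I [Dn, Dn] \<otimes> c')"
    by (simp add: lay)
  also have "(d' \<otimes> I [Up, Dn]) \<bullet> (I [Dn, Up] \<otimes> c') = c' \<bullet> d'"
    using swap [of d' _ _ c'] by simp
  also have "sD \<bullet> (d' \<otimes> I [Dn, Dn]) \<bullet> (V \<otimes> (c' \<bullet> d') \<otimes> V) \<bullet> (I [Dn, Dn] \<otimes> c')
    = sD \<bullet> (((d' \<otimes> V) \<bullet> (V \<otimes> c')) \<otimes> V) \<bullet> (V \<otimes> ((d' \<otimes> V) \<bullet> (V \<otimes> c')))"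
    by (simp add: lay)
  finally show ?thesis using \<open>?L = sD\<close> by (simp add: left_zigzag_Dn)
qed

section \<open>Curls and bubble slides\<close>

lemma cw_low: "r < k \<Longrightarrow> cw H k r = (if r = k - 1 then mneg H (I []) else Z [] [])"
  by (auto simp: cw_first cw_vanish)

lemma ccw_low: "r < - k \<Longrightarrow> ccw H k r = (if r = - k - 1 then I [] else Z [] [])"
  by (auto simp: ccw_first ccw_vanish)

section \<open>Infinite Grassmannian relation\<close>

definition "A n = cw H k (int n + k - 1)"

lemma typing_A [simp]: "D (A n) = []" "R (A n) = []"
  by (simp_all add: A_def)

lemma A_0: "A 0 = mneg H (I [])" and A_Suc: "A (Suc n) = W (K + n)"
  using cw_first cw_nat [of "K + n"] k_nonneg by (simp_all add: A_def algebra_simps)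

text \<open>This is \<open>B_Suc\<close> with \<open>B n\<close> moved to the side of the sum, where
  it is the term of \<open>A 0\<close>.\<close>

lemma grassmannian_nat:
  "msum H [] [] (\<lambda>i. A i \<bullet> B (n - i)) (Suc n) = (if n = 0 then mneg H (I []) else Z [] [])"
proof (cases n)
  case 0
  then show ?thesis by (simp add: A_0 B_0)
next
  case (Suc m)
  have "msum H [] [] (\<lambda>i. A i \<bullet> B (n - i)) (Suc n) = mneg H (B n) \<oplus> msum H [] [] (\<lambda>i. W (K + i) \<bullet> B (m - i)) n"
    by (subst msum_Suc_shift) (simp_all add: A_0 A_Suc Suc del: msum.simps)
  also have "\<dots> = Z [] []"
    using B_Suc [of m] by (simp add: Suc del: msum.simps)
  finally show ?thesis using Suc by simp
qed

lemma grassmannian: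
  "msum H [] [] (\<lambda>r. cw H k (int r + k - 1) \<bullet> ccw H k (m - int r - k - 1)) (nat (m + 1))
    = (if m = 0 then mneg H (I []) else Z [] [])"
proof (cases "0 \<le> m")
  case True
  define n where "n = nat m"
  have m: "m = int n" using True by (simp add: n_def)
  have N: "nat (m + 1) = Suc n" by (simp add: m)
  have "msum H [] [] (\<lambda>r. cw H k (int r + k - 1) \<bullet> ccw H k (m - int r - k - 1)) (nat (m + 1))
    = msum H [] [] (\<lambda>i. A i \<bullet> B (n - i)) (Suc n)"
    unfolding N by (rule msum_cong) (auto simp: A_def B_def m of_nat_diff)
  then show ?thesis by (simp only: grassmannian_nat m of_nat_eq_0_iff)
qed simp

text \<open>The lowest nonzero bubble, of index \<open>- k - 1\<close>, occurs at
  \<open>m = K + r\<close>, hence the bound. The step is the Hecke relation, as for the clockwise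
  curl.\<close>

lemma lcurl_eq: "lcurl r = msum H [Up] [Up] (\<lambda>m. ccw H k (int r - int m - 1) \<otimes> xp m) (K + Suc r)"
proof (induction r)
  case 0
  have "lcurl 0 = msum H [Up] [Up] (\<lambda>m. ccw H k (int 0 - int m - 1) \<otimes> xp m) (Suc K)"
    unfolding lcurl_0 by (rule msum_cong) (use k_nonneg in \<open>simp add: B_def of_nat_diff\<close>)
  then show ?case by (simp del: msum.simps)
next
  case (Suc r)
  have "lcurl (Suc r) = (d' \<otimes> U) \<bullet> (V \<otimes> xp r \<otimes> U) \<bullet> (V \<otimes> ((x \<otimes> U) \<bullet> s)) \<bullet> (c \<otimes> U)"
    unfolding lcurl_def pow_Suc' by (simp add: lay)
  also have "\<dots> = (d' \<otimes> U) \<bullet> (V \<otimes> xp r \<otimes> U) \<bullet> (V \<otimes> s) \<bullet> ((I [Dn, Up] \<otimes> x) \<bullet> (c \<otimes> U))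
     \<oplus> (d' \<otimes> U) \<bullet> (V \<otimes> xp r \<otimes> U) \<bullet> (c \<otimes> U)"
    unfolding hecke by (simp add: lin lay)
  also have "(I [Dn, Up] \<otimes> x) \<bullet> (c \<otimes> U) = (c \<otimes> U) \<bullet> x"
    using swap [of c _ _ x] by simp
  also have "(d' \<otimes> U) \<bullet> (V \<otimes> xp r \<otimes> U) \<bullet> (c \<otimes> U) = W' r \<otimes> U"
    by (simp add: ccw0_def lay)
  finally have "lcurl (Suc r) = lcurl r \<bullet> x \<oplus> (W' r \<otimes> U)"
    by (simp add: lcurl_def cmp_assoc)
  also have "lcurl r \<bullet> x = msum H [Up] [Up] (\<lambda>m. (ccw H k (int r - int m - 1) \<otimes> xp m) \<bullet> x) (K + Suc r)"
    unfolding Suc by (rule msum_cmp_right) simp_all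
  also have "\<dots> = msum H [Up] [Up] (\<lambda>m. ccw H k (int r - int m - 1) \<otimes> xp (Suc m)) (K + Suc r)"
    unfolding pow_Suc' by (rule msum_cong) (simp add: scalar_tns_cmp)
  also have "\<dots> \<oplus> (W' r \<otimes> U) = msum H [Up] [Up] (\<lambda>m. ccw H k (int (Suc r) - int m - 1) \<otimes> xp m) (Suc (K + Suc r))"
    by (subst msum_Suc_shift) (simp_all add: ccw_nat add_commute del: msum.simps mpow.simps(2))
  finally show ?case by (simp del: msum.simps)
qed

lemma curl_ccw:
  "(d' \<otimes> U) \<bullet> (V \<otimes> xp r \<otimes> U) \<bullet> (V \<otimes> s) \<bullet> (c \<otimes> U)
    = msum_all H [Up] [Up] (\<lambda>m. ccw H k (int r - int m - 1) \<otimes> xp m)"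
  using lcurl_eq [of r] unfolding lcurl_def
  by (subst msum_all_eq [where N = "K + Suc r"]) (use k_nonneg in \<open>simp_all add: ccw_vanish\<close>)

lemma rcurl_sum_msum_all: "rcurl_sum r = msum_all H [Up] [Up] (\<lambda>m. xp m \<otimes> cw H k (int r - int m - 1))"
  unfolding rcurl_sum_def by (rule msum_all_eq [symmetric]) (use k_nonneg in \<open>simp_all add: cw_vanish\<close>)

lemma curl_cw:
  "(U \<otimes> d) \<bullet> (U \<otimes> xp r \<otimes> V) \<bullet> (s \<otimes> V) \<bullet> (U \<otimes> c')
    = mneg H (msum_all H [Up] [Up] (\<lambda>m. xp m \<otimes> cw H k (int r - int m - 1)))"
  using rcurl_eq [of r] by (simp add: rcurl_def lay flip: rcurl_sum_msum_all)

lemma curl_cw':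
  "(U \<otimes> d) \<bullet> (s \<otimes> V) \<bullet> (U \<otimes> xp r \<otimes> V) \<bullet> (U \<otimes> c')
    = mneg H (msum_all H [Up] [Up] (\<lambda>m. xp m \<otimes> cw H k (int r - int m - 1)))"
proof -
  have "(U \<otimes> d) \<bullet> (s \<otimes> V) \<bullet> (U \<otimes> xp r \<otimes> V) \<bullet> (U \<otimes> c')
    = ((U \<otimes> d) \<bullet> (s \<otimes> V)) \<bullet> (U \<otimes> xp r \<otimes> V) \<bullet> (U \<otimes> c')"
    by (simp add: cmp_assoc)
  also have "\<dots> = rcurl' r"
    unfolding cap_t [symmetric] by (simp add: rcurl'_def lay)
  finally show ?thesis by (simp add: rcurl'_eq flip: rcurl_sum_msum_all)
qed

text \<open>Rotated, this is up to sign the clockwise curl for the opposite charge.\<close>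

definition "lcurl' r = (d' \<otimes> U) \<bullet> (V \<otimes> s) \<bullet> (V \<otimes> xp r \<otimes> U) \<bullet> (c \<otimes> U)"

lemma lcurl'_eq: "lcurl' r = msum H [Up] [Up] (\<lambda>m. ccw H k (int r - int m - 1) \<otimes> xp m) (K + Suc r)"
proof (induction r)
  case 0
  have "lcurl' 0 = lcurl 0" by (simp add: lcurl_def lcurl'_def)
  then show ?case by (simp only: lcurl_eq)
next
  case (Suc r)
  have "lcurl' (Suc r) = (d' \<otimes> U) \<bullet> (V \<otimes> (s \<bullet> (x \<otimes> U))) \<bullet> (V \<otimes> xp r \<otimes> U) \<bullet> (c \<otimes> U)"
    by (simp add: lcurl'_def lay)
  also have "\<dots> = ((d' \<otimes> U) \<bullet> (I [Dn, Up] \<otimes> x)) \<bullet> (V \<otimes> s) \<bullet> (V \<otimes> xp r \<otimes> U) \<bullet> (c \<otimes> U)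
     \<oplus> (d' \<otimes> U) \<bullet> (V \<otimes> xp r \<otimes> U) \<bullet> (c \<otimes> U)"
    unfolding hecke' by (simp add: lin lay)
  also have "(d' \<otimes> U) \<bullet> (I [Dn, Up] \<otimes> x) = x \<bullet> (d' \<otimes> U)"
    using swap [of d' _ _ x] by simp
  also have "(d' \<otimes> U) \<bullet> (V \<otimes> xp r \<otimes> U) \<bullet> (c \<otimes> U) = W' r \<otimes> U"
    by (simp add: ccw0_def lay)
  finally have "lcurl' (Suc r) = x \<bullet> lcurl' r \<oplus> (W' r \<otimes> U)"
    by (simp add: lcurl'_def cmp_assoc)
  also have "x \<bullet> lcurl' r = msum H [Up] [Up] (\<lambda>m. x \<bullet> (ccw H k (int r - int m - 1) \<otimes> xp m)) (K + Suc r)"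
    unfolding Suc by (rule msum_cmp_left) simp_all
  also have "\<dots> = msum H [Up] [Up] (\<lambda>m. ccw H k (int r - int m - 1) \<otimes> xp (Suc m)) (K + Suc r)"
    by (rule msum_cong) (simp add: scalar_tns_cmp)
  also have "\<dots> \<oplus> (W' r \<otimes> U) = msum H [Up] [Up] (\<lambda>m. ccw H k (int (Suc r) - int m - 1) \<otimes> xp m) (Suc (K + Suc r))"
    by (subst msum_Suc_shift) (simp_all add: ccw_nat add_commute del: msum.simps mpow.simps(2))
  finally show ?case by (simp del: msum.simps)
qed

lemma curl_ccw':
  "(d' \<otimes> U) \<bullet> (V \<otimes> s) \<bullet> (V \<otimes> xp r \<otimes> U) \<bullet> (c \<otimes> U)
    = msum_all H [Up] [Up] (\<lambda>m. ccw H k (int r - int m - 1) \<otimes> xp m)"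
  using lcurl'_eq [of r] unfolding lcurl'_def
  by (subst msum_all_eq [where N = "K + Suc r"]) (use k_nonneg in \<open>simp_all add: ccw_vanish\<close>)

section \<open>Clockwise bubble slides\<close>

definition "slide_sum r = msum H [Up] [Up] (\<lambda>i. rcurl' i \<bullet> xp (r - Suc i)) r"

lemma slide_sum_Suc: "slide_sum (Suc r) = slide_sum r \<bullet> x \<oplus> rcurl' r"
proof -
  have "slide_sum r \<bullet> x = msum H [Up] [Up] (\<lambda>i. (rcurl' i \<bullet> xp (r - Suc i)) \<bullet> x) r"
    unfolding slide_sum_def by (rule msum_cmp_right) simp_all
  also have "\<dots> = msum H [Up] [Up] (\<lambda>i. rcurl' i \<bullet> xp (Suc r - Suc i)) r"
  proof (rule msum_cong)
    fix i assume "i < r"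
    then have "Suc r - Suc i = Suc (r - Suc i)" by simp
    then show "(rcurl' i \<bullet> xp (r - Suc i)) \<bullet> x = rcurl' i \<bullet> xp (Suc r - Suc i)"
      by (simp only: pow_Suc') (simp add: cmp_assoc)
  qed
  finally show ?thesis by (simp add: slide_sum_def)
qed

text \<open>The factor \<open>m + 1\<close> counts the ways to split \<open>m\<close> dots between
  the part produced by the curl and the rest of the strand. The term \<open>m = r\<close> carries a
  bubble of index -2, which is zero.\<close>

lemma slide_sum_eq:
  "slide_sum r = mneg H (msum H [Up] [Up] (\<lambda>m. smul H (of_nat (m + 1)) (xp m \<otimes> cw H k (int r - int m - 2))) (Suc r))"
proof (induction r)
  case 0
  then show ?case using k_nonneg by (simp add: slide_sum_def cw_vanish)
next
  case (Suc r)
  let ?G = "\<lambda>m. smul H (of_nat m) (xp m \<otimes> cw H k (int r - int m - 1))"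
  let ?S = "msum H [Up] [Up] (\<lambda>m. smul H (of_nat (m + 1)) (xp m \<otimes> cw H k (int r - int m - 2))) (Suc r)"
  have "?S \<bullet> x = msum H [Up] [Up] (\<lambda>m. smul H (of_nat (m + 1)) (xp m \<otimes> cw H k (int r - int m - 2)) \<bullet> x) (Suc r)"
    by (rule msum_cmp_right) simp_all
  also have "\<dots> = msum H [Up] [Up] (\<lambda>m. ?G (Suc m)) (Suc r)"
  proof (rule msum_cong)
    fix m
    have "(xp m \<otimes> cw H k (int r - int m - 2)) \<bullet> x = xp (Suc m) \<otimes> cw H k (int r - int m - 2)"
      using interchange [of "xp m" x "cw H k (int r - int m - 2)" "I []"] unfolding pow_Suc' by simp
    moreover have "cw H k (int r - int m - 2) = cw H k (int r - int (Suc m) - 1)"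
      by (rule arg_cong) simp
    ultimately have "(xp m \<otimes> cw H k (int r - int m - 2)) \<bullet> x = xp (Suc m) \<otimes> cw H k (int r - int (Suc m) - 1)"
      by (simp only:)
    then show "smul H (of_nat (m + 1)) (xp m \<otimes> cw H k (int r - int m - 2)) \<bullet> x = ?G (Suc m)"
      by (subst cmp_smul(1)) (simp_all only: Suc_eq_plus1 typing typing_pow typing_bubbles typing_gens append_Nil2)
  qed
  also have "\<dots> = msum H [Up] [Up] ?G (Suc (Suc r))"
    by (subst msum_Suc_shift [of "Suc r"]) (simp_all del: msum.simps)
  finally have S: "?S \<bullet> x = msum H [Up] [Up] ?G (Suc (Suc r))" .
  have "rcurl_sum r = msum H [Up] [Up] (\<lambda>m. xp m \<otimes> cw H k (int r - int m - 1)) (Suc (Suc r))"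
    unfolding rcurl_sum_def by (rule msum_extend [symmetric]) (use k_nonneg in \<open>simp_all add: cw_vanish\<close>)
  then have "?S \<bullet> x \<oplus> rcurl_sum r
      = msum H [Up] [Up] (\<lambda>m. ?G m \<oplus> (xp m \<otimes> cw H k (int r - int m - 1))) (Suc (Suc r))"
    unfolding S by (subst msum_add) simp_all
  also have "\<dots> = msum H [Up] [Up] (\<lambda>m. smul H (of_nat (m + 1)) (xp m \<otimes> cw H k (int (Suc r) - int m - 2))) (Suc (Suc r))"
  proof (rule msum_cong)
    fix m
    have e: "cw H k (int (Suc r) - int m - 2) = cw H k (int r - int m - 1)"
      by (rule arg_cong) simp
    show "?G m \<oplus> (xp m \<otimes> cw H k (int r - int m - 1))
      = smul H (of_nat (m + 1)) (xp m \<otimes> cw H k (int (Suc r) - int m - 2))"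
      unfolding e of_nat_add of_nat_1 smul_add_left by (simp only: smul_simps)
  qed
  finally show ?case
    by (simp add: slide_sum_Suc Suc rcurl'_eq flip: mneg_add del: msum.simps)
qed

text \<open>Inserting \<open>t \<bullet> \<tau>\<close> next to the cup and applying the pitchfork
  puts the bubble on the other side of the strand, crossed by it twice. Then \<open>dx_cross\<close>
  removes the crossings, and each of its corrections closes up to a curl.\<close>

lemma slide_cw:
  "cw H k r \<otimes> U = msub H (U \<otimes> cw H k r)
     (msum_all H [Up] [Up] (\<lambda>m. smul H (of_nat (m + 1)) (xp m \<otimes> cw H k (r - int m - 2))))"
proof (cases "0 \<le> r")
  case False
  \<comment> \<open>A bubble of negative index is zero or minus the identity here.\<close>
  then have "cw H k r \<otimes> U = U \<otimes> cw H k r"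
    using k_nonneg cw_low [of r] by auto
  moreover have "msum_all H [Up] [Up] (\<lambda>m. smul H (of_nat (m + 1)) (xp m \<otimes> cw H k (r - int m - 2))) = Z [Up] [Up]"
    by (subst msum_all_eq [where N = 0]) (use k_nonneg False in \<open>simp_all add: cw_vanish\<close>)
  ultimately show ?thesis by (simp add: msub_eq)
next
  case True
  define n where "n = nat r"
  have r: "r = int n" using True by (simp add: n_def)
  have "W n \<otimes> U = (dx n \<otimes> U) \<bullet> (c' \<otimes> U)"
    by (simp flip: whisker(2) W_eq)
  also have "c' \<otimes> U = (U \<otimes> (t \<bullet> \<tau>)) \<bullet> (c' \<otimes> U)" by (simp add: t_tau)
  also have "\<dots> = (U \<otimes> t) \<bullet> ((U \<otimes> \<tau>) \<bullet> (c' \<otimes> U))" by (simp add: lay)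
  also have "(dx n \<otimes> U) \<bullet> \<dots> = ((dx n \<otimes> U) \<bullet> (U \<otimes> t) \<bullet> (s \<otimes> V)) \<bullet> (U \<otimes> c')"
    unfolding pitchfork by (simp add: cmp_assoc)
  also have "\<dots> = (U \<otimes> dx n) \<bullet> (U \<otimes> c') \<oplus>
    msum H [Up, Up, Dn] [Up] (\<lambda>i. (d \<otimes> U) \<bullet> (xp (n - Suc i) \<otimes> (t \<bullet> (xp i \<otimes> V)))) n \<bullet> (U \<otimes> c')"
    unfolding dx_cross by (rule cmp_add) simp_all
  also have "(U \<otimes> dx n) \<bullet> (U \<otimes> c') = U \<otimes> W n"
    by (simp flip: whisker(1) W_eq)
  also have "msum H [Up, Up, Dn] [Up] (\<lambda>i. (d \<otimes> U) \<bullet> (xp (n - Suc i) \<otimes> (t \<bullet> (xp i \<otimes> V)))) n \<bullet> (U \<otimes> c')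
    = msum H [Up] [Up] (\<lambda>i. ((d \<otimes> U) \<bullet> (xp (n - Suc i) \<otimes> (t \<bullet> (xp i \<otimes> V)))) \<bullet> (U \<otimes> c')) n"
    by (rule msum_cmp_right) simp_all
  also have "\<dots> = slide_sum n"
    unfolding slide_sum_def
  proof (rule msum_cong)
    fix i
    have "(xp (n - Suc i) \<otimes> (t \<bullet> (xp i \<otimes> V))) \<bullet> (U \<otimes> c') = xp (n - Suc i) \<otimes> (t \<bullet> (xp i \<otimes> V) \<bullet> c')"
      by (simp add: cmp_assoc flip: interchange)
    also have "\<dots> = (U \<otimes> (t \<bullet> (xp i \<otimes> V) \<bullet> c')) \<bullet> xp (n - Suc i)"
      using tns_eq_cmp(2) [of "xp (n - Suc i)" "[Up]" "t \<bullet> (xp i \<otimes> V) \<bullet> c'" "[]"] by simp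
    finally show "((d \<otimes> U) \<bullet> (xp (n - Suc i) \<otimes> (t \<bullet> (xp i \<otimes> V)))) \<bullet> (U \<otimes> c') = rcurl' i \<bullet> xp (n - Suc i)"
      by (simp add: cmp_assoc rcurl'_def)
  qed
  also have "\<dots> = mneg H (msum_all H [Up] [Up] (\<lambda>m. smul H (of_nat (m + 1)) (xp m \<otimes> cw H k (int n - int m - 2))))"
    unfolding slide_sum_eq
    by (subst msum_all_eq [where N = "Suc n"]) (use k_nonneg in \<open>simp_all add: cw_vanish del: msum.simps\<close>)
  finally show ?thesis by (simp add: r cw_nat msub_eq)
qed

section \<open>Products of power series and counterclockwise slides\<close>

definition "conv f g n = msum H [Up] [Up] (\<lambda>i. f i \<bullet> g (n - i)) (Suc n)"

definition "endo f \<longleftrightarrow> (\<forall>n::nat. D (f n) = [Up] \<and> R (f n) = [Up])"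

lemma typing_conv [simp]: "endo f \<Longrightarrow> endo g \<Longrightarrow> endo (conv f g)"
  unfolding endo_def conv_def by (simp del: msum.simps)

lemma conv_commute:
  assumes "endo f" "endo g" "\<And>i j. f i \<bullet> g j = g j \<bullet> f i"
  shows "conv f g = conv g f"
proof
  fix n
  have "conv f g n = msum H [Up] [Up] (\<lambda>i. f (Suc n - Suc i) \<bullet> g (n - (Suc n - Suc i))) (Suc n)"
    unfolding conv_def by (rule msum_rev) (use assms in \<open>simp_all add: endo_def\<close>)
  also have "\<dots> = conv g f n"
    unfolding conv_def by (rule msum_cong) (simp add: assms(3))
  finally show "conv f g n = conv g f n" .
qed

lemma conv_assoc:
  assumes "endo f" "endo g" "endo h"
  shows "conv (conv f g) h = conv f (conv g h)"
proof
  fix n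
  have [simp]: "D (f i) = [Up]" "R (f i) = [Up]" "D (g i) = [Up]" "R (g i) = [Up]" "D (h i) = [Up]" "R (h i) = [Up]" for i
    using assms by (simp_all add: endo_def)
  have "conv (conv f g) h n = msum H [Up] [Up] (\<lambda>r. msum H [Up] [Up] (\<lambda>i. f i \<bullet> g (r - i) \<bullet> h (n - (i + (r - i)))) (Suc r)) (Suc n)"
    unfolding conv_def
  proof (rule msum_cong)
    fix r
    have "msum H [Up] [Up] (\<lambda>i. f i \<bullet> g (r - i)) (Suc r) \<bullet> h (n - r)
      = msum H [Up] [Up] (\<lambda>i. (f i \<bullet> g (r - i)) \<bullet> h (n - r)) (Suc r)"
      by (rule msum_cmp_right) simp_all
    also have "\<dots> = msum H [Up] [Up] (\<lambda>i. f i \<bullet> g (r - i) \<bullet> h (n - (i + (r - i)))) (Suc r)"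
      by (rule msum_cong) (simp add: cmp_assoc)
    finally show "msum H [Up] [Up] (\<lambda>i. f i \<bullet> g (r - i)) (Suc r) \<bullet> h (n - r) = \<dots>" .
  qed
  also have "\<dots> = msum H [Up] [Up] (\<lambda>i. msum H [Up] [Up] (\<lambda>j. f i \<bullet> g j \<bullet> h (n - (i + j))) (Suc n - i)) (Suc n)"
    by (rule msum_triangle) simp_all
  also have "\<dots> = conv f (conv g h) n"
    unfolding conv_def
  proof (rule msum_cong)
    fix i assume "i < Suc n"
    then have "Suc n - i = Suc (n - i)" by simp
    moreover have "f i \<bullet> msum H [Up] [Up] (\<lambda>j. g j \<bullet> h (n - i - j)) (Suc (n - i))
      = msum H [Up] [Up] (\<lambda>j. f i \<bullet> g j \<bullet> h (n - i - j)) (Suc (n - i))"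
      by (rule msum_cmp_left) simp_all
    ultimately show "msum H [Up] [Up] (\<lambda>j. f i \<bullet> g j \<bullet> h (n - (i + j))) (Suc n - i)
      = f i \<bullet> msum H [Up] [Up] (\<lambda>j. g j \<bullet> h (n - i - j)) (Suc (n - i))"
      by (simp del: msum.simps)
  qed
  finally show "conv (conv f g) h n = conv f (conv g h) n" .
qed

definition "neg_unit n = (if n = 0 then mneg H U else Z [Up] [Up])"

lemma endo_neg_unit [simp]: "endo neg_unit"
  by (simp add: endo_def neg_unit_def)

lemma conv_neg_unit:
  assumes "endo f"
  shows "conv neg_unit f = (\<lambda>n. mneg H (f n))"
proof
  fix n
  have "conv neg_unit f n = msum H [Up] [Up] (\<lambda>i. neg_unit i \<bullet> f (n - i)) (Suc 0)"
    unfolding conv_def by (rule msum_extend) (use assms in \<open>simp_all add: neg_unit_def endo_def\<close>)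
  then show "conv neg_unit f n = mneg H (f n)"
    using assms by (simp add: neg_unit_def endo_def)
qed

text \<open>The coefficients of \<open>1 - (u - x)\<^sup>-\<^sup>2\<close> as a power series in \<open>u\<^sup>-\<^sup>1\<close>.\<close>

definition "slide_coeff q = (case q of 0 \<Rightarrow> U | Suc 0 \<Rightarrow> Z [Up] [Up] | Suc (Suc m) \<Rightarrow> mneg H (smul H (of_nat (m + 1)) (xp m)))"

lemma endo_slide_coeff [simp]: "endo slide_coeff"
  by (simp add: endo_def slide_coeff_def split: nat.split)

text \<open>Translates a product with the slide series into the shape of the bubble slides. Here
  \<open>g\<close> is a reversed coefficient sequence continued by zeros past \<open>n\<close>,
  which lets the finite convolution match an unbounded sum.\<close>

lemma conv_slide_coeff:
  assumes "endo g" "\<And>q. n < q \<Longrightarrow> g q = Z [Up] [Up]"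
  shows "msum H [Up] [Up] (\<lambda>q. slide_coeff q \<bullet> g q) (Suc n)
    = msub H (g 0) (msum_all H [Up] [Up] (\<lambda>m. smul H (of_nat (m + 1)) (xp m \<bullet> g (m + 2))))"
proof -
  have [simp]: "D (g i) = [Up]" "R (g i) = [Up]" "D (slide_coeff i) = [Up]" "R (slide_coeff i) = [Up]" for i
    using assms(1) endo_slide_coeff by (simp_all only: endo_def)
  \<comment> \<open>The two added zero terms make up for the two coefficients split off next, so
    that the index shift by two ends at a sum of length \<open>Suc n\<close>.\<close>
  have "msum H [Up] [Up] (\<lambda>q. slide_coeff q \<bullet> g q) (Suc n) = msum H [Up] [Up] (\<lambda>q. slide_coeff q \<bullet> g q) (Suc (Suc (Suc n)))"
    by (rule msum_extend [symmetric]) (simp_all add: assms(2))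
  also have "\<dots> = slide_coeff 0 \<bullet> g 0 \<oplus> (slide_coeff (Suc 0) \<bullet> g (Suc 0) \<oplus> msum H [Up] [Up] (\<lambda>m. slide_coeff (Suc (Suc m)) \<bullet> g (Suc (Suc m))) (Suc n))"
    by (subst msum_Suc_shift, simp, simp, subst msum_Suc_shift) (simp_all del: msum.simps)
  also have "\<dots> = g 0 \<oplus> msum H [Up] [Up] (\<lambda>m. mneg H (smul H (of_nat (m + 1)) (xp m \<bullet> g (m + 2)))) (Suc n)"
    by (simp add: slide_coeff_def del: msum.simps)
  also have "msum H [Up] [Up] (\<lambda>m. mneg H (smul H (of_nat (m + 1)) (xp m \<bullet> g (m + 2)))) (Suc n)
    = mneg H (msum H [Up] [Up] (\<lambda>m. smul H (of_nat (m + 1)) (xp m \<bullet> g (m + 2))) (Suc n))"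
    by (rule msum_mneg [symmetric]) simp_all
  also have "msum H [Up] [Up] (\<lambda>m. smul H (of_nat (m + 1)) (xp m \<bullet> g (m + 2))) (Suc n)
    = msum_all H [Up] [Up] (\<lambda>m. smul H (of_nat (m + 1)) (xp m \<bullet> g (m + 2)))"
    by (rule msum_all_eq [symmetric]) (simp_all add: assms(2))
  finally show ?thesis by (simp only: msub_eq)
qed

lemma scalar_left: "D \<beta> = [] \<Longrightarrow> R \<beta> = [] \<Longrightarrow> D f = [Up] \<Longrightarrow> R f = [Up] \<Longrightarrow> f \<bullet> (\<beta> \<otimes> U) = \<beta> \<otimes> f"
  "D \<beta> = [] \<Longrightarrow> R \<beta> = [] \<Longrightarrow> D f = [Up] \<Longrightarrow> R f = [Up] \<Longrightarrow> (\<beta> \<otimes> U) \<bullet> f = \<beta> \<otimes> f"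
  by (simp_all add: scalar_tns_cmp)

lemma scalar_right: "D \<beta> = [] \<Longrightarrow> R \<beta> = [] \<Longrightarrow> D f = [Up] \<Longrightarrow> R f = [Up] \<Longrightarrow> f \<bullet> (U \<otimes> \<beta>) = f \<otimes> \<beta>"
  "D \<beta> = [] \<Longrightarrow> R \<beta> = [] \<Longrightarrow> D f = [Up] \<Longrightarrow> R f = [Up] \<Longrightarrow> (U \<otimes> \<beta>) \<bullet> f = f \<otimes> \<beta>"
  using tns_eq_cmp(1) [of f "[Up]" \<beta> "[]"] tns_eq_cmp(2) [of f "[Up]" \<beta> "[]"] by simp_all

text \<open>The series of A and B are inverse to each other up to sign on both sides of the strand, so
  the slide for A by the invertible factor slide_coeff determines the one for B.\<close>

lemma slide_B: "(\<lambda>n. U \<otimes> B n) = conv slide_coeff (\<lambda>n. B n \<otimes> U)"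
proof -
  define LA RA LB RB where "LA = (\<lambda>n. A n \<otimes> U)" and "RA = (\<lambda>n. U \<otimes> A n)"
    and "LB = (\<lambda>n. B n \<otimes> U)" and "RB = (\<lambda>n. U \<otimes> B n)"
  have en [simp]: "endo LA" "endo RA" "endo LB" "endo RB"
    by (simp_all add: endo_def LA_def RA_def LB_def RB_def)
  have sc [simp]: "D (slide_coeff i) = [Up]" "R (slide_coeff i) = [Up]" for i
    using endo_slide_coeff by (simp_all only: endo_def)
  have "LA = conv slide_coeff RA"
  proof
    fix n
    have "LA n = msub H (U \<otimes> cw H k (int n + k - 1))
     (msum_all H [Up] [Up] (\<lambda>m. smul H (of_nat (m + 1)) (xp m \<otimes> cw H k (int n + k - 1 - int m - 2))))"
      unfolding LA_def A_def by (rule slide_cw)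
    also have "\<dots> = msum H [Up] [Up] (\<lambda>q. slide_coeff q \<bullet> (U \<otimes> cw H k (int n + k - 1 - int q))) (Suc n)"
      using conv_slide_coeff [of "\<lambda>q. U \<otimes> cw H k (int n + k - 1 - int q)" n]
      by (simp add: endo_def cw_vanish scalar_right diff_diff_eq del: msum.simps of_nat_add)
    also have "\<dots> = conv slide_coeff RA n"
      unfolding conv_def by (rule msum_cong) (simp add: RA_def A_def of_nat_diff algebra_simps)
    finally show "LA n = conv slide_coeff RA n" .
  qed
  moreover have "conv LA LB = neg_unit"
  proof
    fix n
    have "conv LA LB n = msum H [Up] [Up] (\<lambda>i. (A i \<bullet> B (n - i)) \<otimes> U) (Suc n)"
      unfolding conv_def LA_def LB_def by (rule msum_cong) (simp add: whisker)
    also have "\<dots> = msum H [] [] (\<lambda>i. A i \<bullet> B (n - i)) (Suc n) \<otimes> U"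
      by (rule msum_tns_right [symmetric]) simp_all
    finally show "conv LA LB n = neg_unit n" by (simp add: grassmannian_nat neg_unit_def del: msum.simps)
  qed
  moreover have "conv RA RB = neg_unit"
  proof
    fix n
    have "conv RA RB n = msum H [Up] [Up] (\<lambda>i. U \<otimes> (A i \<bullet> B (n - i))) (Suc n)"
      unfolding conv_def RA_def RB_def by (rule msum_cong) (simp add: whisker)
    also have "\<dots> = U \<otimes> msum H [] [] (\<lambda>i. A i \<bullet> B (n - i)) (Suc n)"
      by (rule msum_tns_left [symmetric]) simp_all
    finally show "conv RA RB n = neg_unit n" by (simp add: grassmannian_nat neg_unit_def del: msum.simps)
  qed
  moreover have "conv LB RB = conv RB LB"
    by (rule conv_commute) (simp_all add: endo_def LB_def RB_def scalar_left)
  \<comment> \<open>The product of \<open>LA\<close>, \<open>LB\<close> and \<open>RB\<close> is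
    evaluated in two ways. Replacing \<open>LA\<close> by the slide series times \<open>RA\<close>
    and commuting \<open>LB\<close> past \<open>RB\<close> brings \<open>RA\<close> next to
    \<open>RB\<close>, and they cancel up to sign.\<close>
  ultimately have "conv neg_unit RB = conv slide_coeff (conv RA (conv RB LB))"
    by (metis conv_assoc en endo_slide_coeff typing_conv)
  also have "\<dots> = conv slide_coeff (conv neg_unit LB)"
    using \<open>conv RA RB = neg_unit\<close> by (metis conv_assoc en)
  also have "\<dots> = conv (conv neg_unit slide_coeff) LB"
  proof -
    have "conv neg_unit slide_coeff = conv slide_coeff neg_unit"
      by (rule conv_commute) (auto simp: neg_unit_def)
    then show ?thesis by (simp add: conv_assoc)
  qed
  also have "\<dots> = conv neg_unit (conv slide_coeff LB)"
    by (simp add: conv_assoc)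
  finally have "mneg H (RB n) = mneg H (conv slide_coeff LB n)" for n
    by (simp add: conv_neg_unit fun_eq_iff)
  then have "RB = conv slide_coeff LB" by (simp add: mneg_eq_iff fun_eq_iff)
  then show ?thesis by (simp add: LB_def RB_def)
qed

lemma slide_ccw:
  "U \<otimes> ccw H k r = msub H (ccw H k r \<otimes> U)
     (msum_all H [Up] [Up] (\<lambda>m. smul H (of_nat (m + 1)) (ccw H k (r - int m - 2) \<otimes> xp m)))"
proof (cases "r < - k - 1")
  case True
  then have "msum_all H [Up] [Up] (\<lambda>m. smul H (of_nat (m + 1)) (ccw H k (r - int m - 2) \<otimes> xp m)) = Z [Up] [Up]"
    by (subst msum_all_eq [where N = 0]) (simp_all add: ccw_vanish)
  then show ?thesis using True by (simp add: msub_eq ccw_vanish)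
next
  case False
  define n where "n = nat (r + k + 1)"
  have r: "r = int n - k - 1" using False by (simp add: n_def)
  have "U \<otimes> ccw H k r = conv slide_coeff (\<lambda>n. B n \<otimes> U) n"
    using slide_B by (simp add: r B_def fun_eq_iff)
  also have "\<dots> = msum H [Up] [Up] (\<lambda>q. slide_coeff q \<bullet> (ccw H k (r - int q) \<otimes> U)) (Suc n)"
    unfolding conv_def by (rule msum_cong) (simp add: B_def r of_nat_diff algebra_simps)
  also have "\<dots> = msub H (ccw H k r \<otimes> U)
     (msum_all H [Up] [Up] (\<lambda>m. smul H (of_nat (m + 1)) (ccw H k (r - int m - 2) \<otimes> xp m)))"
    using conv_slide_coeff [of "\<lambda>q. ccw H k (r - int q) \<otimes> U" n]
    by (simp add: endo_def ccw_vanish scalar_left r diff_diff_eq del: msum.simps of_nat_add)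
  finally show ?thesis .
qed

section \<open>Alternating braid relation\<close>

definition "braid_term a b m = ccw H k (- int a - int b - int m - 3) \<otimes>
  ((xp a \<otimes> V) \<bullet> c' \<bullet> dx b) \<otimes> xp m"

lemma typing_braid_term [simp]: "D (braid_term a b m) = [Up, Dn, Up]" "R (braid_term a b m) = [Up, Dn, Up]"
  by (simp_all add: braid_term_def)

lemma braid_term_vanish: "K - 1 \<le> a + b + m \<Longrightarrow> braid_term a b m = Z [Up, Dn, Up] [Up, Dn, Up]"
  using k_nonneg by (simp add: braid_term_def ccw_vanish)

lemma braid_term_msum_all:
  "msum_all H [Up, Dn, Up] [Up, Dn, Up] (\<lambda>a. msum_all H [Up, Dn, Up] [Up, Dn, Up] (\<lambda>b.
     msum_all H [Up, Dn, Up] [Up, Dn, Up] (braid_term a b)))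
   = msum H [Up, Dn, Up] [Up, Dn, Up] (\<lambda>a. msum H [Up, Dn, Up] [Up, Dn, Up] (\<lambda>b.
     msum H [Up, Dn, Up] [Up, Dn, Up] (braid_term a b) (K - 1)) (K - 1)) (K - 1)"
  by (rule msum_all_box) (simp_all add: braid_term_vanish)

definition "braid_l = (tt' H k \<otimes> U) \<bullet> (V \<otimes> s) \<bullet> (t \<otimes> U)"
definition "braid_r = (U \<otimes> t) \<bullet> (s \<otimes> V) \<bullet> (U \<otimes> tt' H k)"

lemma typing_braids [simp]: "D braid_l = [Up, Dn, Up]" "R braid_l = [Up, Dn, Up]" "D braid_r = [Up, Dn, Up]" "R braid_r = [Up, Dn, Up]"
  by (simp_all add: braid_l_def braid_r_def tt'_eq)

text \<open>The main term of \<open>dx_cross\<close> contains a short cap on \<open>\<tau>\<close>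
  and vanishes. In the corrections fewer than \<open>K\<close> dots sit between \<open>t\<close> and
  \<open>\<tau>\<close>, so \<open>t_pow_tau\<close> removes both.\<close>

lemma dx_braid_r:
  assumes "r < K"
  shows "(dx r \<otimes> U) \<bullet> braid_r = msum H [Up, Dn, Up] [Up] (\<lambda>i. dx (r - Suc i) \<otimes> xp i) r"
proof -
  have "(dx r \<otimes> U) \<bullet> braid_r = ((dx r \<otimes> U) \<bullet> (U \<otimes> t) \<bullet> (s \<otimes> V)) \<bullet> (U \<otimes> \<tau>)"
    by (simp add: braid_r_def tt'_eq cmp_assoc)
  also have "\<dots> = (U \<otimes> dx r) \<bullet> (U \<otimes> \<tau>) \<oplus>
    msum H [Up, Up, Dn] [Up] (\<lambda>i. (d \<otimes> U) \<bullet> (xp (r - Suc i) \<otimes> (t \<bullet> (xp i \<otimes> V)))) r \<bullet> (U \<otimes> \<tau>)"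
    unfolding dx_cross by (rule cmp_add) simp_all
  also have "(U \<otimes> dx r) \<bullet> (U \<otimes> \<tau>) = U \<otimes> (dx r \<bullet> \<tau>)"
    by (simp add: lay)
  also have "msum H [Up, Up, Dn] [Up] (\<lambda>i. (d \<otimes> U) \<bullet> (xp (r - Suc i) \<otimes> (t \<bullet> (xp i \<otimes> V)))) r \<bullet> (U \<otimes> \<tau>)
    = msum H [Up, Dn, Up] [Up] (\<lambda>i. ((d \<otimes> U) \<bullet> (xp (r - Suc i) \<otimes> (t \<bullet> (xp i \<otimes> V)))) \<bullet> (U \<otimes> \<tau>)) r"
    by (rule msum_cmp_right) simp_all
  also have "\<dots> = msum H [Up, Dn, Up] [Up] (\<lambda>i. dx (r - Suc i) \<otimes> xp i) r"
  proof (rule msum_cong)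
    fix i assume i: "i < r"
    have "(xp (r - Suc i) \<otimes> (t \<bullet> (xp i \<otimes> V))) \<bullet> (U \<otimes> \<tau>) = xp (r - Suc i) \<otimes> (t \<bullet> (xp i \<otimes> V) \<bullet> \<tau>)"
      by (simp add: cmp_assoc flip: interchange)
    also have "\<dots> = xp (r - Suc i) \<otimes> V \<otimes> xp i"
      using i assms by (simp add: t_pow_tau)
    finally have "((d \<otimes> U) \<bullet> (xp (r - Suc i) \<otimes> (t \<bullet> (xp i \<otimes> V)))) \<bullet> (U \<otimes> \<tau>)
      = (d \<otimes> U) \<bullet> ((xp (r - Suc i) \<otimes> V) \<otimes> xp i)"
      by (simp add: cmp_assoc)
    also have "\<dots> = dx (r - Suc i) \<otimes> xp i"
      by (subst interchange [symmetric]) simp_all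
    finally show "((d \<otimes> U) \<bullet> (xp (r - Suc i) \<otimes> (t \<bullet> (xp i \<otimes> V)))) \<bullet> (U \<otimes> \<tau>) = dx (r - Suc i) \<otimes> xp i" .
  qed
  finally show ?thesis using assms by (simp add: dx_tau)
qed

lemma cup_sum_dx:
  assumes "r < K" "i < r"
  shows "(cup_sum (K - Suc r) \<otimes> U) \<bullet> (dx (r - Suc i) \<otimes> xp i)
    = msum H [Up, Dn, Up] [Up, Dn, Up] (\<lambda>j. braid_term j (r - Suc i) i) (K - 1)"
proof -
  let ?h = "dx (r - Suc i) \<otimes> xp i" and ?o = "[Up, Dn, Up]"
  have "(cup_sum (K - Suc r) \<otimes> U) \<bullet> ?h
    = msum H ?o ?o (\<lambda>j. (((xp j \<otimes> V) \<bullet> c' \<bullet> B (K - Suc r - j)) \<otimes> U) \<bullet> ?h) (Suc (K - Suc r))"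
    unfolding cup_sum_def by (rule msum_additive [where \<phi> = "\<lambda>z. (z \<otimes> U) \<bullet> ?h"]) (simp_all add: lin)
  also have "\<dots> = msum H ?o ?o (\<lambda>j. braid_term j (r - Suc i) i) (Suc (K - Suc r))"
  proof (rule msum_cong)
    fix j assume j: "j < Suc (K - Suc r)"
    let ?e = "(xp j \<otimes> V) \<bullet> c'"
    \<comment> \<open>With \<open>a = j\<close>, \<open>b = r - Suc i\<close> and
      \<open>m = i\<close> one has \<open>r = a' + 1\<close> for \<open>a' = b + m\<close>, so the
      bubble index \<open>- j - r - 2\<close> becomes \<open>- a - b - m - 3\<close>.\<close>
    have b: "B (K - Suc r - j) = ccw H k (- int j - int (r - Suc i) - int i - 3)"
      unfolding B_def by (rule arg_cong) (use j assms k_nonneg in simp)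
    have "((?e \<bullet> B (K - Suc r - j)) \<otimes> U) \<bullet> ?h = ((B (K - Suc r - j) \<otimes> ?e) \<otimes> U) \<bullet> ?h"
      by (simp add: scalar_tns_state)
    also have "\<dots> = B (K - Suc r - j) \<otimes> ((?e \<otimes> U) \<bullet> ?h)"
      using scalar_tns_cmp(1) [of "B (K - Suc r - j)" "?e \<otimes> U" ?h] by simp
    also have "(?e \<otimes> U) \<bullet> ?h = (?e \<bullet> dx (r - Suc i)) \<otimes> xp i"
      by (subst interchange [symmetric]) simp_all
    finally show "(((xp j \<otimes> V) \<bullet> c' \<bullet> B (K - Suc r - j)) \<otimes> U) \<bullet> ?h = braid_term j (r - Suc i) i"
      by (simp add: braid_term_def cmp_assoc flip: b)
  qed
  also have "\<dots> = msum H ?o ?o (\<lambda>j. braid_term j (r - Suc i) i) (K - 1)"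
    by (rule msum_extend [symmetric]) (use assms in \<open>simp_all add: braid_term_vanish\<close>)
  finally show ?thesis .
qed

text \<open>Inserting \<open>t \<bullet> \<tau>\<close> at the bottom and applying
  \<open>braid_t\<close> shows that the left side is \<open>(\<tau> \<bullet> t) \<otimes> U\<close>
  after \<open>braid_r\<close>. The identity term of \<open>tau_t\<close> gives
  \<open>braid_r\<close>, its defect the triple sum.\<close>

lemma braid_l_eq: "braid_l = braid_r \<oplus> msum H [Up, Dn, Up] [Up, Dn, Up] (\<lambda>a. msum H [Up, Dn, Up] [Up, Dn, Up] (\<lambda>b.
     msum H [Up, Dn, Up] [Up, Dn, Up] (braid_term a b) (K - 1)) (K - 1)) (K - 1)"
proof -
  let ?o = "[Up, Dn, Up]"
  let ?F = "\<lambda>i b. msum H ?o ?o (\<lambda>j. braid_term j b i) (K - 1)"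
  let ?T = "\<lambda>r. msum H ?o ?o (\<lambda>i. (cup_sum (K - Suc r) \<otimes> U) \<bullet> (dx (r - Suc i) \<otimes> xp i)) r"
  have "(V \<otimes> s) \<bullet> (t \<otimes> U) = (V \<otimes> s) \<bullet> (t \<otimes> U) \<bullet> (U \<otimes> (t \<bullet> \<tau>))"
    by (simp add: t_tau)
  also have "\<dots> = ((V \<otimes> s) \<bullet> (t \<otimes> U) \<bullet> (U \<otimes> t)) \<bullet> (U \<otimes> \<tau>)"
    by (simp add: lay)
  also have "\<dots> = (t \<otimes> U) \<bullet> braid_r"
    unfolding braid_t [symmetric] by (simp add: braid_r_def tt'_eq cmp_assoc)
  finally have "braid_l = ((\<tau> \<bullet> t) \<otimes> U) \<bullet> braid_r"
    by (simp add: braid_l_def tt'_eq lay)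
  also have "\<dots> = braid_r \<oplus> (msum H [Up, Dn] [Up, Dn] (\<lambda>r. cup_sum (K - Suc r) \<bullet> dx r) K \<otimes> U) \<bullet> braid_r"
    unfolding tau_t by (simp add: lin)
  also have "(msum H [Up, Dn] [Up, Dn] (\<lambda>r. cup_sum (K - Suc r) \<bullet> dx r) K \<otimes> U) \<bullet> braid_r
    = msum H ?o ?o (\<lambda>r. ((cup_sum (K - Suc r) \<bullet> dx r) \<otimes> U) \<bullet> braid_r) K"
    by (rule msum_additive [where \<phi> = "\<lambda>z. (z \<otimes> U) \<bullet> braid_r"]) (simp_all add: lin)
  also have "\<dots> = msum H ?o ?o ?T K"
  proof (rule msum_cong)
    fix r assume r: "r < K"
    have "((cup_sum (K - Suc r) \<bullet> dx r) \<otimes> U) \<bullet> braid_r = (cup_sum (K - Suc r) \<otimes> U) \<bullet> ((dx r \<otimes> U) \<bullet> braid_r)"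
      by (simp add: lay)
    also have "\<dots> = ?T r"
      unfolding dx_braid_r [OF r] by (rule msum_cmp_left) simp_all
    finally show "((cup_sum (K - Suc r) \<bullet> dx r) \<otimes> U) \<bullet> braid_r = ?T r" .
  qed
  \<comment> \<open>The summand for \<open>r = 0\<close> is an empty sum. Dropping it shifts
    \<open>r\<close> by one, which gives the triangular form and the length
    \<open>K - 1\<close>.\<close>
  also have "\<dots> = msum H ?o ?o (\<lambda>r. msum H ?o ?o (\<lambda>i. ?F i (r - i)) (Suc r)) (K - 1)"
  proof (cases K)
    case (Suc n)
    have "msum H ?o ?o ?T K = ?T 0 \<oplus> msum H ?o ?o (\<lambda>r. ?T (Suc r)) n"
      unfolding Suc by (rule msum_Suc_shift) simp_all
    also have "\<dots> = msum H ?o ?o (\<lambda>r. ?T (Suc r)) n"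
      by (simp del: msum.simps(2))
    also have "\<dots> = msum H ?o ?o (\<lambda>r. msum H ?o ?o (\<lambda>i. ?F i (r - i)) (Suc r)) n"
    proof (rule msum_cong, rule msum_cong)
      fix r i assume "r < n" "i < Suc r"
      then show "(cup_sum (K - Suc (Suc r)) \<otimes> U) \<bullet> (dx (Suc r - Suc i) \<otimes> xp i) = ?F i (r - i)"
        using cup_sum_dx [of "Suc r" i] Suc by simp
    qed
    finally show ?thesis by (simp only: Suc diff_Suc_1)
  qed simp
  also have "\<dots> = msum H ?o ?o (\<lambda>i. msum H ?o ?o (?F i) (K - 1 - i)) (K - 1)"
    by (rule msum_triangle) simp_all
  \<comment> \<open>The triangle is filled up to a box with terms whose bubble vanishes; in a box
    the order of summation is free.\<close>
  also have "\<dots> = msum H ?o ?o (\<lambda>i. msum H ?o ?o (?F i) (K - 1)) (K - 1)"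
    by (rule msum_cong, rule msum_extend [symmetric]) (simp_all add: msum_zero braid_term_vanish)
  also have "\<dots> = msum H ?o ?o (\<lambda>i. msum H ?o ?o (\<lambda>a. msum H ?o ?o (\<lambda>b. braid_term a b i) (K - 1)) (K - 1)) (K - 1)"
    by (rule msum_cong, rule msum_swap) simp_all
  also have "\<dots> = msum H ?o ?o (\<lambda>a. msum H ?o ?o (\<lambda>i. msum H ?o ?o (\<lambda>b. braid_term a b i) (K - 1)) (K - 1)) (K - 1)"
    by (rule msum_swap) simp_all
  also have "\<dots> = msum H ?o ?o (\<lambda>a. msum H ?o ?o (\<lambda>b. msum H ?o ?o (braid_term a b) (K - 1)) (K - 1)) (K - 1)"
    by (rule msum_cong, rule msum_swap) simp_all
  finally show ?thesis .
qed

lemma alternating_braid: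
  "msub H braid_l braid_r = msum_all H [Up, Dn, Up] [Up, Dn, Up] (\<lambda>a. msum_all H [Up, Dn, Up] [Up, Dn, Up] (\<lambda>b.
     msum_all H [Up, Dn, Up] [Up, Dn, Up] (braid_term a b)))"
proof -
  let ?o = "[Up, Dn, Up]"
  let ?S = "msum H ?o ?o (\<lambda>a. msum H ?o ?o (\<lambda>b. msum H ?o ?o (braid_term a b) (K - 1)) (K - 1)) (K - 1)"
  have "braid_l = ?S \<oplus> braid_r" using braid_l_eq by (simp add: add_commute)
  then have "braid_l \<oplus> mneg H braid_r = ?S"
    by (subst eq_add_iff [symmetric]) simp_all
  then show ?thesis by (simp add: msub_eq braid_term_msum_all)
qed

lemma alternating_braid_le_1:
  assumes "k \<le> 1"
  shows "msub H braid_l braid_r = Z [Up, Dn, Up] [Up, Dn, Up]"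
  using alternating_braid assms by (simp add: braid_term_msum_all)

end

section \<open>Rotation and negative central charge\<close>

text \<open>Rotation by 180 degrees. The sign on the crossing is forced by the Hecke relation; c' and d'
  are exchanged up to sign, and so are the two kinds of bubbles.\<close>

definition rot :: "('k::comm_ring_1, 'm) heis \<Rightarrow> ('k, 'm) heis" where
  "rot H = \<lparr>dom = (\<lambda>f. rev (cod H f)), cod = (\<lambda>f. rev (dom H f)),
    cmp = (\<lambda>f g. cmp H g f), tns = (\<lambda>f g. tns H g f), idm = (\<lambda>a. idm H (rev a)),
    add = add H, zer = (\<lambda>a b. zer H (rev b) (rev a)), smul = smul H,
    gx = gx H, gs = mneg H (gs H), gc = gd H, gd = gc H, gtau = mneg H (gtau H),
    ge = gf H, gf = ge H\<rparr>"

lemma rot_sel [simp]: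
  "dom (rot H) f = rev (cod H f)" "cod (rot H) f = rev (dom H f)"
  "cmp (rot H) f g = cmp H g f" "tns (rot H) f g = tns H g f" "idm (rot H) a = idm H (rev a)"
  "add (rot H) = add H" "zer (rot H) a b = zer H (rev b) (rev a)" "smul (rot H) = smul H"
  "gx (rot H) = gx H" "gs (rot H) = mneg H (gs H)" "gc (rot H) = gd H" "gd (rot H) = gc H"
  "gtau (rot H) = mneg H (gtau H)" "ge (rot H) = gf H" "gf (rot H) = ge H"
  by (simp_all add: rot_def)

lemma rot_ops [simp]:
  "mneg (rot H) f = mneg H f" "msub (rot H) f g = msub H f g"
  "msum (rot H) a b F n = msum H (rev b) (rev a) F n"
  "msum_all (rot H) a b F = msum_all H (rev b) (rev a) F"
proof -
  show m: "msum (rot H) a b F n = msum H (rev b) (rev a) F n" for n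
    by (induction n) simp_all
  show "msum_all (rot H) a b F = msum_all H (rev b) (rev a) F"
    by (simp add: msum_all_def m)
qed (simp_all add: mneg_def msub_def)

context heis
begin

lemma rot_axioms: "lmcat_axioms (rot H)"
  unfolding lmcat_axioms_def hom_def mem_Collect_eq rot_sel
  by (intro conjI allI impI; (elim conjE)?)
    (simp_all add: rev_swap cmp_assoc interchange cmp_add tns_add add_ac smul_add_left smul_add_right flip: mneg_def)

lemma pow_rot: "mpow (rot H) [Up] x n = xp n"
  by (induction n) (use pow_comm in simp_all)

lemma tt_rot: "tt (rot H) = mneg H t"
  by (simp add: tt_def cmp_assoc)

end

section \<open>Transfer to negative charge\<close>

locale heis_neg = heis +
  assumes k_neg: "k < 0"
begin

abbreviation "f' \<equiv> gf H"
abbreviation "c' \<equiv> cc' H k"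
abbreviation "d' \<equiv> dd' H k"

lemma rel_neg:
  shows "int r < - k \<Longrightarrow> f' r \<in> hom H [Dn, Up] []"
  and "t \<bullet> \<tau> \<oplus> msum H [Dn, Up] [Dn, Up] (\<lambda>r. ((V \<otimes> xp r) \<bullet> c) \<bullet> f' r) (nat (- k)) = I [Dn, Up]"
  and "\<tau> \<bullet> t = I [Up, Dn]"
  and "int r < - k \<Longrightarrow> \<tau> \<bullet> (V \<otimes> xp r) \<bullet> c = Z [] [Up, Dn]"
  and "int r < - k \<Longrightarrow> f' r \<bullet> t = Z [Up, Dn] []"
  and "int r < - k \<Longrightarrow> int q < - k \<Longrightarrow> f' r \<bullet> (V \<otimes> xp q) \<bullet> c = (if r = q then I [] else Z [] [])"
proof -
  have *: "(\<forall>r. int r < - k \<longrightarrow> f' r \<in> hom H [Dn, Up] []) \<and>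
    t \<bullet> \<tau> \<oplus> msum H [Dn, Up] [Dn, Up] (\<lambda>r. ((V \<otimes> xp r) \<bullet> c) \<bullet> f' r) (nat (- k)) = I [Dn, Up] \<and>
    \<tau> \<bullet> t = I [Up, Dn] \<and>
    (\<forall>r. int r < - k \<longrightarrow> \<tau> \<bullet> (V \<otimes> xp r) \<bullet> c = Z [] [Up, Dn]) \<and>
    (\<forall>r. int r < - k \<longrightarrow> f' r \<bullet> t = Z [Up, Dn] []) \<and>
    (\<forall>r q. int r < - k \<and> int q < - k \<longrightarrow> f' r \<bullet> (V \<otimes> xp q) \<bullet> c = (if r = q then I [] else Z [] []))"
    by (rule mp [OF _ k_neg], insert rel, unfold heis_rel_def, elim conjE) assumption
  then show "t \<bullet> \<tau> \<oplus> msum H [Dn, Up] [Dn, Up] (\<lambda>r. ((V \<otimes> xp r) \<bullet> c) \<bullet> f' r) (nat (- k)) = I [Dn, Up]"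
    "\<tau> \<bullet> t = I [Up, Dn]"
    by blast+
  from * show "int r < - k \<Longrightarrow> f' r \<in> hom H [Dn, Up] []"
    "int r < - k \<Longrightarrow> \<tau> \<bullet> (V \<otimes> xp r) \<bullet> c = Z [] [Up, Dn]"
    "int r < - k \<Longrightarrow> f' r \<bullet> t = Z [Up, Dn] []"
    "int r < - k \<Longrightarrow> int q < - k \<Longrightarrow> f' r \<bullet> (V \<otimes> xp q) \<bullet> c = (if r = q then I [] else Z [] [])"
    by blast+
qed

lemma typing_f [simp]: "int r < - k \<Longrightarrow> D (f' r) = [Dn, Up]" "int r < - k \<Longrightarrow> R (f' r) = []"
  using rel_neg(1) [of r] by (simp_all add: hom_def)

text \<open>In (I) the rotation exchanges dotted cups with dotted caps and the families
  \<open>e\<close> and \<open>f\<close>. As \<open>t\<close> contains one crossing it changes sign;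
  giving \<open>\<tau>\<close> the same sign keeps their products unchanged.\<close>

lemma rot_rel: "heis_rel (rot H) (- k)"
  unfolding heis_rel_def tt_rot pow_rot rot_sel rot_ops
proof (intro conjI impI allI)
  show "cmp H (mneg H s) (mneg H s) = idm H (rev [Up, Up])"
    by (simp add: ss)
  have "msub H (mneg H s \<bullet> (U \<otimes> x)) ((x \<otimes> U) \<bullet> mneg H s) = msub H ((x \<otimes> U) \<bullet> s) (s \<bullet> (U \<otimes> x))"
    by (simp add: msub_eq add_commute)
  then show "msub H (mneg H s \<bullet> (idm H (rev [Up]) \<otimes> x)) ((x \<otimes> idm H (rev [Up])) \<bullet> mneg H s) = idm H (rev [Up, Up])"
    using hecke_msub by simp
qed (use k_neg rel_neg braid zigzag_Up zigzag_Dn in \<open>simp_all add: hom_def cmp_assoc\<close>)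

sublocale rotated: heis_nonneg "rot H" "- k"
  by unfold_locales (use rot_axioms rot_rel k_neg in simp_all)

lemma cc'_rot: "cc' (rot H) (- k) = mneg H d'"
  using k_neg by (simp add: cc'_def dd'_def)

lemma typing_c'd' [simp]: "D c' = []" "R c' = [Up, Dn]" "D d' = [Dn, Up]" "R d' = []"
  using k_neg by (simp_all add: cc'_def dd'_def)

lemma dd'_rot: "dd' (rot H) (- k) = mneg H c'"
  using k_neg by (simp add: cc'_def dd'_def pow_rot cmp_assoc)

lemma cw0_rot: "cw0 (rot H) (- k) n = mneg H (ccw0 H k n)"
  and ccw0_rot: "ccw0 (rot H) (- k) n = mneg H (cw0 H k n)"
  by (simp_all add: cw0_def ccw0_def cc'_rot dd'_rot pow_rot cmp_assoc)

lemma typing_bubbles0 [simp]: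
  "D (cw0 H k n) = []" "R (cw0 H k n) = []" "D (ccw0 H k n) = []" "R (ccw0 H k n) = []"
  by (simp_all add: cw0_def ccw0_def)

text \<open>The rotation reverses the products in the cofactor expansion, which is harmless because
  endomorphisms of the unit commute.\<close>

lemma mdet_rot:
  assumes "\<And>i j. D (M i j) = []" "\<And>i j. R (M i j) = []"
  shows "mdet (rot H) n M = mdet H n M"
  using assms
proof (induction n arbitrary: M)
  case (Suc n)
  have "mdet (rot H) n (\<lambda>i l. M (Suc i) (if l < j then l else Suc l)) = mdet H n (\<lambda>i l. M (Suc i) (if l < j then l else Suc l))" for j
    by (rule Suc.IH) (simp_all add: Suc.prems)
  moreover have "M 0 j \<bullet> mdet H n (\<lambda>i l. M (Suc i) (if l < j then l else Suc l))
    = mdet H n (\<lambda>i l. M (Suc i) (if l < j then l else Suc l)) \<bullet> M 0 j" for j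
    by (rule scalar_commute) (simp_all add: Suc.prems)
  ultimately show ?case by (simp del: msum.simps)
qed simp

text \<open>The minus signs in the clockwise determinantal formula are exactly those that the
  rotation puts on the bubbles, so the sign rule for nonnegative indices persists for negative
  ones.\<close>

lemma cw_rot: "cw (rot H) (- k) n = mneg H (ccw H k n)"
  and ccw_rot: "ccw (rot H) (- k) n = mneg H (cw H k n)"
  by (simp_all add: cw_def ccw_def idet_def cw0_rot ccw0_rot mdet_rot)

lemma typing_bubbles [simp]: "D (cw H k r) = []" "R (cw H k r) = []" "D (ccw H k r) = []" "R (ccw H k r) = []"
  using rotated.typing_bubbles [of r] by (simp_all add: cw_rot ccw_rot)

lemma tt'_rot: "tt' (rot H) (- k) = mneg H (tt' H k)"
  by (simp add: tt'_def cc'_rot dd'_rot cmp_assoc)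

lemmas rot = cc'_rot dd'_rot cw_rot ccw_rot pow_rot tt_rot tt'_rot

lemma neg_iff: "mneg H f = g \<longleftrightarrow> f = mneg H g"
  using mneg_eq_iff [of f "mneg H g"] by simp

lemma cw_low: "r < k \<Longrightarrow> cw H k r = (if r = k - 1 then mneg H (I []) else Z [] [])"
  using rotated.ccw_low [of r] by (simp add: rot neg_iff)

lemma cw_vanish: "r < k - 1 \<Longrightarrow> cw H k r = Z [] []"
  using cw_low [of r] by simp

lemma ccw_low: "r < - k \<Longrightarrow> ccw H k r = (if r = - k - 1 then I [] else Z [] [])"
  using rotated.cw_low [of r] by (simp add: rot neg_iff split: if_splits)

lemma grassmannian:
  "msum H [] [] (\<lambda>r. cw H k (int r + k - 1) \<bullet> ccw H k (m - int r - k - 1)) (nat (m + 1))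
    = (if m = 0 then mneg H (I []) else Z [] [])"
proof -
  let ?F = "\<lambda>r. cw H k (m - int r + k - 1) \<bullet> ccw H k (int r - k - 1)"
  have "msum H [] [] (\<lambda>r. ccw H k (int r - k - 1) \<bullet> cw H k (m - int r + k - 1)) (nat (m + 1))
    = (if m = 0 then mneg H (I []) else Z [] [])"
    using rotated.grassmannian [of m] scalar_commute by (simp add: rot)
  also have "(\<lambda>r. ccw H k (int r - k - 1) \<bullet> cw H k (m - int r + k - 1)) = ?F"
    using scalar_commute by simp
  finally have "msum H [] [] ?F (nat (m + 1)) = (if m = 0 then mneg H (I []) else Z [] [])" .
  \<comment> \<open>The rotation exchanges the two bubble series, so the running index sits on the
    wrong factor and the sum is reversed.\<close>
  moreover have "msum H [] [] ?F (nat (m + 1)) = msum H [] [] (\<lambda>r. ?F (nat (m + 1) - Suc r)) (nat (m + 1))"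
    by (rule msum_rev) simp_all
  moreover have "\<dots> = msum H [] [] (\<lambda>r. cw H k (int r + k - 1) \<bullet> ccw H k (m - int r - k - 1)) (nat (m + 1))"
    by (rule msum_cong) (simp add: of_nat_diff algebra_simps)
  ultimately show ?thesis by simp
qed

lemma left_zigzag_Up: "(U \<otimes> d') \<bullet> (c' \<otimes> U) = U"
  and left_zigzag_Dn: "(d' \<otimes> V) \<bullet> (V \<otimes> c') = V"
  using rotated.left_zigzag_Up rotated.left_zigzag_Dn by (simp_all add: rot)

lemma mates_x:
  "(V \<otimes> d) \<bullet> (V \<otimes> x \<otimes> V) \<bullet> (c \<otimes> V) = (d' \<otimes> V) \<bullet> (V \<otimes> x \<otimes> V) \<bullet> (V \<otimes> c')"
  using rotated.mates_x by (simp add: rot cmp_assoc)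

lemma mates_s:
  "(I [Dn, Dn] \<otimes> (d \<bullet> (U \<otimes> d \<otimes> V))) \<bullet> (I [Dn, Dn] \<otimes> s \<otimes> I [Dn, Dn]) \<bullet> (((V \<otimes> c \<otimes> U) \<bullet> c) \<otimes> I [Dn, Dn])
  = ((d' \<bullet> (V \<otimes> d' \<otimes> U)) \<otimes> I [Dn, Dn]) \<bullet> (I [Dn, Dn] \<otimes> s \<otimes> I [Dn, Dn]) \<bullet> (I [Dn, Dn] \<otimes> ((U \<otimes> c' \<otimes> V) \<bullet> c'))"
  using rotated.mates_s by (simp add: rot lay mneg_eq_iff)

lemma curl_ccw:
  "(d' \<otimes> U) \<bullet> (V \<otimes> xp r \<otimes> U) \<bullet> (V \<otimes> s) \<bullet> (c \<otimes> U)
    = msum_all H [Up] [Up] (\<lambda>m. ccw H k (int r - int m - 1) \<otimes> xp m)"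
  using rotated.curl_cw' [of r] by (simp add: rot cmp_assoc msum_all_mneg)

lemma curl_cw:
  "(U \<otimes> d) \<bullet> (U \<otimes> xp r \<otimes> V) \<bullet> (s \<otimes> V) \<bullet> (U \<otimes> c')
    = mneg H (msum_all H [Up] [Up] (\<lambda>m. xp m \<otimes> cw H k (int r - int m - 1)))"
  using rotated.curl_ccw' [of r] by (simp add: rot cmp_assoc msum_all_mneg)

lemma msub_mneg:
  "D f = D g \<Longrightarrow> R f = R g \<Longrightarrow> msub H (mneg H f) (mneg H g) = mneg H (msub H f g)"
  by (simp add: msub_eq mneg_add)

lemma slide_cw:
  "cw H k r \<otimes> U = msub H (U \<otimes> cw H k r)
     (msum_all H [Up] [Up] (\<lambda>m. smul H (of_nat (m + 1)) (xp m \<otimes> cw H k (r - int m - 2))))"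
proof -
  have "mneg H (cw H k r \<otimes> U) = msub H (mneg H (U \<otimes> cw H k r))
     (mneg H (msum_all H [Up] [Up] (\<lambda>m. smul H (of_nat (m + 1)) (xp m \<otimes> cw H k (r - int m - 2)))))"
    using rotated.slide_ccw [of r] by (simp add: rot msum_all_mneg)
  then show ?thesis by (simp add: msub_mneg msum_all_def mneg_eq_iff del: of_nat_add)
qed

lemma slide_ccw:
  "U \<otimes> ccw H k r = msub H (ccw H k r \<otimes> U)
     (msum_all H [Up] [Up] (\<lambda>m. smul H (of_nat (m + 1)) (ccw H k (r - int m - 2) \<otimes> xp m)))"
proof -
  have "mneg H (U \<otimes> ccw H k r) = msub H (mneg H (ccw H k r \<otimes> U))
     (mneg H (msum_all H [Up] [Up] (\<lambda>m. smul H (of_nat (m + 1)) (ccw H k (r - int m - 2) \<otimes> xp m))))"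
    using rotated.slide_cw [of r] by (simp add: rot msum_all_mneg)
  then show ?thesis by (simp add: msub_mneg msum_all_def mneg_eq_iff del: of_nat_add)
qed

definition "braid_term a b m = xp m \<otimes> ((V \<otimes> xp a) \<bullet> c \<bullet> d' \<bullet> (V \<otimes> xp b)) \<otimes> cw H k (- int a - int b - int m - 3)"
definition "braid_l = (tt' H k \<otimes> U) \<bullet> (V \<otimes> s) \<bullet> (t \<otimes> U)"
definition "braid_r = (U \<otimes> t) \<bullet> (s \<otimes> V) \<bullet> (U \<otimes> tt' H k)"

lemma typing_tt' [simp]: "D (tt' H k) = [Dn, Up]" "R (tt' H k) = [Up, Dn]"
  by (simp_all add: tt'_def)

lemma braid_term_rot: "rotated.braid_term a b m = braid_term b a m"
proof -
  have "- int a - int b - int m - 3 = - int b - int a - int m - 3" by simp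
  then show ?thesis by (simp only: rotated.braid_term_def braid_term_def) (simp add: rot cmp_assoc)
qed

text \<open>Each side is a product of \<open>t\<close>, \<open>s\<close> and \<open>t'\<close>, and
  each of these contributes one sign.\<close>

lemma braids_rot: "rotated.braid_l = mneg H braid_r" "rotated.braid_r = mneg H braid_l"
  by (simp_all add: rotated.braid_l_def rotated.braid_r_def braid_l_def braid_r_def rot cmp_assoc)

lemma msub_braids: "msub H (mneg H braid_r) (mneg H braid_l) = msub H braid_l braid_r"
  by (simp add: msub_eq add_commute braid_l_def braid_r_def)

lemma alternating_braid:
  "msub H braid_l braid_r = msum_all H [Up, Dn, Up] [Up, Dn, Up] (\<lambda>a. msum_all H [Up, Dn, Up] [Up, Dn, Up] (\<lambda>b.
     msum_all H [Up, Dn, Up] [Up, Dn, Up] (braid_term a b)))"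
proof -
  have "msub H braid_l braid_r = msum_all H [Up, Dn, Up] [Up, Dn, Up] (\<lambda>a. msum_all H [Up, Dn, Up] [Up, Dn, Up] (\<lambda>b.
     msum_all H [Up, Dn, Up] [Up, Dn, Up] (braid_term b a)))"
    using rotated.alternating_braid by (simp add: braids_rot msub_braids braid_term_rot [abs_def])
  \<comment> \<open>Reversing composition exchanged the dots above and below the cup-cap pair, that
    is, \<open>a\<close> and \<open>b\<close>.\<close>
  also have "\<dots> = msum_all H [Up, Dn, Up] [Up, Dn, Up] (\<lambda>a. msum_all H [Up, Dn, Up] [Up, Dn, Up] (\<lambda>b.
     msum_all H [Up, Dn, Up] [Up, Dn, Up] (braid_term a b)))"
    by (rule msum_all_swap [where N = "nat (- k)"]) (use k_neg in \<open>simp_all add: braid_term_def cw_vanish\<close>)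
  finally show ?thesis .
qed

lemma alternating_braid_ge_minus_1:
  assumes "- 1 \<le> k"
  shows "msub H braid_l braid_r = Z [Up, Dn, Up] [Up, Dn, Up]"
  using rotated.alternating_braid_le_1 assms by (simp add: braids_rot msub_braids)

end

section \<open>The relations for arbitrary central charge\<close>

theorem theorem1p3:
  fixes H :: "('k::comm_ring_1, 'm) heis" and k :: int
  assumes "lmcat_axioms H" and "heis_rel H k"
  shows
  "(\<forall>r. r < k \<longrightarrow> cw H k r = (if r = k - 1 then mneg H (idm H []) else zer H [] [])) \<and>
   (\<forall>r. r < - k \<longrightarrow> ccw H k r = (if r = - k - 1 then idm H [] else zer H [] [])) \<and>
   (\<forall>m::int. msum H [] [] (\<lambda>r. cmp H (cw H k (int r + k - 1)) (ccw H k (m - int r - k - 1))) (nat (m + 1))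
        = (if m = 0 then mneg H (idm H []) else zer H [] [])) \<and>
   cmp H (tns H (idm H [Up]) (dd' H k)) (tns H (cc' H k) (idm H [Up])) = idm H [Up] \<and>
   cmp H (tns H (dd' H k) (idm H [Dn])) (tns H (idm H [Dn]) (cc' H k)) = idm H [Dn] \<and>
   cmp H (tns H (idm H [Dn]) (gd H)) (cmp H (tns H (idm H [Dn]) (tns H (gx H) (idm H [Dn]))) (tns H (gc H) (idm H [Dn])))
     = cmp H (tns H (dd' H k) (idm H [Dn])) (cmp H (tns H (idm H [Dn]) (tns H (gx H) (idm H [Dn]))) (tns H (idm H [Dn]) (cc' H k))) \<and>
   cmp H (tns H (idm H [Dn, Dn]) (cmp H (gd H) (tns H (idm H [Up]) (tns H (gd H) (idm H [Dn])))))
     (cmp H (tns H (idm H [Dn, Dn]) (tns H (gs H) (idm H [Dn, Dn])))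
        (tns H (cmp H (tns H (idm H [Dn]) (tns H (gc H) (idm H [Up]))) (gc H)) (idm H [Dn, Dn])))
   = cmp H (tns H (cmp H (dd' H k) (tns H (idm H [Dn]) (tns H (dd' H k) (idm H [Up])))) (idm H [Dn, Dn]))
     (cmp H (tns H (idm H [Dn, Dn]) (tns H (gs H) (idm H [Dn, Dn])))
        (tns H (idm H [Dn, Dn]) (cmp H (tns H (idm H [Up]) (tns H (cc' H k) (idm H [Dn]))) (cc' H k)))) \<and>
   (\<forall>r::nat.
      cmp H (tns H (dd' H k) (idm H [Up]))
        (cmp H (tns H (idm H [Dn]) (tns H (mpow H [Up] (gx H) r) (idm H [Up])))
           (cmp H (tns H (idm H [Dn]) (gs H)) (tns H (gc H) (idm H [Up]))))
      = msum_all H [Up] [Up] (\<lambda>m. tns H (ccw H k (int r - int m - 1)) (mpow H [Up] (gx H) m)) \<and>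
      cmp H (tns H (idm H [Up]) (gd H))
        (cmp H (tns H (idm H [Up]) (tns H (mpow H [Up] (gx H) r) (idm H [Dn])))
           (cmp H (tns H (gs H) (idm H [Dn])) (tns H (idm H [Up]) (cc' H k))))
      = mneg H (msum_all H [Up] [Up] (\<lambda>m. tns H (mpow H [Up] (gx H) m) (cw H k (int r - int m - 1))))) \<and>
   (\<forall>r::int.
      tns H (idm H [Up]) (ccw H k r)
      = msub H (tns H (ccw H k r) (idm H [Up]))
          (msum_all H [Up] [Up] (\<lambda>m. smul H (of_nat (m + 1)) (tns H (ccw H k (r - int m - 2)) (mpow H [Up] (gx H) m)))) \<and>
      tns H (cw H k r) (idm H [Up])
      = msub H (tns H (idm H [Up]) (cw H k r))
          (msum_all H [Up] [Up] (\<lambda>m. smul H (of_nat (m + 1)) (tns H (mpow H [Up] (gx H) m) (cw H k (r - int m - 2)))))) \<and>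
   (let D1 = cmp H (tns H (tt' H k) (idm H [Up])) (cmp H (tns H (idm H [Dn]) (gs H)) (tns H (tt H) (idm H [Up])));
        D2 = cmp H (tns H (idm H [Up]) (tt H)) (cmp H (tns H (gs H) (idm H [Dn])) (tns H (idm H [Up]) (tt' H k)))
    in (2 \<le> k \<longrightarrow> msub H D1 D2 =
          msum_all H [Up, Dn, Up] [Up, Dn, Up] (\<lambda>a. msum_all H [Up, Dn, Up] [Up, Dn, Up] (\<lambda>b.
            msum_all H [Up, Dn, Up] [Up, Dn, Up] (\<lambda>m.
              tns H (ccw H k (- int a - int b - int m - 3))
                (tns H (cmp H (tns H (mpow H [Up] (gx H) a) (idm H [Dn]))
                          (cmp H (cc' H k) (cmp H (gd H) (tns H (mpow H [Up] (gx H) b) (idm H [Dn])))))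
                   (mpow H [Up] (gx H) m)))))) \<and>
       (- 1 \<le> k \<and> k \<le> 1 \<longrightarrow> msub H D1 D2 = zer H [Up, Dn, Up] [Up, Dn, Up]) \<and>
       (k \<le> - 2 \<longrightarrow> msub H D1 D2 =
          msum_all H [Up, Dn, Up] [Up, Dn, Up] (\<lambda>a. msum_all H [Up, Dn, Up] [Up, Dn, Up] (\<lambda>b.
            msum_all H [Up, Dn, Up] [Up, Dn, Up] (\<lambda>m.
              tns H (mpow H [Up] (gx H) m)
                (tns H (cmp H (tns H (idm H [Dn]) (mpow H [Up] (gx H) a))
                          (cmp H (gc H) (cmp H (dd' H k) (tns H (idm H [Dn]) (mpow H [Up] (gx H) b)))))
                   (cw H k (- int a - int b - int m - 3))))))))"
proof (cases "0 \<le> k")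
  case True
  then interpret heis_nonneg H k
    using assms by unfold_locales
  show ?thesis
    unfolding Let_def
    using cw_low ccw_low grassmannian left_zigzag_Up left_zigzag_Dn mates_x mates_s curl_ccw curl_cw
      slide_ccw slide_cw alternating_braid [unfolded braid_l_def braid_r_def braid_term_def]
      alternating_braid_le_1 [unfolded braid_l_def braid_r_def] True
    by (intro conjI allI impI) simp_all
next
  case False
  then interpret heis_neg H k
    using assms by unfold_locales simp_all
  show ?thesis
    unfolding Let_def
    using cw_low ccw_low grassmannian left_zigzag_Up left_zigzag_Dn mates_x mates_s curl_ccw curl_cw
      slide_ccw slide_cw alternating_braid [unfolded braid_l_def braid_r_def braid_term_def]
      alternating_braid_ge_minus_1 [unfolded braid_l_def braid_r_def] False
    by (intro conjI allI impI) simp_all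
qed

end
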